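(* Let $(M,\omega_1,\dots,\omega_s)$ be a polysymplectic manifold. The space of Riemannian metrics on $M$ compatible with the polysymplectic structure is non-empty and contractible.
   Context: For a $2$-form $\alpha$, $\alpha^\perp$ denotes the distribution of vectors $v$ with $\iota_v\alpha=0$. A polysymplectic structure on a vector space $V$ of dimension $n(s+1)$ is given by $\omega_1,\dots,\omega_s\in\Lambda^2V^*$ for which there is a basis $v_1,\dots,v_n,w^1_1,\dots,w^s_n$ of $V$ (a standard polysymplectic basis) with $\omega_j=\sum_{i=1}^n v_i^*\wedge (w_i^j)^*$ for all $j$. A polysymplectic manifold is a smooth manifold of dimension $n(s+1)$ with smooth closed $2$-forms $\omega_1,\dots,\omega_s$ inducing a polysymplectic structure on each tangent space and such that $\sum_j\omega_j^\perp$ is an integrable distribution. A Riemannian metric on $M$ is compatible with the polysymplectic structure if for every $p\in M$ there is a standard polysymplectic basis of $T_pM$ which is also orthonormal. The space of compatible metrics carries the topology induced from the $C^\infty$ topology (uniform convergence of all derivatives on compact sets) on smooth symmetric $2$-tensors. *)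

theory Defs
  imports "HOL-Analysis.Analysis" "HOL-Library.Function_Algebras"
begin

text \<open>Functions into a real vector space form a real vector space. This makes the notions
  \<open>subspace\<close>, \<open>span\<close>, \<open>independent\<close>, \<open>representation\<close> available for tangent spaces below.\<close>

instantiation "fun" :: (type, real_vector) real_vector
begin

definition scaleR_fun :: "real \<Rightarrow> ('a \<Rightarrow> 'b) \<Rightarrow> 'a \<Rightarrow> 'b"
  where "scaleR_fun r f = (\<lambda>x. r *\<^sub>R f x)"

instance
  by standard (simp_all add: scaleR_fun_def plus_fun_def fun_eq_iff scaleR_add_right scaleR_add_left)

end


subsection \<open>Smooth maps between Euclidean spaces\<close>

primrec C_k_on :: "nat \<Rightarrow> 'e::euclidean_space set \<Rightarrow> ('e \<Rightarrow> 'f::real_normed_vector) \<Rightarrow> bool" where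
  "C_k_on 0 S f \<longleftrightarrow> continuous_on S f"
| "C_k_on (Suc k) S f \<longleftrightarrow>
     (\<forall>x\<in>S. f differentiable (at x)) \<and> (\<forall>v. C_k_on k S (\<lambda>x. frechet_derivative f (at x) v))"

text \<open>Only used for open \<open>S\<close>.\<close>

definition smooth_on :: "'e::euclidean_space set \<Rightarrow> ('e \<Rightarrow> 'f::real_normed_vector) \<Rightarrow> bool"
  where "smooth_on S f \<longleftrightarrow> (\<forall>k. C_k_on k S f)"

primrec iter_deriv :: "'e::euclidean_space list \<Rightarrow> ('e \<Rightarrow> real) \<Rightarrow> 'e \<Rightarrow> real" where
  "iter_deriv [] f = f"
| "iter_deriv (v # vs) f = (\<lambda>x. frechet_derivative (iter_deriv vs f) (at x) v)"


subsection \<open>Smooth manifolds\<close>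

text \<open>A chart is a pair of a domain and a coordinate map; the values of the coordinate map outside
  the domain are irrelevant. The dimension of the manifold is the dimension of the model space
  \<^typ>\<open>'e::euclidean_space\<close>.\<close>

type_synonym ('m, 'e) chart = "'m set \<times> ('m \<Rightarrow> 'e)"

definition is_chart :: "'m topology \<Rightarrow> ('m, 'e::euclidean_space) chart \<Rightarrow> bool"
  where "is_chart M c \<longleftrightarrow>
    openin M (fst c) \<and> open (snd c ` fst c) \<and>
    homeomorphic_map (subtopology M (fst c)) (top_of_set (snd c ` fst c)) (snd c)"

definition chart_inv :: "('m, 'e) chart \<Rightarrow> 'e \<Rightarrow> 'm"
  where "chart_inv c = inv_into (fst c) (snd c)"

definition transition :: "('m, 'e) chart \<Rightarrow> ('m, 'e) chart \<Rightarrow> 'e \<Rightarrow> 'e"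
  where "transition c c' = snd c' \<circ> chart_inv c"

definition smoothly_compatible :: "('m, 'e::euclidean_space) chart \<Rightarrow> ('m, 'e) chart \<Rightarrow> bool"
  where "smoothly_compatible c c' \<longleftrightarrow>
    smooth_on (snd c ` (fst c \<inter> fst c')) (transition c c') \<and>
    smooth_on (snd c' ` (fst c \<inter> fst c')) (transition c' c)"

definition smooth_atlas :: "'m topology \<Rightarrow> ('m, 'e::euclidean_space) chart set \<Rightarrow> bool"
  where "smooth_atlas M A \<longleftrightarrow>
    (\<forall>c\<in>A. is_chart M c) \<and> (\<Union>c\<in>A. fst c) = topspace M \<and>
    (\<forall>c\<in>A. \<forall>c'\<in>A. smoothly_compatible c c')"

definition smooth_manifold :: "'m topology \<Rightarrow> ('m, 'e::euclidean_space) chart set \<Rightarrow> bool"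
  where "smooth_manifold M A \<longleftrightarrow>
    Hausdorff_space M \<and> second_countable M \<and> smooth_atlas M A \<and>
    (\<forall>c. is_chart M c \<and> (\<forall>c'\<in>A. smoothly_compatible c c') \<longrightarrow> c \<in> A)"


subsection \<open>Tangent vectors and covariant 2-tensors\<close>

text \<open>A tangent vector at \<open>p\<close> is the family of its coordinate vectors in all charts around \<open>p\<close>; these
  transform by the derivatives of the coordinate changes. The family is zero at all other charts,
  so that tangent spaces are linear subspaces of the type of such families.\<close>

type_synonym ('m, 'e) tvec = "('m, 'e) chart \<Rightarrow> 'e"

type_synonym ('m, 'e) tensor2 = "'m \<Rightarrow> ('m, 'e) tvec \<Rightarrow> ('m, 'e) tvec \<Rightarrow> real"

definition charts_at :: "('m, 'e) chart set \<Rightarrow> 'm \<Rightarrow> ('m, 'e) chart set"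
  where "charts_at A p = {c \<in> A. p \<in> fst c}"

definition tangent_space :: "('m, 'e::euclidean_space) chart set \<Rightarrow> 'm \<Rightarrow> ('m, 'e) tvec set"
  where "tangent_space A p =
    {X. (\<forall>c \<in> charts_at A p. \<forall>c' \<in> charts_at A p.
           X c' = frechet_derivative (transition c c') (at (snd c p)) (X c)) \<and>
        (\<forall>c. c \<notin> charts_at A p \<longrightarrow> X c = 0)}"

text \<open>The tangent vector at \<open>p\<close> with coordinates \<open>u\<close> in the chart \<open>c\<close> (where \<open>p \<in> fst c\<close>).\<close>

definition coord_vector ::
    "('m, 'e::euclidean_space) chart set \<Rightarrow> ('m, 'e) chart \<Rightarrow> 'm \<Rightarrow> 'e \<Rightarrow> ('m, 'e) tvec"
  where "coord_vector A c p u =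
    (\<lambda>c'. if c' \<in> charts_at A p then frechet_derivative (transition c c') (at (snd c p)) u else 0)"

definition bilinear_form_on :: "'v::real_vector set \<Rightarrow> ('v \<Rightarrow> 'v \<Rightarrow> real) \<Rightarrow> bool"
  where "bilinear_form_on V b \<longleftrightarrow>
    (\<forall>X\<in>V. \<forall>Y\<in>V. \<forall>Z\<in>V. \<forall>r.
       b (X + Y) Z = b X Z + b Y Z \<and> b (r *\<^sub>R X) Z = r * b X Z \<and>
       b Z (X + Y) = b Z X + b Z Y \<and> b Z (r *\<^sub>R X) = r * b Z X)"

text \<open>\<open>local_rep A T c x u w\<close> is the value of \<open>T\<close> at the point with coordinates \<open>x\<close> on the vectors with
  coordinates \<open>u\<close> and \<open>w\<close>, all with respect to the chart \<open>c\<close>.\<close>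

definition local_rep ::
    "('m, 'e::euclidean_space) chart set \<Rightarrow> ('m, 'e) tensor2 \<Rightarrow> ('m, 'e) chart \<Rightarrow> 'e \<Rightarrow> 'e \<Rightarrow> 'e \<Rightarrow> real"
  where "local_rep A T c x u w =
    (let p = chart_inv c x in T p (coord_vector A c p u) (coord_vector A c p w))"

text \<open>The value zero outside the tangent spaces is a normalization, which makes two tensor fields
  equal as functions iff they agree on all tangent spaces.\<close>

definition smooth_tensor2 ::
    "'m topology \<Rightarrow> ('m, 'e::euclidean_space) chart set \<Rightarrow> ('m, 'e) tensor2 \<Rightarrow> bool"
  where "smooth_tensor2 M A T \<longleftrightarrow>
    (\<forall>p\<in>topspace M. bilinear_form_on (tangent_space A p) (T p)) \<and>
    (\<forall>p X Y. \<not> (p \<in> topspace M \<and> X \<in> tangent_space A p \<and> Y \<in> tangent_space A p) \<longrightarrow> T p X Y = 0) \<and>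
    (\<forall>c\<in>A. \<forall>u w. smooth_on (snd c ` fst c) (\<lambda>x. local_rep A T c x u w))"

definition smooth_2form ::
    "'m topology \<Rightarrow> ('m, 'e::euclidean_space) chart set \<Rightarrow> ('m, 'e) tensor2 \<Rightarrow> bool"
  where "smooth_2form M A \<alpha> \<longleftrightarrow>
    smooth_tensor2 M A \<alpha> \<and> (\<forall>p\<in>topspace M. \<forall>X\<in>tangent_space A p. \<alpha> p X X = 0)"

text \<open>The exterior derivative of a 2-form in the chart \<open>c\<close>, at the coordinates \<open>x\<close>, evaluated on the
  constant coordinate vector fields \<open>u\<close>, \<open>v\<close>, \<open>w\<close> (whose Lie brackets vanish).\<close>

definition local_ext_deriv ::
    "('m, 'e::euclidean_space) chart set \<Rightarrow> ('m, 'e) tensor2 \<Rightarrow> ('m, 'e) chart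
      \<Rightarrow> 'e \<Rightarrow> 'e \<Rightarrow> 'e \<Rightarrow> 'e \<Rightarrow> real"
  where "local_ext_deriv A \<alpha> c x u v w =
    frechet_derivative (\<lambda>y. local_rep A \<alpha> c y v w) (at x) u -
    frechet_derivative (\<lambda>y. local_rep A \<alpha> c y u w) (at x) v +
    frechet_derivative (\<lambda>y. local_rep A \<alpha> c y u v) (at x) w"

definition closed_2form :: "('m, 'e::euclidean_space) chart set \<Rightarrow> ('m, 'e) tensor2 \<Rightarrow> bool"
  where "closed_2form A \<alpha> \<longleftrightarrow>
    (\<forall>c\<in>A. \<forall>x \<in> snd c ` fst c. \<forall>u v w. local_ext_deriv A \<alpha> c x u v w = 0)"

text \<open>A distribution is integrable if around each point there is a chart (of the maximal atlas) in
  which it is spanned by a fixed set of coordinate directions, i.e. if it is tangent to a foliation.\<close>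

definition integrable_distribution ::
    "'m topology \<Rightarrow> ('m, 'e::euclidean_space) chart set \<Rightarrow> ('m \<Rightarrow> ('m, 'e) tvec set) \<Rightarrow> bool"
  where "integrable_distribution M A D \<longleftrightarrow>
    (\<forall>p\<in>topspace M. \<exists>c \<in> charts_at A p. \<exists>F. subspace F \<and>
       (\<forall>q\<in>fst c. D q = {X \<in> tangent_space A q. X c \<in> F}))"


subsection \<open>Polysymplectic structures\<close>

definition basis_vectors :: "nat \<Rightarrow> nat \<Rightarrow> (nat \<Rightarrow> 'v) \<Rightarrow> (nat \<Rightarrow> nat \<Rightarrow> 'v) \<Rightarrow> 'v set"
  where "basis_vectors n s v w = v ` {1..n} \<union> (\<lambda>(j, i). w j i) ` ({1..s} \<times> {1..n})"

definition wedge :: "('v \<Rightarrow> real) \<Rightarrow> ('v \<Rightarrow> real) \<Rightarrow> 'v \<Rightarrow> 'v \<Rightarrow> real"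
  where "wedge \<alpha> \<beta> X Y = \<alpha> X * \<beta> Y - \<alpha> Y * \<beta> X"

text \<open>\<open>w j i\<close> stands for \<open>w\<^sup>j\<^sub>i\<close>. The cardinality condition says that the listed vectors are pairwise
  distinct. For a basis \<open>B\<close> and \<open>b \<in> B\<close>, the dual basis vector \<open>b\<^sup>*\<close> is
  \<open>\<lambda>X. representation B X b\<close>.\<close>

definition standard_polysymplectic_basis ::
    "'v::real_vector set \<Rightarrow> nat \<Rightarrow> nat \<Rightarrow> (nat \<Rightarrow> 'v \<Rightarrow> 'v \<Rightarrow> real)
      \<Rightarrow> (nat \<Rightarrow> 'v) \<Rightarrow> (nat \<Rightarrow> nat \<Rightarrow> 'v) \<Rightarrow> bool"
  where "standard_polysymplectic_basis V n s \<omega> v w \<longleftrightarrow>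
    (let B = basis_vectors n s v w; dual = (\<lambda>b X. representation B X b) in
       independent B \<and> span B = V \<and> card B = n * (s + 1) \<and>
       (\<forall>j\<in>{1..s}. \<forall>X\<in>V. \<forall>Y\<in>V.
          \<omega> j X Y = (\<Sum>i = 1..n. wedge (dual (v i)) (dual (w j i)) X Y)))"

definition polysymplectic_structure ::
    "'v::real_vector set \<Rightarrow> nat \<Rightarrow> nat \<Rightarrow> (nat \<Rightarrow> 'v \<Rightarrow> 'v \<Rightarrow> real) \<Rightarrow> bool"
  where "polysymplectic_structure V n s \<omega> \<longleftrightarrow>
    (\<exists>v w. standard_polysymplectic_basis V n s \<omega> v w)"

definition perp :: "('m, 'e::euclidean_space) chart set \<Rightarrow> ('m, 'e) tensor2 \<Rightarrow> 'm \<Rightarrow> ('m, 'e) tvec set"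
  where "perp A \<alpha> p = {X \<in> tangent_space A p. \<forall>Y\<in>tangent_space A p. \<alpha> p X Y = 0}"

text \<open>The span of a union of subspaces is their sum.\<close>

definition polysymplectic_manifold ::
    "'m topology \<Rightarrow> ('m, 'e::euclidean_space) chart set \<Rightarrow> nat \<Rightarrow> nat
      \<Rightarrow> (nat \<Rightarrow> ('m, 'e) tensor2) \<Rightarrow> bool"
  where "polysymplectic_manifold M A n s \<omega> \<longleftrightarrow>
    smooth_manifold M A \<and> DIM('e) = n * (s + 1) \<and>
    (\<forall>j\<in>{1..s}. smooth_2form M A (\<omega> j) \<and> closed_2form A (\<omega> j)) \<and>
    (\<forall>p\<in>topspace M. polysymplectic_structure (tangent_space A p) n s (\<lambda>j. \<omega> j p)) \<and>
    integrable_distribution M A (\<lambda>p. span (\<Union>j\<in>{1..s}. perp A (\<omega> j) p))"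


subsection \<open>Compatible metrics and their topology\<close>

definition sym_tensors ::
    "'m topology \<Rightarrow> ('m, 'e::euclidean_space) chart set \<Rightarrow> ('m, 'e) tensor2 set"
  where "sym_tensors M A =
    {T. smooth_tensor2 M A T \<and>
        (\<forall>p\<in>topspace M. \<forall>X\<in>tangent_space A p. \<forall>Y\<in>tangent_space A p. T p X Y = T p Y X)}"

definition riemannian_metric ::
    "'m topology \<Rightarrow> ('m, 'e::euclidean_space) chart set \<Rightarrow> ('m, 'e) tensor2 \<Rightarrow> bool"
  where "riemannian_metric M A g \<longleftrightarrow>
    g \<in> sym_tensors M A \<and>
    (\<forall>p\<in>topspace M. \<forall>X\<in>tangent_space A p. X \<noteq> 0 \<longrightarrow> g p X X > 0)"

definition orthonormal_for :: "('v \<Rightarrow> 'v \<Rightarrow> real) \<Rightarrow> 'v set \<Rightarrow> bool"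
  where "orthonormal_for g B \<longleftrightarrow> (\<forall>b\<in>B. \<forall>b'\<in>B. g b b' = (if b = b' then 1 else 0))"

definition compatible_metrics ::
    "'m topology \<Rightarrow> ('m, 'e::euclidean_space) chart set \<Rightarrow> nat \<Rightarrow> nat
      \<Rightarrow> (nat \<Rightarrow> ('m, 'e) tensor2) \<Rightarrow> ('m, 'e) tensor2 set"
  where "compatible_metrics M A n s \<omega> =
    {g. riemannian_metric M A g \<and>
        (\<forall>p\<in>topspace M. \<exists>v w.
           standard_polysymplectic_basis (tangent_space A p) n s (\<lambda>j. \<omega> j p) v w \<and>
           orthonormal_for (g p) (basis_vectors n s v w))}"

text \<open>The topology of uniform convergence of all partial derivatives of all components (in charts) on
  compact sets. It suffices to use compact sets contained in a chart domain, since every compact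
  subset of the manifold is a finite union of such sets.\<close>

definition Cinf_nbhd ::
    "'m topology \<Rightarrow> ('m, 'e::euclidean_space) chart set \<Rightarrow> ('m, 'e) tensor2 \<Rightarrow> ('m, 'e) chart \<Rightarrow> 'e set
      \<Rightarrow> 'e list \<Rightarrow> 'e \<Rightarrow> 'e \<Rightarrow> real \<Rightarrow> ('m, 'e) tensor2 set"
  where "Cinf_nbhd M A T c K vs u w \<epsilon> =
    {S \<in> sym_tensors M A. \<forall>x\<in>K.
       \<bar>iter_deriv vs (\<lambda>y. local_rep A S c y u w) x - iter_deriv vs (\<lambda>y. local_rep A T c y u w) x\<bar> < \<epsilon>}"

definition Cinf_topology ::
    "'m topology \<Rightarrow> ('m, 'e::euclidean_space) chart set \<Rightarrow> ('m, 'e) tensor2 topology"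
  where "Cinf_topology M A = topology_generated_by
    {Cinf_nbhd M A T c K vs u w \<epsilon> | T c K vs u w \<epsilon>.
       T \<in> sym_tensors M A \<and> c \<in> A \<and> compact K \<and> K \<subseteq> snd c ` fst c \<and> \<epsilon> > 0}"

end

theory Submission
  imports Defs
begin

text \<open>
  The compatible metrics are a retract of the space of all Riemannian metrics, which is non-empty
  (partitions of unity) and convex. The retraction is defined in each tangent space separately.

  For \<open>s = 1\<close> write \<open>\<omega>\<^sub>1 = g (A \<cdot>, \<cdot>)\<close>; the polar decomposition of \<open>A\<close> gives the compatible metric
  \<open>g (S \<cdot>, \<cdot>)\<close> with \<open>S\<close> the positive square root of \<open>- A\<^sup>2\<close>. For \<open>s \<noteq> 1\<close> let \<open>L\<close> be the sum of the
  \<open>\<omega>\<^sub>j\<^sup>\<bottom>\<close>. A compatible metric is the same as an inner product on \<open>V / L\<close> and a complement of \<open>L\<close> that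
  is isotropic for all \<open>\<omega>\<^sub>j\<close>: the forms \<open>\<omega>\<^sub>j\<close> identify \<open>L\<close> with a sum of copies of the dual of \<open>V / L\<close>.
  A metric \<open>g\<close> induces the former by restriction to the \<open>g\<close>-orthogonal complement \<open>H\<close> of \<open>L\<close>, and the
  latter by subtracting from each vector of \<open>H\<close> the element of \<open>L\<close> that represents half the
  restriction of the \<open>\<omega>\<^sub>j\<close> to \<open>H\<close>.

  Integrability of the sum of the \<open>\<omega>\<^sub>j\<^sup>\<bottom>\<close> provides charts in which \<open>L\<close> is constant, so that \<open>g\<close>-orthogonal
  projection onto \<open>H\<close> is visibly a smooth function of \<open>g\<close>.
  Smoothness of the image of a metric and continuity of the retraction in the \<open>C\<^sup>\<infinity>\<close> topology are the
  same statement, about families of functions \<open>F t x\<close> whose derivatives in \<open>x\<close> of all orders are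
  jointly continuous in \<open>t\<close> and \<open>x\<close>.
\<close>


subsection \<open>Smooth families of maps\<close>

text \<open>Compatible metrics are in general not convex. Two of them are therefore joined by the
  straight segment in the space of all metrics, and the segment is pushed back by the retraction.

  The cases differ because \<open>w\<^sup>j\<^sub>i\<close> lies in the kernel of
  \<open>\<omega>\<^sub>l\<close> for every l \<noteq> j. For s \<ge> 2 the span of all
  \<open>w\<^sup>j\<^sub>i\<close> is thus recovered as \<open>L\<close> from the forms alone. For s
  = 1 the only kernel is zero and no Lagrangian subspace is preferred, so the metric is adjusted to
  the form by its polar part instead.

  Orthonormal bases and eigenvectors enter freely at a single point, but cannot be chosen smoothly,
  for instance where eigenvalues cross. The retraction is therefore described by relations between
  forms and operators that determine the result uniquely. Uniqueness makes it independent of charts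
  and choices; smoothness is read off from operators that are determined by the metric, namely
  inverses, a projection and a square root.\<close>

primrec param_C_k ::
  "nat \<Rightarrow> 't topology \<Rightarrow> 'e::euclidean_space set \<Rightarrow> ('t \<Rightarrow> 'e \<Rightarrow> 'f::real_normed_vector) \<Rightarrow> bool" where
  "param_C_k 0 T U F \<longleftrightarrow>
     continuous_map (prod_topology T (top_of_set U)) euclidean (\<lambda>z. F (fst z) (snd z))"
| "param_C_k (Suc k) T U F \<longleftrightarrow>
     continuous_map (prod_topology T (top_of_set U)) euclidean (\<lambda>z. F (fst z) (snd z)) \<and>
     (\<forall>t\<in>topspace T. \<forall>x\<in>U. F t differentiable (at x)) \<and>
     (\<forall>v. param_C_k k T U (\<lambda>t x. frechet_derivative (F t) (at x) v))"

lemma continuous_map_euclidean_tendsto: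
  "continuous_map Z euclidean f \<longleftrightarrow> (\<forall>z\<in>topspace Z. (f \<longlongrightarrow> f z) (atin Z z))"
  by (simp add: continuous_map_atin)

lemma param_C_k_imp_0: "param_C_k k T U F \<Longrightarrow> param_C_k 0 T U F"
  by (cases k) auto

lemma param_C_k_tendsto:
  assumes "param_C_k k T U F" "t \<in> topspace T" "x \<in> U"
  shows "((\<lambda>z. F (fst z) (snd z)) \<longlongrightarrow> F t x) (atin (prod_topology T (top_of_set U)) (t, x))"
  using param_C_k_imp_0[OF assms(1)] assms(2,3) by (simp add: continuous_map_euclidean_tendsto)

lemma param_C_k_0I:
  assumes "\<And>t x. t \<in> topspace T \<Longrightarrow> x \<in> U \<Longrightarrow>
    ((\<lambda>z. F (fst z) (snd z)) \<longlongrightarrow> F t x) (atin (prod_topology T (top_of_set U)) (t, x))"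
  shows "param_C_k 0 T U F"
  using assms by (auto simp: continuous_map_euclidean_tendsto)

text \<open>A derivative at a point of \<open>U\<close> depends on a whole neighbourhood, so
  \<open>U\<close> has to be open for agreement on \<open>U\<close> to determine it.\<close>

lemma param_C_k_cong:
  assumes "open U" "\<And>t x. t \<in> topspace T \<Longrightarrow> x \<in> U \<Longrightarrow> F t x = G t x" "param_C_k k T U F"
  shows "param_C_k k T U G"
  using assms(2,3)
proof (induction k arbitrary: F G)
  case 0
  then show ?case
    by (auto elim!: continuous_map_eq)
next
  case (Suc k)
  have der: "(G t has_derivative f') (at x)"
    if "(F t has_derivative f') (at x)" "t \<in> topspace T" "x \<in> U" for t x f'
    using has_derivative_transform_within_open[OF that(1) \<open>open U\<close> that(3)] Suc.prems(1) that(2)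
    by blast
  have diff: "(F t has_derivative frechet_derivative (F t) (at x)) (at x)"
    if "t \<in> topspace T" "x \<in> U" for t x
    using Suc.prems(2) that by (simp add: frechet_derivative_works)
  have *: "frechet_derivative (F t) (at x) = frechet_derivative (G t) (at x)"
    if "t \<in> topspace T" "x \<in> U" for t x
    using der[OF diff[OF that] that] frechet_derivative_at by blast
  have "param_C_k k T U (\<lambda>t x. frechet_derivative (G t) (at x) v)" for v
    by (rule Suc.IH[of "\<lambda>t x. frechet_derivative (F t) (at x) v"]) (use * Suc.prems in auto)
  moreover have "continuous_map (prod_topology T (top_of_set U)) euclidean (\<lambda>z. G (fst z) (snd z))"
    using Suc.prems by (auto elim!: continuous_map_eq)
  moreover have "\<forall>t\<in>topspace T. \<forall>x\<in>U. G t differentiable (at x)"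
    using der[OF diff] unfolding differentiable_def by blast
  ultimately show ?case by simp
qed

text \<open>The defining clause speaks of \<open>frechet_derivative\<close>; here any formula
  \<open>F'\<close> for the derivative may be supplied. The closure rules below are inductions on
  the order in which \<open>F'\<close> is built from families of lower order.\<close>

lemma param_C_k_SucI:
  assumes "open U" "param_C_k 0 T U F"
    and "\<And>t x. t \<in> topspace T \<Longrightarrow> x \<in> U \<Longrightarrow> (F t has_derivative F' t x) (at x)"
    and "\<And>v. param_C_k k T U (\<lambda>t x. F' t x v)"
  shows "param_C_k (Suc k) T U F"
proof -
  have "param_C_k k T U (\<lambda>t x. frechet_derivative (F t) (at x) v)" for v
  proof (rule param_C_k_cong[OF assms(1) _ assms(4)[of v]])
    show "F' t x v = frechet_derivative (F t) (at x) v" if "t \<in> topspace T" "x \<in> U" for t x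
      using frechet_derivative_at[OF assms(3)[OF that]] by simp
  qed
  then show ?thesis
    using assms(2) differentiableI[OF assms(3)] by auto
qed

lemma param_C_k_SucD:
  assumes "param_C_k (Suc k) T U F" "t \<in> topspace T" "x \<in> U"
  shows "(F t has_derivative frechet_derivative (F t) (at x)) (at x)"
  using assms by (simp add: frechet_derivative_works)

lemma param_C_k_SucD': "param_C_k (Suc k) T U F \<Longrightarrow>
    param_C_k k T U (\<lambda>t x. frechet_derivative (F t) (at x) v)"
  by simp

lemma param_C_k_Suc_imp: "param_C_k (Suc k) T U F \<Longrightarrow> param_C_k k T U F"
proof (induction k arbitrary: F)
  case 0
  then show ?case by (rule param_C_k_imp_0)
next
  case (Suc k)
  have "param_C_k k T U (\<lambda>t x. frechet_derivative (F t) (at x) v)" for v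
    by (rule Suc.IH, rule param_C_k_SucD', rule Suc.prems)
  moreover have "\<forall>t\<in>topspace T. \<forall>x\<in>U. F t differentiable (at x)"
    by (intro ballI differentiableI[OF param_C_k_SucD[OF Suc.prems]])
  ultimately show ?case
    using param_C_k_imp_0[OF Suc.prems] by simp
qed

lemma param_C_k_subset:
  fixes T :: "'t topology" and U :: "'e::euclidean_space set" and F :: "'t \<Rightarrow> 'e \<Rightarrow> 'f::real_normed_vector"
  assumes "V \<subseteq> U" "param_C_k k T U F"
  shows "param_C_k k T V F"
proof -
  have *: "continuous_map (prod_topology T (top_of_set V)) euclidean f"
    if "continuous_map (prod_topology T (top_of_set U)) euclidean f" for f :: "'t \<times> 'e \<Rightarrow> 'f"
  proof -
    have "prod_topology T (top_of_set V) = subtopology (prod_topology T (top_of_set U)) (topspace T \<times> V)"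
      using assms(1) by (simp add: subtopology_Times subtopology_subtopology inf.absorb2)
    then show ?thesis using that by (simp add: continuous_map_from_subtopology)
  qed
  show ?thesis
    using assms(2) by (induction k arbitrary: F) (use * assms(1) in auto)
qed

text \<open>Nothing is differentiated in the parameter, so it can be replaced along any continuous
  map. This finally pulls the family of all symmetric tensors back to the parameter space of the
  homotopy.\<close>

lemma param_C_k_reparam:
  fixes T :: "'t topology" and U :: "'e::euclidean_space set" and F :: "'t \<Rightarrow> 'e \<Rightarrow> 'f::real_normed_vector"
  assumes "continuous_map T' T a" "param_C_k k T U F"
  shows "param_C_k k T' U (\<lambda>t. F (a t))"
  using assms(2)
proof (induction k arbitrary: F)
  have *: "continuous_map (prod_topology T' (top_of_set U)) euclidean (\<lambda>z. F (a (fst z)) (snd z))"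
    if "continuous_map (prod_topology T (top_of_set U)) euclidean (\<lambda>z. F (fst z) (snd z))" for F :: "'t \<Rightarrow> 'e \<Rightarrow> 'f"
  proof -
    have "continuous_map (prod_topology T' (top_of_set U)) (prod_topology T (top_of_set U)) (\<lambda>z. (a (fst z), snd z))"
      by (intro continuous_map_pairedI continuous_map_compose[OF continuous_map_fst, unfolded o_def] assms continuous_map_snd)
    from continuous_map_compose[OF this that] show ?thesis by (simp add: o_def)
  qed
  {
    case 0
    then show ?case using *[of F] by simp
  next
    case (Suc k)
    have "a t \<in> topspace T" if "t \<in> topspace T'" for t
      using assms(1) that by (auto simp: continuous_map_def)
    moreover have "param_C_k k T' U (\<lambda>t x. frechet_derivative (F (a t)) (at x) v)" for v
      using Suc.IH[of "\<lambda>t x. frechet_derivative (F t) (at x) v"] Suc.prems by simp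
    ultimately show ?case using *[of F] Suc.prems by simp
  }
qed

text \<open>The sets \<open>topspace T \<times> V\<close> form an open cover of the domain of the
  family, and both continuity and derivatives can be tested on it.\<close>

lemma param_C_k_local:
  fixes T :: "'t topology" and U :: "'e::euclidean_space set" and F :: "'t \<Rightarrow> 'e \<Rightarrow> 'f::real_normed_vector"
  assumes "\<And>x. x \<in> U \<Longrightarrow> \<exists>V. open V \<and> x \<in> V \<and> V \<subseteq> U \<and> param_C_k k T V F"
  shows "param_C_k k T U F"
proof -
  have *: "continuous_map (prod_topology T (top_of_set U)) euclidean f"
    if f: "\<And>x. x \<in> U \<Longrightarrow> \<exists>V. open V \<and> x \<in> V \<and> V \<subseteq> U \<and> continuous_map (prod_topology T (top_of_set V)) euclidean f"
    for f :: "'t \<times> 'e \<Rightarrow> 'f"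
    unfolding continuous_map_eq_topcontinuous_at
  proof
    fix z assume z: "z \<in> topspace (prod_topology T (top_of_set U))"
    then obtain V where V: "open V" "snd z \<in> V" "V \<subseteq> U" "continuous_map (prod_topology T (top_of_set V)) euclidean f"
      using f[of "snd z"] by auto
    let ?Z = "prod_topology T (top_of_set U)"
    have eq: "prod_topology T (top_of_set V) = subtopology ?Z (topspace T \<times> V)"
      using V(3) by (simp add: subtopology_Times subtopology_subtopology inf.absorb2)
    have op: "openin ?Z (topspace T \<times> V)"
      using V by (simp add: openin_prod_Times_iff open_subset)
    show "topcontinuous_at ?Z euclidean f z"
      unfolding topcontinuous_at_def
    proof (intro conjI allI impI)
      show "z \<in> topspace ?Z" by (rule z)
      show "f \<in> topspace ?Z \<rightarrow> topspace euclidean" by simp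
      fix W assume W: "openin euclidean W \<and> f z \<in> W"
      have "openin (subtopology ?Z (topspace T \<times> V)) {w \<in> topspace (subtopology ?Z (topspace T \<times> V)). f w \<in> W}"
        using V(4) W unfolding eq by (blast intro: openin_continuous_map_preimage)
      then have "openin ?Z {w \<in> topspace (subtopology ?Z (topspace T \<times> V)). f w \<in> W}"
        using op openin_trans_full by blast
      then show "\<exists>u. openin ?Z u \<and> z \<in> u \<and> (\<forall>y\<in>u. f y \<in> W)"
        using z V W by (intro exI[of _ "{w \<in> topspace (subtopology ?Z (topspace T \<times> V)). f w \<in> W}"]) auto
    qed
  qed
  show ?thesis
    using assms
  proof (induction k arbitrary: F)
    case 0
    then show ?case using *[of "\<lambda>z. F (fst z) (snd z)"] by simp
  next
    case (Suc k)
    have "\<exists>V. open V \<and> x \<in> V \<and> V \<subseteq> U \<and> param_C_k k T V (\<lambda>t x. frechet_derivative (F t) (at x) v)"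
      if "x \<in> U" for x v
    proof -
      obtain V where V: "open V" "x \<in> V" "V \<subseteq> U" "param_C_k (Suc k) T V F"
        using Suc.prems[OF \<open>x \<in> U\<close>] by blast
      show ?thesis by (intro exI[of _ V] conjI V param_C_k_SucD'[OF V(4)])
    qed
    then have "param_C_k k T U (\<lambda>t x. frechet_derivative (F t) (at x) v)" for v
      by (rule Suc.IH)
    moreover have "\<exists>V. open V \<and> x \<in> V \<and> V \<subseteq> U \<and>
        continuous_map (prod_topology T (top_of_set V)) euclidean (\<lambda>z. F (fst z) (snd z))" if "x \<in> U" for x
      using Suc.prems[OF that] by auto
    then have "continuous_map (prod_topology T (top_of_set U)) euclidean (\<lambda>z. F (fst z) (snd z))"
      by (rule *)
    moreover have "F t differentiable (at x)" if "t \<in> topspace T" "x \<in> U" for t x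
      using Suc.prems[OF that(2)] that(1) by auto
    ultimately show ?case by simp
  qed
qed

lemma param_C_k_const: 
  assumes "open U" shows "param_C_k k T U (\<lambda>t x. c)"
proof (induction k arbitrary: c)
  case (Suc k)
  then show ?case by (intro param_C_k_SucI[where F'="\<lambda>t x v. 0"] assms) (auto)
qed simp

lemma param_C_k_param:
  assumes "open U" "continuous_map T euclidean f" shows "param_C_k k T U (\<lambda>t x. f t)"
proof -
  have 0: "param_C_k 0 T U (\<lambda>t x. f t)"
    using continuous_map_compose[OF continuous_map_fst assms(2)] by (simp add: o_def)
  show ?thesis
    by (cases k) (auto simp del: param_C_k.simps intro!: 0 param_C_k_SucI[where F'="\<lambda>t x v. 0"] assms param_C_k_const)
qed

lemma param_C_k_linear:
  assumes "open U" "bounded_linear L" "param_C_k k T U F"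
  shows "param_C_k k T U (\<lambda>t x. L (F t x))"
  using assms(3)
proof (induction k arbitrary: F)
  case 0
  show ?case
    by (intro param_C_k_0I bounded_linear.tendsto[OF assms(2)] param_C_k_tendsto[OF 0])
next
  case (Suc k)
  show ?case
  proof (rule param_C_k_SucI[OF assms(1)])
    show "param_C_k 0 T U (\<lambda>t x. L (F t x))"
      by (intro param_C_k_0I bounded_linear.tendsto[OF assms(2)] param_C_k_tendsto[OF Suc.prems])
    show "((\<lambda>x. L (F t x)) has_derivative (\<lambda>v. L (frechet_derivative (F t) (at x) v))) (at x)"
      if "t \<in> topspace T" "x \<in> U" for t x
      by (rule bounded_linear.has_derivative[OF assms(2) param_C_k_SucD[OF Suc.prems that]])
    show "param_C_k k T U (\<lambda>t x. L (frechet_derivative (F t) (at x) v))" for v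
      by (rule Suc.IH, rule param_C_k_SucD', rule Suc.prems)
  qed
qed

lemma param_C_k_add:
  assumes "open U" "param_C_k k T U F" "param_C_k k T U G"
  shows "param_C_k k T U (\<lambda>t x. F t x + G t x)"
  using assms(2,3)
proof (induction k arbitrary: F G)
  case 0
  show ?case
    by (intro param_C_k_0I tendsto_add param_C_k_tendsto[OF 0(1)] param_C_k_tendsto[OF 0(2)])
next
  case (Suc k)
  show ?case
  proof (rule param_C_k_SucI[OF assms(1)])
    show "param_C_k 0 T U (\<lambda>t x. F t x + G t x)"
      by (intro param_C_k_0I tendsto_add param_C_k_tendsto[OF Suc.prems(1)] param_C_k_tendsto[OF Suc.prems(2)])
    show "((\<lambda>x. F t x + G t x) has_derivative
        (\<lambda>v. frechet_derivative (F t) (at x) v + frechet_derivative (G t) (at x) v)) (at x)"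
      if "t \<in> topspace T" "x \<in> U" for t x
      by (intro has_derivative_add param_C_k_SucD[OF Suc.prems(1) that] param_C_k_SucD[OF Suc.prems(2) that])
    show "param_C_k k T U (\<lambda>t x. frechet_derivative (F t) (at x) v + frechet_derivative (G t) (at x) v)" for v
      by (rule Suc.IH; rule param_C_k_SucD'; rule Suc.prems)
  qed
qed

lemma param_C_k_sum:
  assumes "open U" "\<And>i. i \<in> I \<Longrightarrow> param_C_k k T U (F i)"
  shows "param_C_k k T U (\<lambda>t x. \<Sum>i\<in>I. F i t x)"
  using assms(2)
  by (induction I rule: infinite_finite_induct) (auto intro!: param_C_k_const param_C_k_add assms(1))

text \<open>One product rule serves scalar multiples, products, inner products, composition of
  operators and their application to vectors.\<close>

lemma param_C_k_bilinear:
  assumes "open U" "bounded_bilinear B" "param_C_k k T U F" "param_C_k k T U G"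
  shows "param_C_k k T U (\<lambda>t x. B (F t x) (G t x))"
  using assms(3,4)
proof (induction k arbitrary: F G)
  case 0
  show ?case
    by (intro param_C_k_0I bounded_bilinear.tendsto[OF assms(2)] param_C_k_tendsto[OF 0(1)] param_C_k_tendsto[OF 0(2)])
next
  case (Suc k)
  note imp = Suc.prems[THEN param_C_k_Suc_imp]
  show ?case
  proof (rule param_C_k_SucI[OF assms(1)])
    show "param_C_k 0 T U (\<lambda>t x. B (F t x) (G t x))"
      by (intro param_C_k_0I bounded_bilinear.tendsto[OF assms(2)]
          param_C_k_tendsto[OF Suc.prems(1)] param_C_k_tendsto[OF Suc.prems(2)])
    show "((\<lambda>x. B (F t x) (G t x)) has_derivative
        (\<lambda>v. B (F t x) (frechet_derivative (G t) (at x) v) + B (frechet_derivative (F t) (at x) v) (G t x))) (at x)"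
      if "t \<in> topspace T" "x \<in> U" for t x
      by (rule bounded_bilinear.FDERIV[OF assms(2) param_C_k_SucD[OF Suc.prems(1) that] param_C_k_SucD[OF Suc.prems(2) that]])
    show "param_C_k k T U (\<lambda>t x. B (F t x) (frechet_derivative (G t) (at x) v) +
        B (frechet_derivative (F t) (at x) v) (G t x))" for v
      by (intro param_C_k_add assms(1) Suc.IH imp param_C_k_SucD'[OF Suc.prems(1)] param_C_k_SucD'[OF Suc.prems(2)])
  qed
qed

lemmas param_C_k_scaleR = param_C_k_bilinear[OF _ bounded_bilinear_scaleR]
  and param_C_k_mult = param_C_k_bilinear[OF _ bounded_bilinear_mult]
  and param_C_k_inner = param_C_k_bilinear[OF _ bounded_bilinear_inner]
  and param_C_k_compose = param_C_k_bilinear[OF _ bounded_bilinear_blinfun_compose]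
  and param_C_k_apply = param_C_k_bilinear[OF _ bounded_bilinear_blinfun_apply]

lemma param_C_k_minus:
  "open U \<Longrightarrow> param_C_k k T U F \<Longrightarrow> param_C_k k T U (\<lambda>t x. - F t x)"
  by (rule param_C_k_linear[OF _ bounded_linear_minus[OF bounded_linear_ident]])

lemma param_C_k_diff:
  "open U \<Longrightarrow> param_C_k k T U F \<Longrightarrow> param_C_k k T U G \<Longrightarrow> param_C_k k T U (\<lambda>t x. F t x - G t x)"
  using param_C_k_add[OF _ _ param_C_k_minus, of U k T F G] by simp

lemma param_C_k_of_C_k:
  fixes f :: "'e::euclidean_space \<Rightarrow> 'f::real_normed_vector"
  assumes "C_k_on k U f" shows "param_C_k k T U (\<lambda>_. f)"
proof -
  have *: "continuous_map (prod_topology T (top_of_set U)) euclidean (\<lambda>z. f (snd z))"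
    if "continuous_on U f" for f :: "'e \<Rightarrow> 'f"
    using continuous_map_compose[OF continuous_map_snd, of "top_of_set U" euclidean f T] that by (simp add: o_def)
  show ?thesis
    using assms
  proof (induction k arbitrary: f)
    case (Suc k)
    then show ?case
      by (auto intro!: * differentiable_imp_continuous_on differentiable_at_imp_differentiable_on)
  qed (use * in auto)
qed

lemma C_k_of_param_C_k:
  fixes T :: "'t topology" and U :: "'e::euclidean_space set" and F :: "'t \<Rightarrow> 'e \<Rightarrow> 'f::real_normed_vector"
  assumes "param_C_k k T U F" "t \<in> topspace T" shows "C_k_on k U (F t)"
proof -
  have *: "continuous_on U (F t)"
    if "continuous_map (prod_topology T (top_of_set U)) euclidean (\<lambda>z. F (fst z) (snd z))" for F :: "'t \<Rightarrow> 'e \<Rightarrow> 'f"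
  proof -
    have "continuous_map (top_of_set U) (prod_topology T (top_of_set U)) (\<lambda>x. (t, x))"
      using assms(2) by (intro continuous_map_pairedI) auto
    from continuous_map_compose[OF this that] show ?thesis by (simp add: o_def)
  qed
  show ?thesis
    using assms by (induction k arbitrary: F) (auto intro: *)
qed

text \<open>Over a one-point parameter space a family is a single map. The closure properties of
  smooth maps thus become instances of those of families.\<close>

lemma smooth_on_iff_param:
  "smooth_on U f \<longleftrightarrow> (\<forall>k. param_C_k k (discrete_topology {()}) U (\<lambda>_. f))"
  unfolding smooth_on_def
proof (intro iffI allI)
  show "param_C_k k (discrete_topology {()}) U (\<lambda>_. f)" if "\<forall>k. C_k_on k U f" for k
    by (rule param_C_k_of_C_k) (use that in blast)
  show "C_k_on k U f" if "\<forall>k. param_C_k k (discrete_topology {()}) U (\<lambda>_. f)" for k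
    by (rule C_k_of_param_C_k[of k "discrete_topology {()}" U "\<lambda>_. f" "()"]) (use that in \<open>simp_all del: param_C_k.simps\<close>)
qed

lemma param_C_k_compose_smooth:
  fixes T :: "'t topology" and F :: "'t \<Rightarrow> 'e::euclidean_space \<Rightarrow> 'f::real_normed_vector"
    and \<tau> :: "'a::euclidean_space \<Rightarrow> 'e"
  assumes "open U" "open U'" "param_C_k k T U' F" "C_k_on k U \<tau>" "\<And>x. x \<in> U \<Longrightarrow> \<tau> x \<in> U'"
  shows "param_C_k k T U (\<lambda>t x. F t (\<tau> x))"
  using assms(3,4)
proof (induction k arbitrary: F)
  have *: "continuous_map (prod_topology T (top_of_set U)) euclidean (\<lambda>z. F (fst z) (\<tau> (snd z)))"
    if "continuous_map (prod_topology T (top_of_set U')) euclidean (\<lambda>z. F (fst z) (snd z))" "continuous_on U \<tau>"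
    for F :: "'t \<Rightarrow> 'e \<Rightarrow> 'f"
  proof -
    have "continuous_map (top_of_set U) (top_of_set U') \<tau>"
      using that assms(5) by (auto simp: continuous_map_in_subtopology)
    then have "continuous_map (prod_topology T (top_of_set U)) (prod_topology T (top_of_set U')) (\<lambda>z. (fst z, \<tau> (snd z)))"
      by (intro continuous_map_pairedI continuous_map_fst continuous_map_compose[OF continuous_map_snd, unfolded o_def])
    from continuous_map_compose[OF this that(1)] show ?thesis by (simp add: o_def)
  qed
  {
    case 0
    then show ?case using * by simp
  next
    case (Suc k)
    have dt: "\<tau> differentiable at x" if "x \<in> U" for x using Suc.prems that by simp
    have td: "(\<tau> has_derivative frechet_derivative \<tau> (at x)) (at x)" if "x \<in> U" for x
      using dt[OF that] by (simp add: frechet_derivative_works)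
    have ct: "continuous_on U \<tau>"
      using dt by (auto intro!: differentiable_imp_continuous_on differentiable_at_imp_differentiable_on)
    have Ck: "C_k_on k U \<tau>"
      using C_k_of_param_C_k[OF param_C_k_Suc_imp[OF param_C_k_of_C_k[OF Suc.prems(2)]], of "()" "discrete_topology {()}"]
      unfolding topspace_discrete_topology by blast
    \<comment> \<open>By the chain rule the derivative of \<open>F t\<close> is applied to a
      direction that moves with \<open>x\<close>, whereas the induction hypothesis concerns fixed
      directions; hence the expansion in \<open>Basis\<close>.\<close>
    show ?case
    proof (rule param_C_k_SucI[where F'="\<lambda>t x v. \<Sum>b\<in>Basis. (frechet_derivative \<tau> (at x) v \<bullet> b) *\<^sub>R
         frechet_derivative (F t) (at (\<tau> x)) b", OF assms(1)])
      show "param_C_k 0 T U (\<lambda>t x. F t (\<tau> x))"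
        using *[OF _ ct] Suc.prems by simp
    next
      fix t x assume t: "t \<in> topspace T" "x \<in> U"
      have D: "(F t has_derivative frechet_derivative (F t) (at (\<tau> x))) (at (\<tau> x))"
        using param_C_k_SucD[OF Suc.prems(1)] t assms(5) by blast
      have "((\<lambda>x. F t (\<tau> x)) has_derivative (\<lambda>v. frechet_derivative (F t) (at (\<tau> x)) (frechet_derivative \<tau> (at x) v))) (at x)"
        using diff_chain_at[OF td[OF t(2)] D] by (simp add: o_def)
      also have "(\<lambda>v. frechet_derivative (F t) (at (\<tau> x)) (frechet_derivative \<tau> (at x) v)) =
        (\<lambda>v. \<Sum>b\<in>Basis. (frechet_derivative \<tau> (at x) v \<bullet> b) *\<^sub>R frechet_derivative (F t) (at (\<tau> x)) b)"
      proof (rule ext, goal_cases)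
        case (1 v)
        let ?w = "frechet_derivative \<tau> (at x) v"
        have "linear (frechet_derivative (F t) (at (\<tau> x)))" using D has_derivative_linear by blast
        then have "frechet_derivative (F t) (at (\<tau> x)) (\<Sum>b\<in>Basis. (?w \<bullet> b) *\<^sub>R b) = (\<Sum>b\<in>Basis. (?w \<bullet> b) *\<^sub>R frechet_derivative (F t) (at (\<tau> x)) b)"
          by (simp add: linear_sum linear_scale)
        then show ?case by (simp only: euclidean_representation)
      qed
      finally show "((\<lambda>x. F t (\<tau> x)) has_derivative (\<lambda>v. \<Sum>b\<in>Basis. (frechet_derivative \<tau> (at x) v \<bullet> b) *\<^sub>R
         frechet_derivative (F t) (at (\<tau> x)) b)) (at x)" .
    next
      fix v
      have "param_C_k k T U (\<lambda>t x. frechet_derivative (F t) (at (\<tau> x)) b)" for b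
        using Suc.IH[OF _ Ck, of "\<lambda>t x. frechet_derivative (F t) (at x) b"] Suc.prems by simp
      moreover have "param_C_k k T U (\<lambda>t x. frechet_derivative \<tau> (at x) v)"
        by (rule param_C_k_of_C_k) (use Suc.prems in simp)
      ultimately show "param_C_k k T U (\<lambda>t x. \<Sum>b\<in>Basis. (frechet_derivative \<tau> (at x) v \<bullet> b) *\<^sub>R
         frechet_derivative (F t) (at (\<tau> x)) b)"
        by (intro param_C_k_sum param_C_k_scaleR param_C_k_inner param_C_k_const assms(1))
    qed
  }
qed

lemma smooth_on_imp_param: "smooth_on U f \<Longrightarrow> param_C_k k T U (\<lambda>_. f)"
  unfolding smooth_on_def by (intro param_C_k_of_C_k) simp

lemma smooth_onI_param:
  assumes "\<And>k. param_C_k k (discrete_topology {()}) U (\<lambda>_. f)" shows "smooth_on U f"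
  unfolding smooth_on_iff_param by (intro allI assms)

lemma smooth_on_cong:
  assumes "open U" "smooth_on U f" "\<And>x. x \<in> U \<Longrightarrow> f x = g x"
  shows "smooth_on U g"
proof (rule smooth_onI_param)
  show "param_C_k k (discrete_topology {()}) U (\<lambda>_. g)" for k
    using param_C_k_cong[where F="\<lambda>_. f" and G="\<lambda>_. g", OF assms(1) _ smooth_on_imp_param[OF assms(2)]] assms(3)
    by (simp del: param_C_k.simps)
qed

lemma smooth_on_subset: "smooth_on U f \<Longrightarrow> V \<subseteq> U \<Longrightarrow> smooth_on V f"
  by (rule smooth_onI_param, rule param_C_k_subset, assumption, rule smooth_on_imp_param)

lemma smooth_on_local:
  assumes "\<And>x. x \<in> U \<Longrightarrow> \<exists>V. open V \<and> x \<in> V \<and> V \<subseteq> U \<and> smooth_on V f"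
  shows "smooth_on U f"
proof (intro smooth_onI_param param_C_k_local)
  fix x k assume "x \<in> U"
  then obtain V where "open V" "x \<in> V" "V \<subseteq> U" "smooth_on V f" using assms by blast
  then show "\<exists>V. open V \<and> x \<in> V \<and> V \<subseteq> U \<and> param_C_k k (discrete_topology {()}) V (\<lambda>_. f)"
    by (intro exI[of _ V] conjI smooth_on_imp_param)
qed

lemma smooth_on_has_derivative:
  "smooth_on U f \<Longrightarrow> x \<in> U \<Longrightarrow> (f has_derivative frechet_derivative f (at x)) (at x)"
  unfolding smooth_on_def by (metis C_k_on.simps(2) frechet_derivative_works)

lemma smooth_on_frechet_derivative:
  "smooth_on U f \<Longrightarrow> smooth_on U (\<lambda>x. frechet_derivative f (at x) v)"
  unfolding smooth_on_def by (metis C_k_on.simps(2))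

lemma smooth_on_compose:
  assumes "open U" "open U'" "smooth_on U' f" "smooth_on U \<tau>" "\<And>x. x \<in> U \<Longrightarrow> \<tau> x \<in> U'"
  shows "smooth_on U (\<lambda>x. f (\<tau> x))"
proof (intro smooth_onI_param)
  fix k
  have "C_k_on k U \<tau>" using assms(4) by (simp add: smooth_on_def)
  from param_C_k_compose_smooth[OF assms(1,2) smooth_on_imp_param[OF assms(3)] this assms(5)]
  show "param_C_k k (discrete_topology {()}) U (\<lambda>_ x. f (\<tau> x))" by simp
qed

section \<open>Inverses and square roots of families of operators\<close>

lemma blinfun_compose_id [simp]:
  fixes C :: "'a::real_normed_vector \<Rightarrow>\<^sub>L 'b::real_normed_vector"
  shows "C o\<^sub>L id_blinfun = C" "id_blinfun o\<^sub>L C = C"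
  by (auto intro: blinfun_eqI)

lemma blinfun_inverse_exists:
  fixes B :: "'b::euclidean_space \<Rightarrow>\<^sub>L 'b"
  assumes "inj (blinfun_apply B)"
  shows "\<exists>J. B o\<^sub>L J = id_blinfun \<and> J o\<^sub>L B = id_blinfun"
proof -
  obtain g where g: "linear g" "\<And>u. g (blinfun_apply B u) = u" "\<And>u. blinfun_apply B (g u) = u"
    using linear_injective_isomorphism[OF bounded_linear.linear[OF blinfun.bounded_linear_right] assms] by metis
  have "bounded_linear g" using g(1) linear_conv_bounded_linear by blast
  then have "blinfun_apply (Blinfun g) = g" by (rule bounded_linear_Blinfun_apply)
  then show ?thesis by (intro exI[of _ "Blinfun g"] conjI blinfun_eqI) (use g in simp_all)
qed

lemma positive_definite_invertible:
  fixes B :: "'b::euclidean_space \<Rightarrow>\<^sub>L 'b"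
  assumes "\<And>u. u \<noteq> 0 \<Longrightarrow> B u \<bullet> u > 0"
  shows "\<exists>J. B o\<^sub>L J = id_blinfun \<and> J o\<^sub>L B = id_blinfun"
proof (rule blinfun_inverse_exists, subst linear_injective_0[OF bounded_linear.linear[OF blinfun.bounded_linear_right]], intro allI impI)
  show "u = 0" if "blinfun_apply B u = 0" for u
    using assms[of u] that by force
qed

text \<open>\<open>B z - B0 = B z (A0 - A z) B0\<close> if \<open>B z\<close> is a left inverse of
  \<open>A z\<close> and \<open>B0\<close> a right inverse of \<open>A0\<close>. As soon as the
  norms of \<open>A0 - A z\<close> and \<open>B0\<close> have product at most 1/2, this equation
  bounds \<open>B z\<close> by twice the norm of \<open>B0\<close>; with that bound it gives
  convergence.\<close>

lemma tendsto_inverse_blinfun: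
  fixes A B :: "'a \<Rightarrow> ('b::real_normed_vector \<Rightarrow>\<^sub>L 'b)"
  assumes A: "(A \<longlongrightarrow> A0) F"
    and inv: "\<forall>\<^sub>F z in F. B z o\<^sub>L A z = id_blinfun"
    and inv0: "A0 o\<^sub>L B0 = id_blinfun"
  shows "(B \<longlongrightarrow> B0) F"
proof -
  have nA: "((\<lambda>z. norm (A0 - A z)) \<longlongrightarrow> 0) F"
    using tendsto_norm_zero[OF tendsto_diff[OF tendsto_const[of A0] A, simplified]] by simp
  have ev: "\<forall>\<^sub>F z in F. norm (A0 - A z) * norm B0 \<le> 1/2"
  proof -
    have "((\<lambda>z. norm (A0 - A z) * norm B0) \<longlongrightarrow> 0) F"
      using tendsto_mult_left_zero[OF nA] by simp
    then have "\<forall>\<^sub>F z in F. norm (A0 - A z) * norm B0 < 1/2"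
      by (rule order_tendstoD(2)) simp
    then show ?thesis by (rule eventually_mono) simp
  qed
  have "\<forall>\<^sub>F z in F. norm (B z - B0) \<le> 2 * norm B0 * norm B0 * norm (A0 - A z)"
    using ev inv
  proof eventually_elim
    case (elim z)
    have "B z - B0 = (B z o\<^sub>L (A0 o\<^sub>L B0)) - ((B z o\<^sub>L A z) o\<^sub>L B0)"
      by (simp only: elim(2) inv0 blinfun_compose_id)
    also have "\<dots> = B z o\<^sub>L ((A0 - A z) o\<^sub>L B0)"
      by (auto intro!: blinfun_eqI simp: blinfun.bilinear_simps)
    finally have eq: "B z - B0 = B z o\<^sub>L ((A0 - A z) o\<^sub>L B0)" .
    have le: "norm (B z - B0) \<le> norm (B z) * (norm (A0 - A z) * norm B0)"
      unfolding eq using norm_blinfun_compose[of "B z" "(A0 - A z) o\<^sub>L B0"]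
        mult_left_mono[OF norm_blinfun_compose[of "A0 - A z" B0] norm_ge_zero[of "B z"]] by linarith
    have "norm (B z) * (norm (A0 - A z) * norm B0) \<le> norm (B z) * (1/2)"
      by (rule mult_left_mono) (use elim in auto)
    then have "norm (B z) \<le> 2 * norm B0"
      using le norm_triangle_ineq2[of "B z" B0] by linarith
    then have "norm (B z) * (norm (A0 - A z) * norm B0) \<le> 2 * norm B0 * (norm (A0 - A z) * norm B0)"
      by (rule mult_right_mono) simp
    with le show ?case by (simp add: mult_ac)
  qed
  moreover have "((\<lambda>z. 2 * norm B0 * norm B0 * norm (A0 - A z)) \<longlongrightarrow> 0) F"
    by (rule tendsto_mult_right_zero[OF nA])
  ultimately have "((\<lambda>z. B z - B0) \<longlongrightarrow> 0) F"
    by (rule Lim_null_comparison)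
  then show ?thesis by (rule LIM_zero_cancel)
qed

text \<open>Caratheodory's form of differentiability, with an operator \<open>R y\<close> in place
  of the difference quotient. For inverses and square roots the increments are linear images of the
  increments of the given operators, so that convergence of \<open>R\<close> is all that remains to
  be shown.\<close>

lemma has_derivative_blinfun_increment:
  fixes R :: "'a::euclidean_space \<Rightarrow> ('b::real_normed_vector \<Rightarrow>\<^sub>L 'c::real_normed_vector)"
  assumes f: "(f has_derivative f') (at x)" and R: "(R \<longlongrightarrow> R0) (at x)"
    and h: "\<forall>\<^sub>F y in at x. h y - h x = R y (f y - f x)"
  shows "(h has_derivative (\<lambda>v. R0 (f' v))) (at x)"
proof -
  have bl: "bounded_linear f'" using f by (rule has_derivative_bounded_linear)
  define q where "q y = (f y - f x - f' (y - x)) /\<^sub>R norm (y - x)" for y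
  have q: "(q \<longlongrightarrow> 0) (at x)"
    using f unfolding has_derivative_def q_def by (simp add: netlimit_at)
  have n: "norm (f y - f x) / norm (y - x) \<le> norm (q y) + onorm f'" if "y \<noteq> x" for y
  proof -
    have "f y - f x = norm (y - x) *\<^sub>R q y + f' (y - x)" using that by (simp add: q_def)
    then have "norm (f y - f x) \<le> norm (y - x) * norm (q y) + onorm f' * norm (y - x)"
      using norm_triangle_le[OF add_left_mono[OF onorm[OF bl, of "y - x"]]]
      by (metis (no_types, opaque_lifting) add_left_mono norm_scaleR abs_norm_cancel norm_triangle_le onorm[OF bl])
    then show ?thesis using that by (simp add: field_simps)
  qed
  have "((\<lambda>y. R0 (q y)) \<longlongrightarrow> R0 0) (at x)"
    by (intro tendsto_intros q)
  then have t1: "((\<lambda>y. norm (R0 (q y))) \<longlongrightarrow> 0) (at x)"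
    by (simp add: tendsto_norm_zero blinfun.bilinear_simps)
  have nR: "((\<lambda>y. norm (R y - R0)) \<longlongrightarrow> 0) (at x)"
    using tendsto_norm_zero[OF tendsto_diff[OF R tendsto_const[of R0], simplified]] by simp
  have "((\<lambda>y. norm (R y - R0) * (norm (q y) + onorm f')) \<longlongrightarrow> 0 * (0 + onorm f')) (at x)"
    by (intro tendsto_intros nR tendsto_norm_zero q)
  then have t: "((\<lambda>y. norm (R0 (q y)) + norm (R y - R0) * (norm (q y) + onorm f')) \<longlongrightarrow> 0) (at x)"
    using tendsto_add[OF t1] by force
  have le: "\<forall>\<^sub>F y in at x. norm ((h y - h x - R0 (f' (y - x))) /\<^sub>R norm (y - x))
      \<le> norm (R0 (q y)) + norm (R y - R0) * (norm (q y) + onorm f')"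
    using h eventually_at_ball'[OF zero_less_one, of x UNIV]
  proof eventually_elim
    case (elim y)
    have "(h y - h x - R0 (f' (y - x))) /\<^sub>R norm (y - x) = R0 (q y) + ((R y - R0) (f y - f x)) /\<^sub>R norm (y - x)"
    proof -
      have "h y - h x - R0 (f' (y - x)) = norm (y - x) *\<^sub>R R0 (q y) + (R y - R0) (f y - f x)"
        using elim by (simp add: q_def blinfun.bilinear_simps)
      then show ?thesis using elim by (simp add: scaleR_add_right)
    qed
    moreover have "norm (((R y - R0) (f y - f x)) /\<^sub>R norm (y - x)) \<le> norm (R y - R0) * (norm (q y) + onorm f')"
    proof -
      have "norm (((R y - R0) (f y - f x)) /\<^sub>R norm (y - x)) \<le> norm (R y - R0) * norm (f y - f x) / norm (y - x)"
        using norm_blinfun[of "R y - R0" "f y - f x"] by (simp add: divide_inverse mult.commute mult_left_mono)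
      also have "\<dots> \<le> norm (R y - R0) * (norm (q y) + onorm f')"
        using mult_left_mono[OF n[of y] norm_ge_zero[of "R y - R0"]] elim by simp
      finally show ?thesis .
    qed
    ultimately show ?case
      using norm_triangle_ineq[of "R0 (q y)" "((R y - R0) (f y - f x)) /\<^sub>R norm (y - x)"] by simp
  qed
  have "((\<lambda>y. (h y - h x - R0 (f' (y - x))) /\<^sub>R norm (y - x)) \<longlongrightarrow> 0) (at x)"
    by (rule tendsto_norm_zero_cancel, rule tendsto_sandwich[OF _ le tendsto_const t]) simp
  moreover have "bounded_linear (\<lambda>v. R0 (f' v))"
    using bounded_linear_compose[OF blinfun.bounded_linear_right bl] .
  ultimately show ?thesis
    unfolding has_derivative_def by (simp add: netlimit_at)
qed

text \<open>The increments satisfy \<open>G' - G = - G' (F' - F) G\<close>, which yields continuity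
  and then differentiability. The derivative is composed of \<open>G\<close> and the derivative of
  \<open>F\<close> only, so it has order \<open>k\<close> once \<open>G\<close> has.\<close>

lemma param_C_k_inverse:
  fixes F G :: "'t \<Rightarrow> 'e::euclidean_space \<Rightarrow> ('b::real_normed_vector \<Rightarrow>\<^sub>L 'b)"
  assumes "open U" "param_C_k k T U F"
    and inv: "\<And>t x. t \<in> topspace T \<Longrightarrow> x \<in> U \<Longrightarrow> F t x o\<^sub>L G t x = id_blinfun"
      "\<And>t x. t \<in> topspace T \<Longrightarrow> x \<in> U \<Longrightarrow> G t x o\<^sub>L F t x = id_blinfun"
  shows "param_C_k k T U G"
  using assms(2)
proof (induction k)
  case 0
  show ?case
  proof (rule param_C_k_0I)
    fix t x assume tx: "t \<in> topspace T" "x \<in> U"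
    have "\<forall>\<^sub>F z in atin (prod_topology T (top_of_set U)) (t, x). z \<in> topspace (prod_topology T (top_of_set U))"
      by (auto simp: eventually_atin intro!: exI[of _ "topspace (prod_topology T (top_of_set U))"] tx)
    then have "\<forall>\<^sub>F z in atin (prod_topology T (top_of_set U)) (t, x).
        G (fst z) (snd z) o\<^sub>L F (fst z) (snd z) = id_blinfun"
      by (rule eventually_mono) (auto intro!: inv)
    then show "((\<lambda>z. G (fst z) (snd z)) \<longlongrightarrow> G t x) (atin (prod_topology T (top_of_set U)) (t, x))"
      by (rule tendsto_inverse_blinfun[OF param_C_k_tendsto[OF 0 tx] _ inv(1)[OF tx]])
  qed
next
  case (Suc k)
  have G: "param_C_k k T U G" using Suc param_C_k_Suc_imp by blast
  show ?case
  proof (rule param_C_k_SucI[where F'="\<lambda>t x v. - (G t x o\<^sub>L frechet_derivative (F t) (at x) v o\<^sub>L G t x)"])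
    show "open U" "param_C_k 0 T U G" by (fact assms(1), rule param_C_k_imp_0[OF G])
    show "param_C_k k T U (\<lambda>t x. - (G t x o\<^sub>L frechet_derivative (F t) (at x) v o\<^sub>L G t x))" for v
      by (intro param_C_k_minus param_C_k_compose assms(1) G param_C_k_SucD'[OF Suc.prems])
    fix t x assume tx: "t \<in> topspace T" "x \<in> U"
    note D = param_C_k_SucD[OF Suc.prems tx]
    have evU: "\<forall>\<^sub>F y in at x. y \<in> U"
      using assms(1) tx(2) by (simp add: eventually_at_in_open')
    have tG: "(G t \<longlongrightarrow> G t x) (at x)"
    proof (rule tendsto_inverse_blinfun[OF _ _ inv(1)[OF tx]])
      show "(F t \<longlongrightarrow> F t x) (at x)" using has_derivative_continuous[OF D] by (simp add: isCont_def)
      show "\<forall>\<^sub>F z in at x. G t z o\<^sub>L F t z = id_blinfun"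
        using evU by (rule eventually_mono) (use inv(2) tx in auto)
    qed
    define R where "R y = - (Blinfun (\<lambda>Z. G t y o\<^sub>L Z o\<^sub>L G t x))" for y
    have blR: "bounded_linear (\<lambda>Z. C o\<^sub>L Z o\<^sub>L D)" for C D :: "'b \<Rightarrow>\<^sub>L 'b"
      by (intro bounded_linear_compose[OF bounded_bilinear.bounded_linear_left[OF bounded_bilinear_blinfun_compose]
            bounded_bilinear.bounded_linear_right[OF bounded_bilinear_blinfun_compose]])
    have Rapp: "blinfun_apply (R y) Z = - (G t y o\<^sub>L Z o\<^sub>L G t x)" for y Z
      unfolding R_def by (simp add: blinfun.bilinear_simps bounded_linear_Blinfun_apply[OF blR])
    have "(R \<longlongrightarrow> R x) (at x)"
    proof -
      have "norm (R y - R x) \<le> norm (G t y - G t x) * norm (G t x)" for y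
      proof (rule norm_blinfun_bound)
        fix Z
        have "(R y - R x) Z = - ((G t y - G t x) o\<^sub>L Z o\<^sub>L G t x)"
          by (auto intro!: blinfun_eqI simp: blinfun.bilinear_simps Rapp)
        then have "norm ((R y - R x) Z) \<le> norm (G t y - G t x) * norm Z * norm (G t x)"
          using norm_blinfun_compose[of "(G t y - G t x) o\<^sub>L Z" "G t x"] norm_blinfun_compose[of "G t y - G t x" Z]
          by (smt (verit, best) mult_right_mono norm_ge_zero norm_minus_cancel)
        then show "norm ((R y - R x) Z) \<le> norm (G t y - G t x) * norm (G t x) * norm Z" by (simp add: mult_ac)
      qed simp
      moreover have "((\<lambda>y. norm (G t y - G t x) * norm (G t x)) \<longlongrightarrow> 0) (at x)"
        by (intro tendsto_mult_left_zero tendsto_norm_zero LIM_zero tG)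
      ultimately have "((\<lambda>y. R y - R x) \<longlongrightarrow> 0) (at x)"
        by (rule Lim_null_comparison[OF always_eventually, OF allI])
      then show ?thesis by (rule LIM_zero_cancel)
    qed
    moreover have "\<forall>\<^sub>F y in at x. G t y - G t x = R y (F t y - F t x)"
      using evU
    proof (rule eventually_mono)
      fix y assume y: "y \<in> U"
      have "G t y - G t x = (G t y o\<^sub>L (F t x o\<^sub>L G t x)) - ((G t y o\<^sub>L F t y) o\<^sub>L G t x)"
        by (simp only: inv(1)[OF tx] inv(2)[OF tx(1) y] blinfun_compose_id)
      then show "G t y - G t x = R y (F t y - F t x)"
        unfolding Rapp by (auto intro!: blinfun_eqI simp: blinfun.bilinear_simps)
    qed
    ultimately show "(G t has_derivative (\<lambda>v. - (G t x o\<^sub>L frechet_derivative (F t) (at x) v o\<^sub>L G t x))) (at x)"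
      using has_derivative_blinfun_increment[OF D, of R "R x" "G t"] by (simp add: Rapp)
  qed
qed

text \<open>The minimum over the unit sphere, extended by homogeneity of degree two. Unlike mere
  positivity, the constant \<open>m\<close> is stable under small changes of
  \<open>G\<close>.\<close>

lemma positive_definite_lower_bound:
  fixes G :: "'b::euclidean_space \<Rightarrow>\<^sub>L 'b"
  assumes "\<And>u. u \<noteq> 0 \<Longrightarrow> G u \<bullet> u > 0"
  obtains m where "m > 0" "\<And>u. m * (norm u)\<^sup>2 \<le> G u \<bullet> u"
proof -
  have "continuous_on (sphere 0 1) (\<lambda>u. G u \<bullet> u)" by (intro continuous_intros)
  then obtain u0 where u0: "u0 \<in> sphere 0 1" "\<And>u. u \<in> sphere 0 1 \<Longrightarrow> G u0 \<bullet> u0 \<le> G u \<bullet> u"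
    using continuous_attains_inf[of "sphere (0::'b) 1" "\<lambda>u. G u \<bullet> u"] by (auto simp: Ball_def)
  show ?thesis
  proof
    show "G u0 \<bullet> u0 > 0" using assms[of u0] u0(1) by (metis dist_0_norm mem_sphere norm_zero zero_neq_one)
    fix u
    show "(G u0 \<bullet> u0) * (norm u)\<^sup>2 \<le> G u \<bullet> u"
    proof (cases "u = 0")
      case False
      then have "G u0 \<bullet> u0 \<le> G (u /\<^sub>R norm u) \<bullet> (u /\<^sub>R norm u)" by (intro u0(2)) simp
      also have "\<dots> = (G u \<bullet> u) / (norm u)\<^sup>2"
        by (simp add: blinfun.bilinear_simps power2_eq_square divide_inverse)
      finally show ?thesis using False by (simp add: field_simps)
    qed simp
  qed
qed

text \<open>The square root \<open>S\<close> of \<open>P\<close> is not given by a formula in \<open>P\<close>. Increments satisfy the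
  Sylvester equation \<open>S' D + D S = \<Delta>P\<close>, which the eigenprojections of \<open>S\<close> decouple into
  \<open>(S' + \<mu>\<^sub>i) D \<pi>\<^sub>i = \<Delta>P \<pi>\<^sub>i\<close>. This yields continuity, differentiability and a formula for the
  derivative that allows induction on the order of differentiability.\<close>

lemma param_C_k_sqrt:
  fixes P S G :: "'t \<Rightarrow> 'e::euclidean_space \<Rightarrow> ('b::euclidean_space \<Rightarrow>\<^sub>L 'b)"
  assumes U: "open U" and P: "param_C_k k T U P" and G: "param_C_k 0 T U G"
    and pos: "\<And>t x u. t \<in> topspace T \<Longrightarrow> x \<in> U \<Longrightarrow> u \<noteq> 0 \<Longrightarrow> G t x u \<bullet> u > 0"
    and psd: "\<And>t x u. t \<in> topspace T \<Longrightarrow> x \<in> U \<Longrightarrow> G t x (S t x u) \<bullet> u \<ge> 0"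
    and sq: "\<And>t x. t \<in> topspace T \<Longrightarrow> x \<in> U \<Longrightarrow> S t x o\<^sub>L S t x = P t x"
    and eig: "\<And>t x. t \<in> topspace T \<Longrightarrow> x \<in> U \<Longrightarrow> \<exists>I \<mu> \<pi>. finite (I :: nat set) \<and>
        (\<forall>i\<in>I. \<mu> i > 0 \<and> S t x o\<^sub>L \<pi> i = \<mu> i *\<^sub>R \<pi> i \<and> \<pi> i o\<^sub>L S t x = \<mu> i *\<^sub>R \<pi> i) \<and> (\<Sum>i\<in>I. \<pi> i) = id_blinfun"
  shows "param_C_k k T U S"
proof -
  note bl = blinfun.bilinear_simps
  have incr: "(S t' x' o\<^sub>L (S t' x' - S t x)) + ((S t' x' - S t x) o\<^sub>L S t x) = P t' x' - P t x"
    if "t \<in> topspace T" "x \<in> U" "t' \<in> topspace T" "x' \<in> U" for t x t' x'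
    unfolding sq[OF that(1,2), symmetric] sq[OF that(3,4), symmetric]
    by (auto intro!: blinfun_eqI simp: bl)
  have decoupled: "(S' + l *\<^sub>R id_blinfun) o\<^sub>L (D o\<^sub>L p) = (((S' o\<^sub>L D) + (D o\<^sub>L S)) o\<^sub>L p)"
    if "S o\<^sub>L p = l *\<^sub>R p" for S S' D p :: "'b \<Rightarrow>\<^sub>L 'b" and l
  proof (rule blinfun_eqI)
    fix u
    have "S (p u) = l *\<^sub>R p u" using arg_cong[OF that, of "\<lambda>f. blinfun_apply f u"] by (simp add: bl)
    then show "((S' + l *\<^sub>R id_blinfun) o\<^sub>L (D o\<^sub>L p)) u = (((S' o\<^sub>L D) + (D o\<^sub>L S)) o\<^sub>L p) u"
      by (simp add: bl)
  qed
  have cont: "param_C_k 0 T U S"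
  proof (rule param_C_k_0I)
    fix t x assume tx: "t \<in> topspace T" "x \<in> U"
    let ?F = "atin (prod_topology T (top_of_set U)) (t, x)"
    define D where "D z = S (fst z) (snd z) - S t x" for z
    define dP where "dP z = P (fst z) (snd z) - P t x" for z
    obtain I \<mu> and \<pi> :: "nat \<Rightarrow> 'b \<Rightarrow>\<^sub>L 'b" where I: "finite (I :: nat set)"
      "\<And>i. i \<in> I \<Longrightarrow> \<mu> i > 0 \<and> S t x o\<^sub>L \<pi> i = \<mu> i *\<^sub>R \<pi> i" "(\<Sum>i\<in>I. \<pi> i) = id_blinfun"
      using eig[OF tx] by blast
    obtain m where m: "m > 0" "\<And>u. m * (norm u)\<^sup>2 \<le> G t x u \<bullet> u"
      using positive_definite_lower_bound[of "G t x"] pos[OF tx] by blast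
    have evT: "\<forall>\<^sub>F z in ?F. fst z \<in> topspace T \<and> snd z \<in> U"
      by (auto simp: eventually_atin intro!: exI[of _ "topspace (prod_topology T (top_of_set U))"] tx)
    have evG: "\<forall>\<^sub>F z in ?F. norm (G (fst z) (snd z) - G t x) < m / 2"
      using tendstoD[OF param_C_k_tendsto[OF G tx], of "m/2"] m(1) by (simp add: dist_norm)
    have dP: "(dP \<longlongrightarrow> 0) ?F"
      unfolding dP_def using param_C_k_tendsto[OF P tx] by (rule LIM_zero)
    define C where "C = norm (G t x) + m / 2"
    have bound: "norm (D z o\<^sub>L \<pi> i) \<le> C * norm (\<pi> i) / \<mu> i * (2 / m) * norm (dP z)"
      if z: "fst z \<in> topspace T \<and> snd z \<in> U" "norm (G (fst z) (snd z) - G t x) < m / 2" and i: "i \<in> I" for z i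
    proof (rule norm_blinfun_bound)
      show "0 \<le> C * norm (\<pi> i) / \<mu> i * (2 / m) * norm (dP z)"
        unfolding C_def using m(1) I(2)[OF i] by (intro mult_nonneg_nonneg divide_nonneg_nonneg add_nonneg_nonneg) auto
      fix u
      define Z where "Z = D z (\<pi> i u)"
      let ?G = "G (fst z) (snd z)" and ?S = "S (fst z) (snd z)"
      have "(?S + \<mu> i *\<^sub>R id_blinfun) o\<^sub>L (D z o\<^sub>L \<pi> i) = dP z o\<^sub>L \<pi> i"
        using decoupled[of "S t x" "\<pi> i" "\<mu> i" ?S "D z"] I(2)[OF i] incr[OF tx, of "fst z" "snd z"] z(1)
        unfolding D_def dP_def by simp
      from arg_cong[OF this, of "\<lambda>f. blinfun_apply f u"]
      have eq: "?S Z + \<mu> i *\<^sub>R Z = dP z (\<pi> i u)" by (simp add: Z_def bl)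
      \<comment> \<open>Half of the lower bound at the base point survives nearby, because
        \<open>?G\<close> differs from \<open>G t x\<close> by less than
        \<open>m / 2\<close>.\<close>
      have "?G Z \<bullet> Z \<ge> (m / 2) * (norm Z)\<^sup>2"
      proof -
        have "\<bar>(?G - G t x) Z \<bullet> Z\<bar> \<le> norm ((?G - G t x) Z) * norm Z" by (rule Cauchy_Schwarz_ineq2)
        also have "\<dots> \<le> (norm (?G - G t x) * norm Z) * norm Z"
          by (intro mult_right_mono norm_blinfun) simp
        also have "\<dots> \<le> (m / 2 * norm Z) * norm Z"
          using z(2) by (intro mult_right_mono) auto
        finally have "\<bar>(?G - G t x) Z \<bullet> Z\<bar> \<le> m / 2 * (norm Z)\<^sup>2" by (simp add: power2_eq_square)
        moreover have "(?G - G t x) Z \<bullet> Z = ?G Z \<bullet> Z - G t x Z \<bullet> Z" by (simp add: bl inner_diff_left)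
        ultimately show ?thesis using m(2)[of Z] by linarith
      qed
      \<comment> \<open>The decoupled equation is paired with \<open>Z\<close> in the inner product
        of \<open>?G\<close>. The term with \<open>?S\<close> is nonnegative by \<open>psd\<close>,
        so the multiple of \<open>Z\<close> is controlled by \<open>dP z\<close> alone; no bound on
        \<open>?S\<close> enters.\<close>
      then have "\<mu> i * ((m / 2) * (norm Z)\<^sup>2) \<le> \<mu> i * (?G Z \<bullet> Z)"
        using I(2)[OF i] by (intro mult_left_mono) auto
      also have "\<dots> \<le> ?G (dP z (\<pi> i u)) \<bullet> Z"
        unfolding eq[symmetric] using psd[of "fst z" "snd z" Z] z(1) by (simp add: bl inner_add_left)
      also have "\<dots> \<le> norm (?G (dP z (\<pi> i u))) * norm Z" by (rule norm_cauchy_schwarz)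
      also have "\<dots> \<le> (C * (norm (dP z) * (norm (\<pi> i) * norm u))) * norm Z"
      proof (rule mult_right_mono)
        have "norm (?G (dP z (\<pi> i u))) \<le> norm ?G * norm (dP z (\<pi> i u))" by (rule norm_blinfun)
        also have "\<dots> \<le> C * (norm (dP z) * (norm (\<pi> i) * norm u))"
        proof (intro mult_mono)
          show "norm ?G \<le> C" unfolding C_def using z(2) norm_triangle_ineq2[of ?G "G t x"] by linarith
          show "0 \<le> C" unfolding C_def using m(1) by (simp add: add_nonneg_nonneg)
          have "norm (dP z (\<pi> i u)) \<le> norm (dP z) * norm (\<pi> i u)" by (rule norm_blinfun)
          also have "\<dots> \<le> norm (dP z) * (norm (\<pi> i) * norm u)" by (intro mult_left_mono norm_blinfun) simp
          finally show "norm (dP z (\<pi> i u)) \<le> norm (dP z) * (norm (\<pi> i) * norm u)" .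
        qed simp
        finally show "norm (?G (dP z (\<pi> i u))) \<le> C * (norm (dP z) * (norm (\<pi> i) * norm u))" .
      qed simp
      finally have le: "(\<mu> i * (m / 2)) * norm Z * norm Z \<le> (C * (norm (dP z) * (norm (\<pi> i) * norm u))) * norm Z"
        by (simp add: power2_eq_square mult_ac)
      have "(\<mu> i * (m / 2)) * norm Z \<le> C * (norm (dP z) * (norm (\<pi> i) * norm u))"
      proof (cases "norm Z = 0")
        case True
        have "0 \<le> C" unfolding C_def using m(1) by (simp add: add_nonneg_nonneg)
        with True show ?thesis by simp
      next
        case False
        then have "0 < norm Z" by simp
        from mult_right_le_imp_le[OF le this] show ?thesis .
      qed
      then show "norm ((D z o\<^sub>L \<pi> i) u) \<le> C * norm (\<pi> i) / \<mu> i * (2 / m) * norm (dP z) * norm u"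
        using m(1) I(2)[OF i] by (simp add: Z_def field_simps)
    qed
    have "((\<lambda>z. D z o\<^sub>L \<pi> i) \<longlongrightarrow> 0) ?F" if i: "i \<in> I" for i
    proof (rule Lim_null_comparison)
      show "\<forall>\<^sub>F z in ?F. norm (D z o\<^sub>L \<pi> i) \<le> C * norm (\<pi> i) / \<mu> i * (2 / m) * norm (dP z)"
        using evT evG by eventually_elim (rule bound[OF _ _ i])
      show "((\<lambda>z. C * norm (\<pi> i) / \<mu> i * (2 / m) * norm (dP z)) \<longlongrightarrow> 0) ?F"
        by (intro tendsto_mult_right_zero tendsto_norm_zero dP)
    qed
    then have "((\<lambda>z. \<Sum>i\<in>I. D z o\<^sub>L \<pi> i) \<longlongrightarrow> 0) ?F"
      using tendsto_sum[of I "\<lambda>i z. D z o\<^sub>L \<pi> i" "\<lambda>_. 0" ?F] by simp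
    moreover have "(\<Sum>i\<in>I. D z o\<^sub>L \<pi> i) = D z" for z
      unfolding bounded_bilinear.sum_right[OF bounded_bilinear_blinfun_compose, symmetric] I(3) by simp
    ultimately have "(D \<longlongrightarrow> 0) ?F" by simp
    then show "((\<lambda>z. S (fst z) (snd z)) \<longlongrightarrow> S t x) ?F"
      unfolding D_def by (rule LIM_zero_cancel)
  qed
  \<comment> \<open>The Sylvester operator. Its two arguments are kept apart since an increment of
    the root involves the values at two points.\<close>
  define N :: "('b \<Rightarrow>\<^sub>L 'b) \<Rightarrow> ('b \<Rightarrow>\<^sub>L 'b) \<Rightarrow> ('b \<Rightarrow>\<^sub>L 'b) \<Rightarrow>\<^sub>L ('b \<Rightarrow>\<^sub>L 'b)"
    where "N S' S = Blinfun (\<lambda>Z. (S' o\<^sub>L Z) + (Z o\<^sub>L S))" for S' S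
  note bc = bounded_bilinear_blinfun_compose
  have Napp: "N S' S Z = (S' o\<^sub>L Z) + (Z o\<^sub>L S)" for S' S Z
    unfolding N_def
    by (subst bounded_linear_Blinfun_apply)
      (auto intro!: bounded_linear_add bounded_bilinear.bounded_linear_right[OF bc] bounded_bilinear.bounded_linear_left[OF bc])
  have Nle: "norm (N S' S) \<le> norm S' + norm S" for S' S
  proof (rule norm_blinfun_bound)
    show "norm (N S' S Z) \<le> (norm S' + norm S) * norm Z" for Z
      unfolding Napp using norm_triangle_ineq[of "S' o\<^sub>L Z" "Z o\<^sub>L S"] norm_blinfun_compose[of S' Z] norm_blinfun_compose[of Z S]
      by (simp add: algebra_simps)
  qed simp
  \<comment> \<open>\<open>S' + \<mu>\<^sub>i\<close> is injective because \<open>S'\<close> is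
    nonnegative for the inner product at its own point \<open>x'\<close>. With its inverses
    \<open>J i\<close>, the map that sends \<open>Z\<close> to the sum of the
    \<open>J i Z \<pi>\<^sub>i\<close> inverts the Sylvester operator.\<close>
  have Ninv: "\<exists>R. N S' (S t x) o\<^sub>L R = id_blinfun \<and> R o\<^sub>L N S' (S t x) = id_blinfun"
    if tx: "t \<in> topspace T" "x \<in> U" and S': "\<And>u. G t x' (S' u) \<bullet> u \<ge> 0" "x' \<in> U" for t x x' and S' :: "'b \<Rightarrow>\<^sub>L 'b"
  proof -
    obtain I \<mu> and \<pi> :: "nat \<Rightarrow> 'b \<Rightarrow>\<^sub>L 'b" where I: "finite (I :: nat set)" "(\<Sum>i\<in>I. \<pi> i) = id_blinfun"
      "\<And>i. i \<in> I \<Longrightarrow> \<mu> i > 0 \<and> S t x o\<^sub>L \<pi> i = \<mu> i *\<^sub>R \<pi> i \<and> \<pi> i o\<^sub>L S t x = \<mu> i *\<^sub>R \<pi> i"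
      using eig[OF tx] by blast
    have "\<exists>J. (S' + \<mu> i *\<^sub>R id_blinfun) o\<^sub>L J = id_blinfun \<and> J o\<^sub>L (S' + \<mu> i *\<^sub>R id_blinfun) = id_blinfun" if i: "i \<in> I" for i
    proof -
      let ?A = "S' + \<mu> i *\<^sub>R id_blinfun"
      have "inj (blinfun_apply ?A)"
      proof (subst linear_injective_0[OF bounded_linear.linear[OF blinfun.bounded_linear_right]], intro allI impI)
        fix u assume "blinfun_apply ?A u = 0"
        then have "S' u + \<mu> i *\<^sub>R u = 0" by (simp add: bl)
        from arg_cong[OF this, of "\<lambda>w. G t x' w \<bullet> u"]
        have "G t x' (S' u) \<bullet> u + \<mu> i * (G t x' u \<bullet> u) = 0" by (simp add: bl inner_add_left)
        then have "\<mu> i * (G t x' u \<bullet> u) \<le> 0" using S'(1)[of u] by linarith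
        then show "u = 0" using pos[OF tx(1) S'(2), of u] I(3)[OF i] by (metis mult_pos_pos not_le)
      qed
      then show ?thesis by (rule blinfun_inverse_exists)
    qed
    then obtain J where J: "\<And>i. i \<in> I \<Longrightarrow> (S' + \<mu> i *\<^sub>R id_blinfun) o\<^sub>L J i = id_blinfun"
      "\<And>i. i \<in> I \<Longrightarrow> J i o\<^sub>L (S' + \<mu> i *\<^sub>R id_blinfun) = id_blinfun" by metis
    define R where "R = Blinfun (\<lambda>Z. \<Sum>i\<in>I. J i o\<^sub>L (Z o\<^sub>L \<pi> i))"
    have Rapp: "R Z = (\<Sum>i\<in>I. J i o\<^sub>L (Z o\<^sub>L \<pi> i))" for Z
      unfolding R_def
      by (subst bounded_linear_Blinfun_apply)
        (auto intro!: bounded_linear_sum bounded_linear_compose[OF bounded_bilinear.bounded_linear_right[OF bc] bounded_bilinear.bounded_linear_left[OF bc]])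
    have part: "(\<Sum>i\<in>I. Z o\<^sub>L \<pi> i) = Z" for Z :: "'b \<Rightarrow>\<^sub>L 'b"
      unfolding bounded_bilinear.sum_right[OF bc, symmetric] I(2) by simp
    have "N S' (S t x) (R Z) = Z" for Z
    proof -
      have "N S' (S t x) (R Z) = (\<Sum>i\<in>I. N S' (S t x) (J i o\<^sub>L (Z o\<^sub>L \<pi> i)))"
        unfolding Rapp by (rule blinfun.sum_right)
      also have "\<dots> = (\<Sum>i\<in>I. Z o\<^sub>L \<pi> i)"
      proof (rule sum.cong[OF refl])
        fix i assume i: "i \<in> I"
        have "N S' (S t x) (J i o\<^sub>L (Z o\<^sub>L \<pi> i)) = ((S' + \<mu> i *\<^sub>R id_blinfun) o\<^sub>L J i) o\<^sub>L (Z o\<^sub>L \<pi> i)"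
        proof (rule blinfun_eqI)
          fix u
          have "\<pi> i (S t x u) = \<mu> i *\<^sub>R \<pi> i u"
            using arg_cong[OF I(3)[OF i, THEN conjunct2, THEN conjunct2], of "\<lambda>f. blinfun_apply f u"] by (simp add: bl)
          then show "N S' (S t x) (J i o\<^sub>L (Z o\<^sub>L \<pi> i)) u = (((S' + \<mu> i *\<^sub>R id_blinfun) o\<^sub>L J i) o\<^sub>L (Z o\<^sub>L \<pi> i)) u"
            by (simp add: Napp bl)
        qed
        then show "N S' (S t x) (J i o\<^sub>L (Z o\<^sub>L \<pi> i)) = Z o\<^sub>L \<pi> i" by (simp only: J(1)[OF i] blinfun_compose_id)
      qed
      finally show ?thesis using part by simp
    qed
    moreover have "R (N S' (S t x) Z) = Z" for Z
    proof -
      have "R (N S' (S t x) Z) = (\<Sum>i\<in>I. Z o\<^sub>L \<pi> i)"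
        unfolding Rapp
      proof (rule sum.cong[OF refl])
        fix i assume i: "i \<in> I"
        have "J i o\<^sub>L (N S' (S t x) Z o\<^sub>L \<pi> i) = J i o\<^sub>L ((S' + \<mu> i *\<^sub>R id_blinfun) o\<^sub>L (Z o\<^sub>L \<pi> i))"
          unfolding Napp using decoupled[of "S t x" "\<pi> i" "\<mu> i" S' Z] I(3)[OF i] by simp
        also have "\<dots> = (J i o\<^sub>L (S' + \<mu> i *\<^sub>R id_blinfun)) o\<^sub>L (Z o\<^sub>L \<pi> i)" by (auto intro: blinfun_eqI)
        finally show "J i o\<^sub>L (N S' (S t x) Z o\<^sub>L \<pi> i) = Z o\<^sub>L \<pi> i" by (simp only: J(2)[OF i] blinfun_compose_id)
      qed
      then show ?thesis using part by simp
    qed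
    ultimately show ?thesis by (intro exI[of _ R] conjI blinfun_eqI) simp_all
  qed
  define R where "R t x x' = (SOME R. N (S t x') (S t x) o\<^sub>L R = id_blinfun \<and> R o\<^sub>L N (S t x') (S t x) = id_blinfun)" for t x x'
  have R: "N (S t x') (S t x) o\<^sub>L R t x x' = id_blinfun" "R t x x' o\<^sub>L N (S t x') (S t x) = id_blinfun"
    if "t \<in> topspace T" "x \<in> U" "x' \<in> U" for t x x'
    using someI_ex[OF Ninv[OF that(1,2), of x' "S t x'"]] psd[OF that(1,3)] that(3) unfolding R_def by auto
  \<comment> \<open>\<open>R t x y\<close> takes the increment of \<open>P t\<close> between
    \<open>x\<close> and \<open>y\<close> to that of \<open>S t\<close>; continuity of the root,
    proved above, makes it converge to \<open>R t x x\<close>.\<close>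
  have der: "(S t has_derivative (\<lambda>v. R t x x (P' v))) (at x)"
    if tx: "t \<in> topspace T" "x \<in> U" and P': "(P t has_derivative P') (at x)" for t x P'
  proof (rule has_derivative_blinfun_increment[OF P'])
    have evU: "\<forall>\<^sub>F y in at x. y \<in> U" using U tx(2) by (simp add: eventually_at_in_open')
    have "(S t \<longlongrightarrow> S t x) (at x)"
    proof -
      have "C_k_on 0 U (S t)" using C_k_of_param_C_k[OF cont tx(1)] .
      then have "isCont (S t) x" using U tx(2) by (simp add: continuous_on_eq_continuous_at)
      then show ?thesis by (simp add: isCont_def)
    qed
    then have nS: "((\<lambda>y. norm (S t y - S t x)) \<longlongrightarrow> 0) (at x)" by (intro tendsto_norm_zero LIM_zero)
    have nN: "norm (N (S t y) (S t x) - N (S t x) (S t x)) \<le> norm (S t y - S t x)" for y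
    proof -
      have "N (S t y) (S t x) - N (S t x) (S t x) = N (S t y - S t x) 0"
        by (rule blinfun_eqI, rule blinfun_eqI) (simp add: Napp bl)
      then show ?thesis using Nle[of "S t y - S t x" 0] by simp
    qed
    have "((\<lambda>y. N (S t y) (S t x) - N (S t x) (S t x)) \<longlongrightarrow> 0) (at x)"
      by (rule Lim_null_comparison[OF always_eventually[OF allI[OF nN]] nS])
    then have Nt: "((\<lambda>y. N (S t y) (S t x)) \<longlongrightarrow> N (S t x) (S t x)) (at x)" by (rule LIM_zero_cancel)
    show "((R t x) \<longlongrightarrow> R t x x) (at x)"
    proof (rule tendsto_inverse_blinfun[OF Nt _ R(1)[OF tx tx(2)]])
      show "\<forall>\<^sub>F z in at x. R t x z o\<^sub>L N (S t z) (S t x) = id_blinfun"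
        using evU by (rule eventually_mono) (rule R(2)[OF tx])
    qed
    show "\<forall>\<^sub>F y in at x. S t y - S t x = R t x y (P t y - P t x)"
      using evU
    proof (rule eventually_mono)
      fix y assume y: "y \<in> U"
      have "P t y - P t x = N (S t y) (S t x) (S t y - S t x)"
        unfolding Napp using incr[OF tx tx(1) y] by simp
      then show "S t y - S t x = R t x y (P t y - P t x)"
        using arg_cong[OF R(2)[OF tx y], of "\<lambda>f. blinfun_apply f (S t y - S t x)"] by simp
    qed
  qed
  have Nlin: "bounded_linear (\<lambda>S. N S S)"
    by (rule bounded_linear_intro[where K=2])
      (auto intro!: blinfun_eqI simp: Napp bl scaleR_add_right intro: order_trans[OF Nle])
  show ?thesis
    using P
  proof (induction k)
    case 0
    show ?case by (rule cont)
  next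
    case (Suc k)
    have S: "param_C_k k T U S" by (rule Suc.IH[OF param_C_k_Suc_imp[OF Suc.prems]])
    show ?case
    proof (rule param_C_k_SucI[OF U cont der])
      show "(P t has_derivative frechet_derivative (P t) (at x)) (at x)" if "t \<in> topspace T" "x \<in> U" for t x
        by (rule param_C_k_SucD[OF Suc.prems that])
      \<comment> \<open>On the diagonal the Sylvester operator is linear in the root, so its inverse
        inherits the order already known for \<open>S\<close>.\<close>
      have "param_C_k k T U (\<lambda>t x. R t x x)"
        by (rule param_C_k_inverse[OF U param_C_k_linear[OF U Nlin S]]) (auto intro: R)
      then show "param_C_k k T U (\<lambda>t x. R t x x (frechet_derivative (P t) (at x) v))" for v
        by (intro param_C_k_apply U param_C_k_SucD'[OF Suc.prems])
    qed
  qed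
qed

subsection \<open>Inner products and skew forms\<close>

lemma bilinear_sum_left: "bilinear b \<Longrightarrow> b (\<Sum>i\<in>I. f i) y = (\<Sum>i\<in>I. b (f i) y)"
  unfolding bilinear_def using linear_sum[of "\<lambda>x. b x y"] by blast

lemma bilinear_sum_right: "bilinear b \<Longrightarrow> b y (\<Sum>i\<in>I. f i) = (\<Sum>i\<in>I. b y (f i))"
  unfolding bilinear_def using linear_sum[of "b y"] by blast

text \<open>Definiteness is split off because the forms produced by the retraction are at first only
  known to be symmetric. It is obtained afterwards from an orthonormal family of full size.\<close>

locale symmetric_form =
  fixes g :: "'e::euclidean_space \<Rightarrow> 'e \<Rightarrow> real"
  assumes bil: "bilinear g" and sym: "g X Y = g Y X"
begin

lemmas g_simps = bilinear_ladd[OF bil] bilinear_radd[OF bil] bilinear_lmul[OF bil] bilinear_rmul[OF bil]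
  bilinear_lneg[OF bil] bilinear_rneg[OF bil] bilinear_lsub[OF bil] bilinear_rsub[OF bil]
  bilinear_lzero[OF bil] bilinear_rzero[OF bil] bilinear_sum_left[OF bil] bilinear_sum_right[OF bil]

definition orthonormal_family :: "'i set \<Rightarrow> ('i \<Rightarrow> 'e) \<Rightarrow> bool" where
  "orthonormal_family I f \<longleftrightarrow> (\<forall>a\<in>I. \<forall>b\<in>I. g (f a) (f b) = (if a = b then 1 else 0))"

lemma orthonormal_familyD:
  "orthonormal_family I f \<Longrightarrow> a \<in> I \<Longrightarrow> b \<in> I \<Longrightarrow> g (f a) (f b) = (if a = b then 1 else 0)"
  unfolding orthonormal_family_def by blast

lemma orthonormal_family_inj: "orthonormal_family I f \<Longrightarrow> inj_on f I"
  unfolding orthonormal_family_def inj_on_def by (metis zero_neq_one)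

lemma orthonormal_family_independent:
  assumes "finite I" "orthonormal_family I f"
  shows "independent (f ` I)"
proof (rule independent_if_scalars_zero)
  show "finite (f ` I)" using assms by simp
  fix c x assume *: "(\<Sum>x\<in>f ` I. c x *\<^sub>R x) = 0" "x \<in> f ` I"
  then obtain a where a: "a \<in> I" "x = f a" by auto
  have "0 = g (\<Sum>x\<in>f ` I. c x *\<^sub>R x) (f a)" using * by (simp add: g_simps)
  also have "\<dots> = (\<Sum>b\<in>I. c (f b) * (if b = a then 1 else 0))"
    unfolding sum.reindex[OF orthonormal_family_inj[OF assms(2)]]
    using a orthonormal_familyD[OF assms(2)] by (auto simp: g_simps intro!: sum.cong)
  also have "\<dots> = c x" using a assms(1) by (simp add: if_distrib sum.delta cong: if_cong)
  finally show "c x = 0" by simp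
qed

lemma orthonormal_family_expansion:
  assumes "finite I" "orthonormal_family I f" "X \<in> span (f ` I)"
  shows "X = (\<Sum>a\<in>I. g X (f a) *\<^sub>R f a)"
  using assms(3)
proof (induction rule: span_induct)
  case base
  have "linear (\<lambda>X. X - (\<Sum>a\<in>I. g X (f a) *\<^sub>R f a))"
    by (rule linearI)
      (simp_all add: g_simps scaleR_add_left sum.distrib scaleR_diff_right scaleR_sum_right)
  from linear_subspace_kernel[OF this] show ?case by simp
next
  case (step x)
  then obtain b where b: "b \<in> I" "x = f b" by auto
  have "(\<Sum>a\<in>I. g x (f a) *\<^sub>R f a) = (\<Sum>a\<in>I. (if a = b then f a else 0))"
    using b orthonormal_familyD[OF assms(2)] by (auto intro!: sum.cong)
  then show ?case using b assms(1) by simp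
qed

lemma orthonormal_family_card_le:
  assumes "finite I" "orthonormal_family I f" shows "card I \<le> DIM('e)"
  using independent_card_le_dim[OF subset_UNIV orthonormal_family_independent[OF assms]]
    card_image[OF orthonormal_family_inj[OF assms(2)]] by (simp add: dim_UNIV)

lemma orthonormal_family_spans:
  assumes "finite I" "orthonormal_family I f" "card I = DIM('e)" shows "span (f ` I) = UNIV"
  using card_ge_dim_independent[OF subset_UNIV orthonormal_family_independent[OF assms(1,2)]]
    card_image[OF orthonormal_family_inj[OF assms(2)]] assms(3) by (auto simp: dim_UNIV)

lemma orthonormal_family_card:
  assumes "finite I" "orthonormal_family I f" "span (f ` I) = UNIV" shows "card I = DIM('e)"
  using dim_eq_card[of "f ` I" UNIV] orthonormal_family_independent[OF assms(1,2)] assms(3)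
    card_image[OF orthonormal_family_inj[OF assms(2)]] by (simp add: dim_UNIV)

text \<open>Parseval's identity: \<open>g X X\<close> is the sum of the squares of the coordinates,
  not all of which vanish.\<close>

lemma orthonormal_family_pos:
  assumes "finite I" "orthonormal_family I f" "span (f ` I) = UNIV" "X \<noteq> 0"
  shows "g X X > 0"
proof -
  have X: "X = (\<Sum>a\<in>I. g X (f a) *\<^sub>R f a)"
    using orthonormal_family_expansion[OF assms(1,2)] assms(3) by blast
  have "g X X = g X (\<Sum>a\<in>I. g X (f a) *\<^sub>R f a)" using X by simp
  also have "\<dots> = (\<Sum>a\<in>I. (g X (f a))\<^sup>2)" by (simp add: g_simps power2_eq_square)
  finally have *: "g X X = (\<Sum>a\<in>I. (g X (f a))\<^sup>2)" .
  obtain a where "a \<in> I" "g X (f a) \<noteq> 0"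
    using X assms(4) by (metis (mono_tags, lifting) scaleR_eq_0_iff sum.neutral)
  then show ?thesis
    unfolding * using assms(1) by (intro sum_pos2) auto
qed

end

locale inner_product_form = symmetric_form g for g :: "'e::euclidean_space \<Rightarrow> 'e \<Rightarrow> real" +
  assumes pos: "X \<noteq> 0 \<Longrightarrow> g X X > 0"
begin

lemma nonneg: "g X X \<ge> 0"
  using pos[of X] by (cases "X = 0") (auto simp: g_simps)

lemma eq_zero: "g X X = 0 \<longleftrightarrow> X = 0"
  using pos[of X] by (cases "X = 0") (auto simp: g_simps)

lemma eqI: "(\<And>Y. g X Y = g X' Y) \<Longrightarrow> X = X'"
  using eq_zero[of "X - X'"] by (simp add: g_simps)

text \<open>Gram-Schmidt as a maximality argument. Among the orthonormal sets in \<open>V\<close>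
  that contain \<open>B0\<close>, whose sizes are bounded by the dimension, a largest one spans
  \<open>V\<close>: otherwise the normalized residual of a vector outside the span could be
  added.\<close>

lemma orthonormal_extension:
  assumes V: "subspace V" and B0: "finite B0" "B0 \<subseteq> V" "orthonormal_family B0 (\<lambda>x. x)"
  obtains B where "finite B" "B0 \<subseteq> B" "orthonormal_family B (\<lambda>x. x)" "span B = V"
proof -
  let ?P = "\<lambda>B. finite B \<and> B0 \<subseteq> B \<and> B \<subseteq> V \<and> orthonormal_family B (\<lambda>x. x)"
  have "\<exists>B. ?P B \<and> (\<forall>B'. ?P B' \<longrightarrow> card B' \<le> card B)"
    by (rule ex_has_greatest_nat[where b="Suc (DIM('e))" and k=B0])
      (use B0 orthonormal_family_card_le in \<open>auto simp: less_Suc_eq_le\<close>)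
  then obtain B where B: "finite B" "B0 \<subseteq> B" "B \<subseteq> V" "orthonormal_family B (\<lambda>x. x)"
    and max: "\<And>B'. ?P B' \<Longrightarrow> card B' \<le> card B" by blast
  have "V \<subseteq> span B"
  proof (rule ccontr)
    assume "\<not> V \<subseteq> span B"
    then obtain X where X: "X \<in> V" "X \<notin> span B" by blast
    define Y where "Y = X - (\<Sum>b\<in>B. g X b *\<^sub>R b)"
    have sp: "(\<Sum>b\<in>B. g X b *\<^sub>R b) \<in> span B" by (intro span_sum span_scale span_base)
    have Y0: "Y \<noteq> 0" using X(2) sp unfolding Y_def by auto
    have YV: "Y \<in> V"
      unfolding Y_def using V B(3) X(1) by (intro subspace_diff subspace_sum subspace_scale) auto
    have orth: "g Y b = 0" if "b \<in> B" for b
    proof -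
      have "g Y b = g X b - (\<Sum>a\<in>B. g X a * (if a = b then 1 else 0))"
        unfolding Y_def using orthonormal_familyD[OF B(4)] that by (auto simp: g_simps intro!: sum.cong)
      then show ?thesis using that B(1) by (simp add: if_distrib cong: if_cong)
    qed
    define Z where "Z = Y /\<^sub>R sqrt (g Y Y)"
    have gY: "g Y Y > 0" using pos[OF Y0] .
    have Z1: "g Z Z = 1" using gY by (simp add: Z_def g_simps divide_inverse[symmetric] real_sqrt_mult[symmetric] field_simps)
    have Zo: "g Z b = 0" if "b \<in> B" for b using orth[OF that] by (simp add: Z_def g_simps)
    have ZB: "Z \<notin> B" using Zo[of Z] Z1 by auto
    have ZV: "Z \<in> V" using YV V by (simp add: Z_def subspace_scale)
    have Zo': "g b Z = 0" if "b \<in> B" for b using Zo[OF that] sym[of b Z] by simp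
    have "orthonormal_family (insert Z B) (\<lambda>x. x)"
      using Z1 Zo Zo' orthonormal_familyD[OF B(4)] ZB unfolding orthonormal_family_def by auto
    then have "?P (insert Z B)" using B ZV by auto
    from max[OF this] show False using ZB B(1) by simp
  qed
  moreover have "span B \<subseteq> V" using B(3) V by (simp add: span_minimal)
  ultimately have "span B = V" by blast
  with B(1,2,4) show ?thesis by (rule that)
qed

lemma orthonormal_basis_exists:
  obtains B where "finite B" "orthonormal_family B (\<lambda>x. x)" "span B = UNIV" "card B = DIM('e)"
proof -
  have "orthonormal_family {} (\<lambda>x. x)" by (simp add: orthonormal_family_def)
  then obtain B where B: "finite B" "orthonormal_family B (\<lambda>x. x)" "span B = UNIV"
    by (rule orthonormal_extension[OF subspace_UNIV finite.emptyI empty_subsetI])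
  moreover have "card B = DIM('e)" using orthonormal_family_card[of B "\<lambda>x. x"] B by simp
  ultimately show ?thesis by (rule that)
qed

lemma riesz:
  assumes "linear \<phi>" shows "\<exists>Z. \<forall>Y. g Z Y = \<phi> Y"
proof -
  obtain B where B: "finite B" "orthonormal_family B (\<lambda>x. x)" "span B = UNIV"
    by (rule orthonormal_basis_exists)
  have "g (\<Sum>b\<in>B. \<phi> b *\<^sub>R b) Y = \<phi> Y" for Y
  proof -
    have "\<phi> Y = \<phi> (\<Sum>b\<in>B. g Y b *\<^sub>R b)"
      using orthonormal_family_expansion[OF B(1,2), of Y] B(3) by simp
    also have "\<dots> = (\<Sum>b\<in>B. g Y b * \<phi> b)" using assms by (simp add: linear_sum linear_scale)
    finally show ?thesis by (simp add: g_simps sym[of _ Y] mult.commute)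
  qed
  then show ?thesis by blast
qed

lemma form_representation:
  assumes "bilinear b"
  obtains A where "linear A" "\<And>X Y. g (A X) Y = b X Y"
proof -
  have "\<exists>Z. \<forall>Y. g Z Y = b X Y" for X
    by (rule riesz) (use assms in \<open>simp add: bilinear_def\<close>)
  then obtain A where A: "\<And>X Y. g (A X) Y = b X Y" by metis
  have "linear A"
    by (rule linearI; rule eqI) (simp_all add: A g_simps bilinear_ladd[OF assms] bilinear_lmul[OF assms])
  then show ?thesis using A by (rule that)
qed

end

lemma inner_product_form_inner: "inner_product_form (\<bullet>)"
  by standard (auto simp: bilinear_conv_bounded_bilinear bounded_bilinear_inner inner_commute)

context inner_product_form
begin

text \<open>Makes the unit sphere of \<open>g\<close> bounded in the Euclidean norm, hence
  compact.\<close>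

lemma form_lower_bound: obtains m where "m > 0" "\<And>X. m * (norm X)\<^sup>2 \<le> g X X"
proof -
  obtain A where A: "linear A" "\<And>X Y. A X \<bullet> Y = g X Y"
    by (rule inner_product_form.form_representation[OF inner_product_form_inner bil]) (rule that)
  have b: "blinfun_apply (Blinfun A) = A"
    using A(1) by (simp add: bounded_linear_Blinfun_apply linear_conv_bounded_linear)
  obtain m where "m > 0" "\<And>u. m * (norm u)\<^sup>2 \<le> Blinfun A u \<bullet> u"
    by (rule positive_definite_lower_bound[of "Blinfun A"]) (auto simp: b A(2) pos)
  then show ?thesis by (intro that[of m]) (simp_all add: b A(2))
qed

text \<open>For the operator \<open>A\<close> with \<open>g (A X) Y = \<omega> X Y\<close> the last
  condition says that \<open>A\<close> maps \<open>v i\<close> to \<open>\<mu> i\<close> times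
  \<open>w i\<close> and \<open>w i\<close> to minus \<open>\<mu> i\<close> times
  \<open>v i\<close>. The Boolean index merges both sequences into one orthonormal family. Spanning
  is left out so that a frame can be enlarged block by block.\<close>

definition skew_frame ::
  "('e \<Rightarrow> 'e \<Rightarrow> real) \<Rightarrow> nat \<Rightarrow> (nat \<Rightarrow> real) \<Rightarrow> (nat \<Rightarrow> 'e) \<Rightarrow> (nat \<Rightarrow> 'e) \<Rightarrow> bool" where
  "skew_frame \<omega> k \<mu> v w \<longleftrightarrow> (\<forall>i<k. \<mu> i > 0) \<and>
    orthonormal_family ({..<k} \<times> UNIV) (\<lambda>(i, b). if b then w i else v i) \<and>
    (\<forall>i<k. \<forall>Y. \<omega> (v i) Y = \<mu> i * g (w i) Y \<and> \<omega> (w i) Y = - \<mu> i * g (v i) Y)"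

text \<open>A pair of unit vectors maximizing \<open>\<omega>\<close> on the orthogonal complement of the pairs found so far
  spans the next block.\<close>

lemma skew_normal_form:
  assumes bo: "bilinear \<omega>" and alt: "\<And>X. \<omega> X X = 0" and nondeg: "\<forall>X. (\<forall>Y. \<omega> X Y = 0) \<longrightarrow> X = 0"
  shows "\<exists>k \<mu> v w. skew_frame \<omega> k \<mu> v w \<and>
    span ((\<lambda>(i, b). if b then w i else v i) ` ({..<k} \<times> UNIV)) = UNIV"
proof -
  note o_simps = bilinear_ladd[OF bo] bilinear_radd[OF bo] bilinear_lmul[OF bo] bilinear_rmul[OF bo]
    bilinear_lneg[OF bo] bilinear_rneg[OF bo]
  have anti: "\<omega> X Y = - \<omega> Y X" for X Y
  proof -
    have "\<omega> X X + \<omega> X Y + (\<omega> Y X + \<omega> Y Y) = 0"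
      using alt[of "X + Y"] by (simp only: o_simps)
    then show ?thesis using alt[of X] alt[of Y] by simp
  qed
  obtain A where A: "linear A" "\<And>X Y. g (A X) Y = \<omega> X Y"
    by (rule form_representation[OF bo]) (rule that)
  have NF0: "\<exists>\<mu> v w. skew_frame \<omega> 0 \<mu> v w" by (simp add: skew_frame_def orthonormal_family_def)
  have bound: "k < Suc (DIM('e))" if "\<exists>\<mu> v w. skew_frame \<omega> k \<mu> v w" for k
  proof -
    obtain \<mu> v w where "skew_frame \<omega> k \<mu> v w" using \<open>\<exists>\<mu> v w. skew_frame \<omega> k \<mu> v w\<close> by blast
    then have "card ({..<k} \<times> (UNIV :: bool set)) \<le> DIM('e)"
      unfolding skew_frame_def by (intro orthonormal_family_card_le[of _ "\<lambda>(i, b). if b then w i else v i"]) auto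
    then show ?thesis by (simp add: card_cartesian_product)
  qed
  have "\<exists>k. (\<exists>\<mu> v w. skew_frame \<omega> k \<mu> v w) \<and> (\<forall>j. (\<exists>\<mu> v w. skew_frame \<omega> j \<mu> v w) \<longrightarrow> j \<le> k)"
    using ex_has_greatest_nat[of "\<lambda>k. \<exists>\<mu> v w. skew_frame \<omega> k \<mu> v w" 0 "\<lambda>k. k" "Suc (DIM('e))"] NF0 bound by blast
  then obtain k \<mu> v w where NF: "skew_frame \<omega> k \<mu> v w" and max: "\<And>j \<mu>' v' w'. skew_frame \<omega> j \<mu>' v' w' \<Longrightarrow> j \<le> k" by blast
  let ?f = "\<lambda>v w (i::nat, b). if b then w i else (v i :: 'e)"
  have on: "orthonormal_family ({..<k} \<times> UNIV) (?f v w)" using NF by (simp add: skew_frame_def)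
  have o: "\<And>i Y. i < k \<Longrightarrow> \<omega> (v i) Y = \<mu> i * g (w i) Y" "\<And>i Y. i < k \<Longrightarrow> \<omega> (w i) Y = - \<mu> i * g (v i) Y"
    using NF unfolding skew_frame_def by blast+
  have mu: "\<And>i. i < k \<Longrightarrow> \<mu> i > 0" using NF unfolding skew_frame_def by blast
  have onD: "g (?f v w a) (?f v w b) = (if a = b then 1 else 0)" if "a \<in> {..<k} \<times> UNIV" "b \<in> {..<k} \<times> UNIV" for a b
    by (rule orthonormal_familyD[OF on that])
  have "span (?f v w ` ({..<k} \<times> UNIV)) = UNIV"
  proof (rule ccontr)
    assume "span (?f v w ` ({..<k} \<times> UNIV)) \<noteq> UNIV"
    then obtain X where X: "X \<notin> span (?f v w ` ({..<k} \<times> UNIV))" by blast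
    define V where "V = {X. \<forall>a\<in>{..<k} \<times> UNIV. g X (?f v w a) = 0}"
    define X' where "X' = X - (\<Sum>a\<in>{..<k} \<times> UNIV. g X (?f v w a) *\<^sub>R ?f v w a)"
    have "(\<Sum>a\<in>{..<k} \<times> UNIV. g X (?f v w a) *\<^sub>R ?f v w a) \<in> span (?f v w ` ({..<k} \<times> UNIV))"
      by (intro span_sum span_scale span_base imageI)
    then have X'0: "X' \<noteq> 0" using X unfolding X'_def by (auto simp del: split_paired_all)
    have X'V: "X' \<in> V"
      unfolding V_def
    proof (intro CollectI ballI)
      fix b assume b: "b \<in> {..<k} \<times> (UNIV :: bool set)"
      have "g X' (?f v w b) = g X (?f v w b) - (\<Sum>a\<in>{..<k} \<times> UNIV. g X (?f v w a) * g (?f v w a) (?f v w b))"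
        unfolding X'_def by (simp add: g_simps)
      also have "(\<Sum>a\<in>{..<k} \<times> UNIV. g X (?f v w a) * g (?f v w a) (?f v w b)) =
          (\<Sum>a\<in>{..<k} \<times> UNIV. if a = b then g X (?f v w a) else 0)"
        by (rule sum.cong[OF refl], subst onD[OF _ b]) auto
      also have "\<dots> = g X (?f v w b)" using b by (subst sum.delta) auto
      finally show "g X' (?f v w b) = 0" by simp
    qed
    have scaleV: "c *\<^sub>R Y \<in> V" if "Y \<in> V" for c Y using that by (simp add: V_def g_simps)
    have VD: "g Y (v i) = 0" "g Y (w i) = 0" if "Y \<in> V" "i < k" for Y i
    proof -
      have *: "g Y (?f v w a) = 0" if "a \<in> {..<k} \<times> UNIV" for a using \<open>Y \<in> V\<close> that unfolding V_def by blast
      show "g Y (v i) = 0" using *[of "(i, False)"] that(2) by simp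
      show "g Y (w i) = 0" using *[of "(i, True)"] that(2) by simp
    qed
    have VI: "Y \<in> V" if "\<And>i. i < k \<Longrightarrow> g Y (v i) = 0" "\<And>i. i < k \<Longrightarrow> g Y (w i) = 0" for Y
      using that by (auto simp: V_def)
    \<comment> \<open>\<open>V\<close> is the orthogonal complement of the blocks; it is invariant
      because \<open>A\<close> is skew and preserves the span of each block.\<close>
    have AV: "A Y \<in> V" if Y: "Y \<in> V" for Y
      by (rule VI) (simp_all add: A(2) anti[of Y] o sym[of _ Y] VD[OF Y])
    define K where "K = {Y \<in> V. g Y Y = 1}"
    have bb: "bounded_bilinear g" "bounded_bilinear \<omega>" using bil bo by (simp_all add: bilinear_conv_bounded_bilinear)
    have "closed K"
    proof -
      have "K = (\<Inter>a\<in>{..<k} \<times> UNIV. {Y. g Y (?f v w a) = 0}) \<inter> {Y. g Y Y = 1}"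
        unfolding K_def V_def by blast
      moreover have "closed {Y. g Y Z = 0}" "closed {Y. g Y Y = 1}" for Z
        by (intro closed_Collect_eq bounded_bilinear.continuous_on[OF bb(1)] continuous_intros)+
      ultimately show ?thesis by (simp add: closed_INT closed_Int)
    qed
    moreover have "bounded K"
    proof -
      obtain m where m: "m > 0" "\<And>X. m * (norm X)\<^sup>2 \<le> g X X" by (rule form_lower_bound) blast
      have "norm Y \<le> sqrt (1 / m)" if "Y \<in> K" for Y
        using m(2)[of Y] m(1) that by (intro real_le_rsqrt) (simp add: K_def field_simps)
      then show ?thesis by (auto simp: bounded_iff)
    qed
    ultimately have "compact (K \<times> K)" by (simp add: compact_Times compact_eq_bounded_closed[of K])
    define nrm where "nrm Y = Y /\<^sub>R sqrt (g Y Y)" for Y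
    have nrmK: "nrm Y \<in> K" if "Y \<in> V" "Y \<noteq> 0" for Y
      using scaleV[OF that(1)] pos[OF that(2)] by (auto simp: nrm_def K_def g_simps field_simps real_sqrt_mult[symmetric])
    have gnrm: "g Y (nrm Y) = sqrt (g Y Y)" if "Y \<noteq> 0" for Y
      using pos[OF that] by (simp add: nrm_def g_simps) (simp add: real_div_sqrt inverse_eq_divide)
    have "K \<times> K \<noteq> {}" using nrmK[OF X'V X'0] by auto
    have "continuous_on (K \<times> K) (\<lambda>z. \<omega> (fst z) (snd z))"
      by (intro bounded_bilinear.continuous_on[OF bb(2)] continuous_intros)
    from continuous_attains_sup[OF \<open>compact (K \<times> K)\<close> \<open>K \<times> K \<noteq> {}\<close> this]
    obtain p q where pq: "p \<in> K" "q \<in> K" and max_pq: "\<And>Y Z. Y \<in> K \<Longrightarrow> Z \<in> K \<Longrightarrow> \<omega> Y Z \<le> \<omega> p q"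
      by auto
    define l where "l = \<omega> p q"
    have pqV: "p \<in> V" "q \<in> V" and n1: "g p p = 1" "g q q = 1" using pq by (auto simp: K_def)
    have AX0: "A Y \<noteq> 0" if "Y \<noteq> 0" for Y
      using nondeg that by (auto simp: A(2)[symmetric] g_simps)
    \<comment> \<open>Nondegeneracy enters here: \<open>A X'\<close> is nonzero, and the normalized
      pair of \<open>X'\<close> and \<open>A X'\<close> is a competitor with positive value.\<close>
    have l0: "l > 0"
    proof -
      have "\<omega> (nrm X') (nrm (A X')) = g (A X') (nrm (A X')) / sqrt (g X' X')"
        unfolding nrm_def[of X'] by (simp add: o_simps A(2) divide_inverse mult.commute)
      also have "\<dots> = sqrt (g (A X') (A X')) / sqrt (g X' X')" by (simp add: gnrm[OF AX0[OF X'0]])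
      also have "\<dots> > 0" using pos[OF AX0[OF X'0]] pos[OF X'0] by simp
      finally show ?thesis
        using max_pq[OF nrmK[OF X'V X'0] nrmK[OF AV[OF X'V] AX0[OF X'0]]] unfolding l_def by linarith
    qed
    have p0: "p \<noteq> 0" "q \<noteq> 0" using n1 by (auto simp: g_simps)
    \<comment> \<open>The equality case of the Cauchy-Schwarz inequality.\<close>
    have eq: "Y = c *\<^sub>R Z" if "g Y Z = c" "g Z Z = 1" "sqrt (g Y Y) \<le> \<bar>c\<bar>" for Y Z c
    proof -
      have "g Y Y \<le> c\<^sup>2" using that(3) by (metis abs_ge_zero nonneg power2_abs real_sqrt_le_iff real_sqrt_pow2_iff real_sqrt_abs)
      moreover have "g (Y - c *\<^sub>R Z) (Y - c *\<^sub>R Z) = g Y Y - c\<^sup>2"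
        using that(1,2) sym[of Z Y] by (simp add: g_simps power2_eq_square algebra_simps)
      ultimately have "g (Y - c *\<^sub>R Z) (Y - c *\<^sub>R Z) = 0" using nonneg[of "Y - c *\<^sub>R Z"] by simp
      then show ?thesis by (simp add: eq_zero)
    qed
    \<comment> \<open>Maximality, tested against the normalized \<open>A p\<close>, bounds the
      length of \<open>A p\<close> by \<open>l\<close>, while its component along the unit vector
      \<open>q\<close> already equals \<open>l\<close>.\<close>
    have Ap: "A p = l *\<^sub>R q"
    proof (rule eq)
      show "g (A p) q = l" by (simp add: A(2) l_def)
      have "sqrt (g (A p) (A p)) = \<omega> p (nrm (A p))" using gnrm[OF AX0[OF p0(1)]] by (simp add: A(2))
      then show "sqrt (g (A p) (A p)) \<le> \<bar>l\<bar>"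
        using max_pq[OF pq(1) nrmK[OF AV[OF pqV(1)] AX0[OF p0(1)]]] l0 unfolding l_def by simp
    qed (rule n1)
    have Aq: "A q = (- l) *\<^sub>R p"
    proof (rule eq)
      show "g (A q) p = - l" using anti[of q p] by (simp add: A(2) l_def)
      have "nrm (- A q) \<in> K" using nrmK[of "- A q"] scaleV[OF AV[OF pqV(2)], of "-1"] AX0[OF p0(2)] by simp
      moreover have "\<omega> (nrm (- A q)) q = sqrt (g (A q) (A q))"
        using gnrm[OF AX0[OF p0(2)]] by (subst anti) (simp add: nrm_def o_simps A(2)[symmetric] g_simps)
      ultimately show "sqrt (g (A q) (A q)) \<le> \<bar>- l\<bar>"
        using max_pq[OF _ pq(2)] l0 unfolding l_def by fastforce
    qed (rule n1)
    have pq0: "g p q = 0" "g q p = 0"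
    proof -
      have "l * g q p = g (A p) p" by (simp add: Ap g_simps)
      also have "\<dots> = 0" by (simp add: A(2) alt)
      finally show "g q p = 0" "g p q = 0" using l0 sym[of p q] by auto
    qed
    let ?v = "v(k := p)" and ?w = "w(k := q)" and ?m = "\<mu>(k := l)"
    have "orthonormal_family ({..<Suc k} \<times> UNIV) (?f ?v ?w)"
      unfolding orthonormal_family_def
    proof (intro ballI)
      fix a b assume ab: "a \<in> {..<Suc k} \<times> (UNIV :: bool set)" "b \<in> {..<Suc k} \<times> (UNIV :: bool set)"
      obtain i x j y where ij: "a = (i, x)" "b = (j, y)" by (cases a, cases b)
      have "i < k \<or> i = k" "j < k \<or> j = k" using ab ij by auto
      moreover have "g (v i) p = 0" "g (w i) p = 0" "g (v i) q = 0" "g (w i) q = 0" if "i < k" for i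
        using VD[OF pqV(1) that] VD[OF pqV(2) that] sym by metis+
      ultimately show "g (?f ?v ?w a) (?f ?v ?w b) = (if a = b then 1 else 0)"
        using onD[of a b] VD[OF pqV(1)] VD[OF pqV(2)] n1 pq0 unfolding ij by (auto split: if_splits)
    qed
    moreover have "\<omega> (?v i) Y = ?m i * g (?w i) Y \<and> \<omega> (?w i) Y = - ?m i * g (?v i) Y" if "i < Suc k" for i Y
    proof (cases "i = k")
      case True
      then show ?thesis by (simp add: A(2)[symmetric] Ap Aq g_simps)
    next
      case False
      then show ?thesis using o[of i Y] that by simp
    qed
    moreover have "?m i > 0" if "i < Suc k" for i using mu[of i] l0 that by auto
    ultimately have "skew_frame \<omega> (Suc k) ?m ?v ?w" unfolding skew_frame_def by blast
    from max[OF this] show False by simp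
  qed
  with NF show ?thesis by blast
qed

end

section \<open>Relations that define the retraction on one vector space\<close>

definition kernel_sum :: "nat \<Rightarrow> 'v::real_vector set \<Rightarrow> (nat \<Rightarrow> 'v \<Rightarrow> 'v \<Rightarrow> real) \<Rightarrow> 'v set" where
  "kernel_sum s V \<omega> = span (\<Union>j\<in>{1..s}. {X\<in>V. \<forall>Y\<in>V. \<omega> j X Y = 0})"

text \<open>\<open>S\<close> is the nonnegative square root of \<open>- A\<^sup>2\<close>, where
  \<open>A\<close> represents the form by means of \<open>g\<close>. Operators are constrained on
  \<open>V\<close> only, since tangent spaces are proper subspaces of an ambient type; linearity of
  \<open>S\<close> follows from its symmetry.\<close>

definition polar_rel ::
  "'v::real_vector set \<Rightarrow> ('v \<Rightarrow> 'v \<Rightarrow> real) \<Rightarrow> ('v \<Rightarrow> 'v \<Rightarrow> real) \<Rightarrow> ('v \<Rightarrow> 'v) \<Rightarrow> bool" where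
  "polar_rel V \<omega> g S \<longleftrightarrow> S \<in> V \<rightarrow> V \<and> (\<exists>A\<in>V \<rightarrow> V.
     (\<forall>X\<in>V. \<forall>Y\<in>V. g (A X) Y = \<omega> X Y \<and> g (S X) Y = g X (S Y)) \<and>
     (\<forall>X\<in>V. g (S X) X \<ge> 0 \<and> S (S X) = - A (A X)))"

text \<open>\<open>Q\<close> is the \<open>g\<close>-orthogonal projection whose kernel is the
  kernel sum, and \<open>A j\<close> represents \<open>\<omega> j\<close> by means of
  \<open>g\<close>.\<close>

definition split_rel ::
  "'v::real_vector set \<Rightarrow> nat \<Rightarrow> (nat \<Rightarrow> 'v \<Rightarrow> 'v \<Rightarrow> real) \<Rightarrow> ('v \<Rightarrow> 'v \<Rightarrow> real) \<Rightarrow> ('v \<Rightarrow> 'v)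
    \<Rightarrow> (nat \<Rightarrow> 'v \<Rightarrow> 'v) \<Rightarrow> bool" where
  "split_rel V s \<omega> g Q A \<longleftrightarrow> Q \<in> V \<rightarrow> V \<and>
     (\<forall>j\<in>{1..s}. A j \<in> V \<rightarrow> V \<and> (\<forall>X\<in>V. \<forall>Y\<in>V. g (A j X) Y = \<omega> j X Y)) \<and>
     (\<forall>X\<in>V. X - Q X \<in> kernel_sum s V \<omega> \<and> (\<forall>Y\<in>kernel_sum s V \<omega>. g (Q X) Y = 0))"

text \<open>For \<open>Y\<close> in the range of \<open>Q\<close> let \<open>c Y\<close> be the element of the kernel of \<open>Q\<close> with
  \<open>\<omega>\<^sub>j (c Y, \<cdot>) = \<omega>\<^sub>j (Y, \<cdot>) / 2\<close> on the range of \<open>Q\<close> for all \<open>j\<close>. The vectors \<open>Y - c Y\<close> form the isotropic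
  complement, with respect to which \<open>X\<close> has the component \<open>X - Q X + c (Q X)\<close> in the kernel; the
  functionals that this component induces by the \<open>\<omega>\<^sub>j\<close> are represented by \<open>Q (A\<^sub>j (X - Q X / 2))\<close>.\<close>

definition split_form ::
  "nat \<Rightarrow> ('v::real_vector \<Rightarrow> 'v \<Rightarrow> real) \<Rightarrow> ('v \<Rightarrow> 'v) \<Rightarrow> (nat \<Rightarrow> 'v \<Rightarrow> 'v) \<Rightarrow> 'v \<Rightarrow> 'v \<Rightarrow> real" where
  "split_form s g Q A X Y = g (Q X) (Q Y) +
     (\<Sum>j = 1..s. g (Q (A j (X - (1/2) *\<^sub>R Q X))) (Q (A j (Y - (1/2) *\<^sub>R Q Y))))"

text \<open>The case s = 0 belongs to the second branch: the kernel sum is zero, \<open>Q\<close> is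
  the identity on \<open>V\<close> and \<open>split_form\<close> is \<open>g\<close>, as it should
  be, because then any orthonormal basis is a standard one. The values of \<open>h\<close> are
  determined on \<open>V\<close> only.\<close>

definition retract_rel ::
  "'v::real_vector set \<Rightarrow> nat \<Rightarrow> (nat \<Rightarrow> 'v \<Rightarrow> 'v \<Rightarrow> real) \<Rightarrow> ('v \<Rightarrow> 'v \<Rightarrow> real) \<Rightarrow> ('v \<Rightarrow> 'v \<Rightarrow> real) \<Rightarrow> bool" where
  "retract_rel V s \<omega> g h \<longleftrightarrow>
     (if s = 1 then \<exists>S. polar_rel V (\<omega> 1) g S \<and> (\<forall>X\<in>V. \<forall>Y\<in>V. h X Y = g (S X) Y)
      else \<exists>Q A. split_rel V s \<omega> g Q A \<and> (\<forall>X\<in>V. \<forall>Y\<in>V. h X Y = split_form s g Q A X Y))"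


subsection \<open>Polysymplectic frames\<close>

text \<open>The vector \<open>v\<^sub>i\<close> is \<open>f 0 i\<close>, the vector \<open>w\<^sup>j\<^sub>i\<close> is \<open>f j i\<close>, and \<open>\<xi> j i\<close> are the coordinates.\<close>

definition polysymplectic_frame ::
  "nat \<Rightarrow> nat \<Rightarrow> (nat \<Rightarrow> 'v::real_vector \<Rightarrow> 'v \<Rightarrow> real) \<Rightarrow> (nat \<Rightarrow> nat \<Rightarrow> 'v) \<Rightarrow> (nat \<Rightarrow> nat \<Rightarrow> 'v \<Rightarrow> real) \<Rightarrow> bool"
  where "polysymplectic_frame n s \<omega> f \<xi> \<longleftrightarrow>
    (\<forall>j\<in>{0..s}. \<forall>i\<in>{1..n}. linear (\<xi> j i)) \<and>
    (\<forall>j\<in>{0..s}. \<forall>i\<in>{1..n}. \<forall>l\<in>{0..s}. \<forall>k\<in>{1..n}. \<xi> j i (f l k) = (if j = l \<and> i = k then 1 else 0)) \<and>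
    (\<forall>X. X = (\<Sum>j = 0..s. \<Sum>i = 1..n. \<xi> j i X *\<^sub>R f j i)) \<and>
    (\<forall>j\<in>{1..s}. \<forall>X Y. \<omega> j X Y = (\<Sum>i = 1..n. \<xi> 0 i X * \<xi> j i Y - \<xi> 0 i Y * \<xi> j i X))"

definition frame_image :: "nat \<Rightarrow> nat \<Rightarrow> (nat \<Rightarrow> nat \<Rightarrow> 'v) \<Rightarrow> 'v set" where
  "frame_image n s f = (\<lambda>(j, i). f j i) ` ({0..s} \<times> {1..n})"

lemma basis_vectors_frame_image:
  assumes "\<And>i. f 0 i = v i" "\<And>j i. j \<ge> 1 \<Longrightarrow> f j i = w j i"
  shows "basis_vectors n s v w = frame_image n s f"
proof -
  have *: "{0..s} = insert 0 {1..s}" by auto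
  have "frame_image n s f = (\<lambda>i. f 0 i) ` {1..n} \<union> (\<lambda>(j, i). f j i) ` ({1..s} \<times> {1..n})"
    unfolding frame_image_def * by force
  also have "\<dots> = v ` {1..n} \<union> (\<lambda>(j, i). w j i) ` ({1..s} \<times> {1..n})"
    using assms by (intro arg_cong2[where f="(\<union>)"] image_cong) auto
  finally show ?thesis by (simp add: basis_vectors_def)
qed

lemma finite_frame_image [simp]: "finite (frame_image n s f)"
  by (simp add: frame_image_def)

lemma polysymplectic_frame_of_basis:
  assumes "standard_polysymplectic_basis UNIV n s \<omega> v w"
  obtains f \<xi> where "polysymplectic_frame n s \<omega> f \<xi>" "frame_image n s f = basis_vectors n s v w"
proof -
  define f where "f j i = (if j = 0 then v i else w j i)" for j i
  define B where "B = basis_vectors n s v w"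
  define \<xi> where "\<xi> j i X = representation B X (f j i)" for j i X
  have Bf: "B = frame_image n s f"
    unfolding B_def by (rule basis_vectors_frame_image) (auto simp: f_def)
  have B: "independent B" "span B = UNIV" "card B = n * (s + 1)"
    and om: "\<And>j X Y. j \<in> {1..s} \<Longrightarrow> \<omega> j X Y = (\<Sum>i = 1..n. wedge (\<lambda>X. representation B X (v i)) (\<lambda>X. representation B X (w j i)) X Y)"
    using assms unfolding standard_polysymplectic_basis_def B_def Let_def by auto
  \<comment> \<open>\<open>B\<close> has as many elements as there are index pairs, so the listing
    is free of repetitions.\<close>
  have inj: "inj_on (\<lambda>(j, i). f j i) ({0..s} \<times> {1..n})"
    by (rule eq_card_imp_inj_on) (use B(3) in \<open>auto simp: Bf frame_image_def\<close>)
  have fB: "f j i \<in> B" if "j \<in> {0..s}" "i \<in> {1..n}" for j i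
    unfolding Bf frame_image_def using that by force
  have "polysymplectic_frame n s \<omega> f \<xi>"
    unfolding polysymplectic_frame_def
  proof (intro conjI ballI allI)
    show "linear (\<xi> j i)" for j i
      unfolding \<xi>_def by (rule linearI) (simp_all add: B representation_add representation_scale)
    show "\<xi> j i (f l k) = (if j = l \<and> i = k then 1 else 0)"
      if "j \<in> {0..s}" "i \<in> {1..n}" "l \<in> {0..s}" "k \<in> {1..n}" for j i l k
      using inj_onD[OF inj, of "(l, k)" "(j, i)"] that
      by (auto simp: \<xi>_def representation_basis[OF B(1) fB])
    show "X = (\<Sum>j = 0..s. \<Sum>i = 1..n. \<xi> j i X *\<^sub>R f j i)" for X
    proof -
      have "X = (\<Sum>b\<in>B. representation B X b *\<^sub>R b)"
        using B by (simp add: sum_representation_eq Bf)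
      also have "\<dots> = (\<Sum>(j, i)\<in>{0..s} \<times> {1..n}. \<xi> j i X *\<^sub>R f j i)"
        unfolding Bf frame_image_def sum.reindex[OF inj] by (simp add: \<xi>_def Bf frame_image_def case_prod_unfold)
      finally show ?thesis by (simp add: sum.cartesian_product)
    qed
    show "\<omega> j X Y = (\<Sum>i = 1..n. \<xi> 0 i X * \<xi> j i Y - \<xi> 0 i Y * \<xi> j i X)" if "j \<in> {1..s}" for j X Y
      using that by (simp add: om wedge_def \<xi>_def f_def)
  qed
  then show ?thesis by (rule that) (simp add: Bf[symmetric] B_def)
qed

context
  fixes n s \<omega> and f :: "nat \<Rightarrow> nat \<Rightarrow> 'e::euclidean_space" and \<xi>
  assumes frame: "polysymplectic_frame n s \<omega> f \<xi>"
begin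

lemma frame_linear: "j \<le> s \<Longrightarrow> i \<in> {1..n} \<Longrightarrow> linear (\<xi> j i)"
  using frame unfolding polysymplectic_frame_def by auto

lemma frame_dual: "j \<le> s \<Longrightarrow> i \<in> {1..n} \<Longrightarrow> l \<le> s \<Longrightarrow> k \<in> {1..n} \<Longrightarrow>
    \<xi> j i (f l k) = (if j = l \<and> i = k then 1 else 0)"
  using frame unfolding polysymplectic_frame_def by auto

lemma frame_expansion: "X = (\<Sum>j = 0..s. \<Sum>i = 1..n. \<xi> j i X *\<^sub>R f j i)"
  using frame unfolding polysymplectic_frame_def by blast

lemma frame_form: "j \<in> {1..s} \<Longrightarrow>
    \<omega> j X Y = (\<Sum>i = 1..n. \<xi> 0 i X * \<xi> j i Y - \<xi> 0 i Y * \<xi> j i X)"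
  using frame unfolding polysymplectic_frame_def by blast

lemma frame_form_bilinear: "j \<in> {1..s} \<Longrightarrow> bilinear (\<omega> j)"
  unfolding bilinear_def
  by (auto intro!: linearI simp: frame_form linear_add[OF frame_linear] linear_scale[OF frame_linear]
      algebra_simps sum.distrib sum_distrib_left sum_subtractf)

lemma frame_form_skew: "j \<in> {1..s} \<Longrightarrow> \<omega> j X Y = - \<omega> j Y X"
  by (simp add: frame_form sum_negf[symmetric])

lemma frame_inj: "inj_on (\<lambda>(j, i). f j i) ({0..s} \<times> {1..n})"
proof (rule inj_onI, clarify)
  fix j i l k assume *: "j \<in> {0..s}" "i \<in> {1..n}" "l \<in> {0..s}" "k \<in> {1..n}" "f j i = f l k"
  have "\<xi> j i (f l k) = 1" using frame_dual[of j i j i] * by simp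
  then show "j = l \<and> i = k" using frame_dual[of j i l k] * by (auto split: if_splits)
qed

lemma frame_independent: "independent (frame_image n s f)"
proof (rule independent_if_scalars_zero)
  fix c x assume *: "(\<Sum>x\<in>frame_image n s f. c x *\<^sub>R x) = 0" "x \<in> frame_image n s f"
  then obtain j i where x: "x = f j i" "j \<in> {0..s}" "i \<in> {1..n}" by (auto simp: frame_image_def)
  have lin: "linear (\<xi> j i)" using frame_linear x by simp
  have "0 = \<xi> j i (\<Sum>x\<in>frame_image n s f. c x *\<^sub>R x)" using * lin by (simp add: linear_0)
  also have "\<dots> = (\<Sum>a\<in>{0..s} \<times> {1..n}. c (f (fst a) (snd a)) * \<xi> j i (f (fst a) (snd a)))"
    unfolding frame_image_def sum.reindex[OF frame_inj] using lin
    by (simp add: linear_sum linear_scale case_prod_unfold)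
  also have "\<dots> = (\<Sum>a\<in>{0..s} \<times> {1..n}. if a = (j, i) then c x else 0)"
    by (rule sum.cong) (use x frame_dual in \<open>auto split: if_splits\<close>)
  also have "\<dots> = c x" using x by simp
  finally show "c x = 0" by simp
qed simp

lemma frame_span: "span (frame_image n s f) = UNIV"
proof -
  have "f j i \<in> frame_image n s f" if "j \<in> {0..s}" "i \<in> {1..n}" for j i
    using that by (force simp: frame_image_def)
  then have "(\<Sum>j = 0..s. \<Sum>i = 1..n. \<xi> j i X *\<^sub>R f j i) \<in> span (frame_image n s f)" for X
    by (intro span_sum span_scale span_base)
  then show ?thesis using frame_expansion by (metis UNIV_eq_I)
qed

lemma standard_basis_of_frame: "standard_polysymplectic_basis UNIV n s \<omega> (f 0) f"
proof -
  let ?B = "frame_image n s f"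
  have B: "basis_vectors n s (f 0) f = ?B" by (rule basis_vectors_frame_image) auto
  have rep: "representation ?B X (f j i) = \<xi> j i X" if ji: "j \<in> {0..s}" "i \<in> {1..n}" for j i X
  proof -
    have lin: "linear (\<xi> j i)" using frame_linear ji by simp
    have "\<xi> j i X = \<xi> j i (\<Sum>b\<in>?B. representation ?B X b *\<^sub>R b)"
      using frame_independent frame_span by (subst sum_representation_eq) auto
    also have "\<dots> = (\<Sum>a\<in>{0..s} \<times> {1..n}. representation ?B X (f (fst a) (snd a)) * \<xi> j i (f (fst a) (snd a)))"
      using lin sum.reindex[OF frame_inj, of "\<lambda>b. representation ?B X b * \<xi> j i b"]
      by (simp add: linear_sum linear_scale case_prod_unfold frame_image_def)
    also have "\<dots> = (\<Sum>a\<in>{0..s} \<times> {1..n}. if a = (j, i) then representation ?B X (f j i) else 0)"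
      by (rule sum.cong) (use ji frame_dual in \<open>auto split: if_splits\<close>)
    also have "\<dots> = representation ?B X (f j i)" using ji by simp
    finally show ?thesis by simp
  qed
  have "card ?B = n * (s + 1)"
    unfolding frame_image_def card_image[OF frame_inj] by (simp add: card_cartesian_product)
  moreover have "\<omega> j X Y = (\<Sum>i = 1..n. wedge (\<lambda>X. representation ?B X (f 0 i)) (\<lambda>X. representation ?B X (f j i)) X Y)"
    if "j \<in> {1..s}" for j X Y
    unfolding frame_form[OF that] wedge_def using that by (intro sum.cong) (auto simp: rep)
  ultimately show ?thesis
    unfolding standard_polysymplectic_basis_def Let_def B using frame_independent frame_span by auto
qed

text \<open>Each \<open>\<omega> j\<close> alone forces all \<open>\<xi> 0 i\<close> to vanish on
  its kernel. Conversely \<open>f j i\<close> with j \<ge> 1 lies in the kernel of every other form,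
  and for s \<ge> 2 there is another form. For s = 0 both sides are zero; for s = 1 the left side is
  zero while the right side is spanned by the \<open>f 1 i\<close>.\<close>

lemma frame_kernel_sum:
  assumes "s \<noteq> 1"
  shows "kernel_sum s UNIV \<omega> = {X. \<forall>i\<in>{1..n}. \<xi> 0 i X = 0}"
proof (intro equalityI subsetI)
  have "subspace {X. \<forall>i\<in>{1..n}. \<xi> 0 i X = 0}"
    unfolding subspace_def by (auto simp: linear_0[OF frame_linear] linear_add[OF frame_linear] linear_scale[OF frame_linear])
  moreover have "(\<Union>j\<in>{1..s}. {X\<in>UNIV. \<forall>Y\<in>UNIV. \<omega> j X Y = 0}) \<subseteq> {X. \<forall>i\<in>{1..n}. \<xi> 0 i X = 0}"
  proof clarsimp
    fix j X i assume *: "Suc 0 \<le> j" "j \<le> s" "\<forall>Y. \<omega> j X Y = 0" "Suc 0 \<le> i" "i \<le> n"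
    have "\<omega> j X (f j i) = (\<Sum>k = 1..n. if k = i then \<xi> 0 i X else 0)"
      unfolding frame_form[of j, simplified, OF conjI[OF *(1,2)]] using * by (intro sum.cong) (auto simp: frame_dual)
    then show "\<xi> 0 i X = 0" using * by simp
  qed
  ultimately show "X \<in> {X. \<forall>i\<in>{1..n}. \<xi> 0 i X = 0}" if "X \<in> kernel_sum s UNIV \<omega>" for X
    using that span_minimal unfolding kernel_sum_def by blast
next
  fix X assume X: "X \<in> {X. \<forall>i\<in>{1..n}. \<xi> 0 i X = 0}"
  have "\<xi> j i X *\<^sub>R f j i \<in> kernel_sum s UNIV \<omega>" if ji: "j \<in> {0..s}" "i \<in> {1..n}" for j i
  proof (cases "j = 0")
    case True
    then show ?thesis using X ji by (simp add: kernel_sum_def span_zero)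
  next
    case False
    then have "s \<ge> 2" using ji assms by auto
    \<comment> \<open>Some index in the range that differs from \<open>j\<close>.\<close>
    define l :: nat where "l = (if j = 1 then 2 else 1)"
    have l: "l \<in> {1..s}" "l \<noteq> j" using \<open>s \<ge> 2\<close> by (auto simp: l_def)
    have "\<omega> l (f j i) Y = 0" for Y
      unfolding frame_form[OF l(1)] using ji l False by (intro sum.neutral) (auto simp: frame_dual)
    then show ?thesis unfolding kernel_sum_def by (intro span_scale span_base UN_I[OF l(1)]) simp
  qed
  then have "(\<Sum>j = 0..s. \<Sum>i = 1..n. \<xi> j i X *\<^sub>R f j i) \<in> kernel_sum s UNIV \<omega>"
    unfolding kernel_sum_def by (intro span_sum)
  then show "X \<in> kernel_sum s UNIV \<omega>"
    by (subst frame_expansion)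
qed

end

text \<open>The test applied to the frames constructed in both cases. The size of the family makes
  it a basis, so that only pairs of basis vectors have to be examined, and definiteness of
  \<open>g\<close> comes out as a result.\<close>

lemma (in symmetric_form) orthonormal_frame:
  assumes "DIM('e) = n * (s + 1)"
    and on: "\<And>j i l k. j \<le> s \<Longrightarrow> i \<in> {1..n} \<Longrightarrow> l \<le> s \<Longrightarrow> k \<in> {1..n} \<Longrightarrow>
      g (f j i) (f l k) = (if j = l \<and> i = k then 1 else 0)"
    and bo: "\<And>j. j \<in> {1..s} \<Longrightarrow> bilinear (\<omega> j)"
    and skew: "\<And>j X Y. j \<in> {1..s} \<Longrightarrow> \<omega> j X Y = - \<omega> j Y X"
    and vv: "\<And>j i k. j \<in> {1..s} \<Longrightarrow> i \<in> {1..n} \<Longrightarrow> k \<in> {1..n} \<Longrightarrow> \<omega> j (f 0 i) (f 0 k) = 0"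
    and vw: "\<And>j i l k. j \<in> {1..s} \<Longrightarrow> i \<in> {1..n} \<Longrightarrow> l \<in> {1..s} \<Longrightarrow> k \<in> {1..n} \<Longrightarrow>
      \<omega> j (f 0 i) (f l k) = (if j = l \<and> i = k then 1 else 0)"
    and ww: "\<And>j i l m k. j \<in> {1..s} \<Longrightarrow> i \<in> {1..n} \<Longrightarrow> l \<in> {1..s} \<Longrightarrow> m \<in> {1..s} \<Longrightarrow> k \<in> {1..n} \<Longrightarrow>
      \<omega> j (f l i) (f m k) = 0"
  shows "polysymplectic_frame n s \<omega> f (\<lambda>j i X. g X (f j i))" "inner_product_form g"
    "orthonormal_for g (basis_vectors n s (f 0) f)"
proof -
  let ?I = "{0..s} \<times> {1..n}" and ?f = "\<lambda>(j, i). f j i"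
  have fam: "orthonormal_family ?I ?f" unfolding orthonormal_family_def using on by auto
  have span: "span (?f ` ?I) = UNIV"
    by (rule orthonormal_family_spans) (use fam assms(1) in \<open>auto simp: card_cartesian_product\<close>)
  have exp: "X = (\<Sum>j = 0..s. \<Sum>i = 1..n. g X (f j i) *\<^sub>R f j i)" for X
    using orthonormal_family_expansion[OF _ fam, of X] span by (simp add: sum.cartesian_product case_prod_unfold)
  show "inner_product_form g"
    by standard (rule orthonormal_family_pos[OF _ fam span], auto)
  show "orthonormal_for g (basis_vectors n s (f 0) f)"
  proof -
    have "basis_vectors n s (f 0) f = ?f ` ?I"
      using basis_vectors_frame_image[of f "f 0" f n s] by (simp add: frame_image_def)
    moreover have "g (?f a) (?f b) = (if ?f a = ?f b then 1 else 0)" if "a \<in> ?I" "b \<in> ?I" for a b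
      using orthonormal_familyD[OF fam that] inj_on_eq_iff[OF orthonormal_family_inj[OF fam] that] by simp
    ultimately show ?thesis unfolding orthonormal_for_def by (simp only: ball_simps) simp
  qed
  have "\<omega> j X Y = (\<Sum>i = 1..n. g X (f 0 i) * g Y (f j i) - g Y (f 0 i) * g X (f j i))" if j: "j \<in> {1..s}" for j X Y
  proof -
    note b = bo[OF j]
    have ex: "X = (\<Sum>a\<in>?I. g X (?f a) *\<^sub>R ?f a)" for X
      using orthonormal_family_expansion[OF _ fam, of X] span by simp
    have oY: "\<omega> j (f 0 i) Y = g Y (f j i)" if i: "i \<in> {1..n}" for i Y
    proof -
      have "\<omega> j (f 0 i) Y = \<omega> j (f 0 i) (\<Sum>a\<in>?I. g Y (?f a) *\<^sub>R ?f a)" using ex by simp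
      also have "\<dots> = (\<Sum>a\<in>?I. g Y (?f a) * \<omega> j (f 0 i) (?f a))"
        by (simp add: bilinear_sum_right[OF b] bilinear_rmul[OF b])
      also have "\<dots> = (\<Sum>a\<in>?I. if a = (j, i) then g Y (f j i) else 0)"
      proof (rule sum.cong[OF refl])
        fix a assume "a \<in> ?I"
        then obtain l k where a: "a = (l, k)" "l \<le> s" "k \<in> {1..n}" by (cases a) auto
        show "g Y (?f a) * \<omega> j (f 0 i) (?f a) = (if a = (j, i) then g Y (f j i) else 0)"
          using vv[OF j i a(3)] vw[OF j i _ a(3), of l] a j by (cases "l = 0") auto
      qed
      also have "\<dots> = g Y (f j i)" using i j by simp
      finally show ?thesis .
    qed
    have oW: "\<omega> j (f l i) Y = (if l = j then - g Y (f 0 i) else 0)" if i: "i \<in> {1..n}" and l: "l \<in> {1..s}" for i l Y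
    proof -
      have "\<omega> j (f l i) Y = \<omega> j (f l i) (\<Sum>a\<in>?I. g Y (?f a) *\<^sub>R ?f a)" using ex by simp
      also have "\<dots> = (\<Sum>a\<in>?I. g Y (?f a) * \<omega> j (f l i) (?f a))"
        by (simp add: bilinear_sum_right[OF b] bilinear_rmul[OF b])
      also have "\<dots> = (\<Sum>a\<in>?I. if a = (0, i) then (if l = j then - g Y (f 0 i) else 0) else 0)"
      proof (rule sum.cong[OF refl])
        fix a assume "a \<in> ?I"
        then obtain m k where a: "a = (m, k)" "m \<le> s" "k \<in> {1..n}" by (cases a) auto
        show "g Y (?f a) * \<omega> j (f l i) (?f a) = (if a = (0, i) then (if l = j then - g Y (f 0 i) else 0) else 0)"
          using ww[OF j i l _ a(3), of m] vw[OF j a(3) l i] skew[OF j, of "f l i" "f 0 k"] a by (cases "m = 0") auto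
      qed
      also have "\<dots> = (if l = j then - g Y (f 0 i) else 0)" using i by simp
      finally show ?thesis .
    qed
    have split: "{0..s} = insert 0 {1..s}" by auto
    have "\<omega> j X Y = \<omega> j (\<Sum>l = 0..s. \<Sum>i = 1..n. g X (f l i) *\<^sub>R f l i) Y" using exp by simp
    also have "\<dots> = (\<Sum>l = 0..s. \<Sum>i = 1..n. g X (f l i) * \<omega> j (f l i) Y)"
      by (simp add: bilinear_sum_left[OF b] bilinear_lmul[OF b])
    also have "\<dots> = (\<Sum>i = 1..n. g X (f 0 i) * g Y (f j i)) + (\<Sum>l\<in>{1..s}. \<Sum>i = 1..n. g X (f l i) * (if l = j then - g Y (f 0 i) else 0))"
      unfolding split by (simp add: oY oW)
    also have "(\<Sum>l\<in>{1..s}. \<Sum>i = 1..n. g X (f l i) * (if l = j then - g Y (f 0 i) else 0)) =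
       (\<Sum>l\<in>{1..s}. if l = j then \<Sum>i = 1..n. - g X (f j i) * g Y (f 0 i) else 0)"
      by (intro sum.cong) auto
    also have "\<dots> = (\<Sum>i = 1..n. - g X (f j i) * g Y (f 0 i))" using j by simp
    finally show ?thesis by (simp add: sum_subtractf sum_negf algebra_simps)
  qed
  then show "polysymplectic_frame n s \<omega> f (\<lambda>j i X. g X (f j i))"
    unfolding polysymplectic_frame_def using on exp
    by (auto intro!: linearI simp: g_simps)
qed

subsection \<open>The retraction in a single vector space\<close>

context inner_product_form
begin

text \<open>Two candidates differ by an element of the kernel sum that is also orthogonal to
  it.\<close>

lemma split_projection_unique:
  assumes "split_rel UNIV s \<omega> g Q A" "X - Z \<in> kernel_sum s UNIV \<omega>" "\<And>Y. Y \<in> kernel_sum s UNIV \<omega> \<Longrightarrow> g Z Y = 0"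
  shows "Q X = Z"
proof -
  have Q: "X - Q X \<in> kernel_sum s UNIV \<omega>" "\<And>Y. Y \<in> kernel_sum s UNIV \<omega> \<Longrightarrow> g (Q X) Y = 0"
    using assms(1) unfolding split_rel_def by auto
  have "(X - Z) - (X - Q X) \<in> kernel_sum s UNIV \<omega>"
    using assms(2) Q(1) unfolding kernel_sum_def by (rule span_diff)
  then have d: "Q X - Z \<in> kernel_sum s UNIV \<omega>" by simp
  have "g (Q X - Z) (Q X - Z) = 0"
    using Q(2)[OF d] assms(3)[OF d] bilinear_lsub[OF bil, of "Q X" Z "Q X - Z"] by linarith
  then show ?thesis by (simp add: eq_zero)
qed

lemma split_form_unique:
  assumes "split_rel UNIV s \<omega> g Q A" "split_rel UNIV s \<omega> g Q' A'"
  shows "split_form s g Q A = split_form s g Q' A'"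
proof -
  have Q: "Q = Q'"
  proof
    show "Q X = Q' X" for X
      by (rule split_projection_unique[OF assms(1)]) (use assms(2) in \<open>auto simp: split_rel_def\<close>)
  qed
  have "A j X = A' j X" if "j \<in> {1..s}" for j X
    by (rule eqI) (use assms that in \<open>simp add: split_rel_def\<close>)
  then show ?thesis unfolding Q split_form_def by (intro ext arg_cong2[where f="(+)"] sum.cong) auto
qed

lemma split_rel_exists:
  assumes "\<And>j. j \<in> {1..s} \<Longrightarrow> bilinear (\<omega> j)"
  obtains Q A where "split_rel UNIV s \<omega> g Q A"
proof -
  let ?L = "kernel_sum s UNIV \<omega>"
  have L: "subspace ?L" by (simp add: kernel_sum_def)
  have "orthonormal_family {} (\<lambda>x. x)" by (simp add: orthonormal_family_def)
  then obtain B where B: "finite B" "orthonormal_family B (\<lambda>x. x)" "span B = ?L"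
    by (rule orthonormal_extension[OF L finite.emptyI empty_subsetI])
  have "\<exists>A. \<forall>X Y. g (A X) Y = \<omega> j X Y" if "j \<in> {1..s}" for j
    by (rule form_representation[OF assms[OF that]]) blast
  then obtain A where A: "\<And>j X Y. j \<in> {1..s} \<Longrightarrow> g (A j X) Y = \<omega> j X Y" by metis
  define Q where "Q X = X - (\<Sum>b\<in>B. g X b *\<^sub>R b)" for X
  have "X - Q X \<in> ?L" for X
    unfolding B(3)[symmetric] Q_def by (simp add: span_sum span_scale span_base)
  moreover have "g (Q X) Y = 0" if "Y \<in> ?L" for X Y
  proof -
    have "Y = (\<Sum>b\<in>B. g Y b *\<^sub>R b)"
      using orthonormal_family_expansion[OF B(1,2), of Y] that B(3) by simp
    then have "g (Q X) Y = g (Q X) (\<Sum>b\<in>B. g Y b *\<^sub>R b)" by (rule arg_cong)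
    also have "\<dots> = (\<Sum>b\<in>B. g Y b * g (Q X) b)" by (simp add: g_simps)
    also have "g (Q X) b = 0" if "b \<in> B" for b
    proof -
      have "g (Q X) b = g X b - (\<Sum>a\<in>B. g X a * g a b)" by (simp add: Q_def g_simps)
      also have "(\<Sum>a\<in>B. g X a * g a b) = (\<Sum>a\<in>B. if a = b then g X b else 0)"
        using orthonormal_familyD[OF B(2)] that by (intro sum.cong) auto
      finally show ?thesis using that B(1) by simp
    qed
    then have "(\<Sum>b\<in>B. g Y b * g (Q X) b) = 0" by simp
    finally show ?thesis .
  qed
  ultimately have "split_rel UNIV s \<omega> g Q A" unfolding split_rel_def using A by auto
  then show ?thesis by (rule that)
qed

text \<open>Linearity is not recorded in \<open>split_rel\<close>: for \<open>Q\<close> it follows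
  from uniqueness of the projection, for \<open>A j\<close> from definiteness of
  \<open>g\<close>.\<close>

lemma split_form_symmetric:
  assumes rel: "split_rel UNIV s \<omega> g Q A" and bo: "\<And>j. j \<in> {1..s} \<Longrightarrow> bilinear (\<omega> j)"
  shows "symmetric_form (split_form s g Q A)"
proof
  have Q: "\<And>X. X - Q X \<in> kernel_sum s UNIV \<omega>" "\<And>X Y. Y \<in> kernel_sum s UNIV \<omega> \<Longrightarrow> g (Q X) Y = 0"
    using rel unfolding split_rel_def by auto
  have linQ: "linear Q"
  proof (rule linearI; rule split_projection_unique[OF rel])
    fix X Y and c :: real
    have "X + Y - (Q X + Q Y) = (X - Q X) + (Y - Q Y)" "c *\<^sub>R X - c *\<^sub>R Q X = c *\<^sub>R (X - Q X)"
      by (simp_all add: algebra_simps)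
    then show "X + Y - (Q X + Q Y) \<in> kernel_sum s UNIV \<omega>" "c *\<^sub>R X - c *\<^sub>R Q X \<in> kernel_sum s UNIV \<omega>"
      using Q(1) by (simp_all only: kernel_sum_def span_add span_scale)
  qed (simp_all add: g_simps Q(2))
  have linA: "linear (A j)" if j: "j \<in> {1..s}" for j
    by (rule linearI; rule eqI)
      (use rel j in \<open>simp_all add: split_rel_def g_simps bilinear_ladd[OF bo[OF j]] bilinear_lmul[OF bo[OF j]]\<close>)
  define C where "C j X = Q (A j (X - (1/2) *\<^sub>R Q X))" for j X
  have linC: "linear (C j)" if "j \<in> {1..s}" for j
    using linear_compose[OF linear_compose[OF linear_compose_sub[OF linear_id linear_compose_scale_right[OF linQ, of "1/2"]] linA[OF that]] linQ]
    unfolding C_def by (simp add: o_def)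
  have bilC: "bilinear (\<lambda>X Y. g (C j X) (C j Y))" if "j \<in> {1..s}" for j
    unfolding bilinear_def
    by (intro allI conjI linearI) (simp_all add: linear_add[OF linC[OF that]] linear_scale[OF linC[OF that]] g_simps)
  have bilQ: "bilinear (\<lambda>X Y. g (Q X) (Q Y))"
    unfolding bilinear_def
    by (intro allI conjI linearI) (simp_all add: linear_add[OF linQ] linear_scale[OF linQ] g_simps)
  show "bilinear (split_form s g Q A)"
    using bilQ bilC unfolding bilinear_def split_form_def C_def[symmetric]
    by (intro allI conjI linear_compose_add linear_compose_sum) auto
  show "split_form s g Q A X Y = split_form s g Q A Y X" for X Y
    unfolding split_form_def using sym by simp
qed

text \<open>An orthonormal basis \<open>e\<close> of the orthogonal complement of \<open>?L\<close>
  determines everything else: \<open>w j i\<close> are the vectors of \<open>?L\<close> dual to it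
  under the forms, and \<open>f' 0 i\<close> is the lift of \<open>e i\<close> to the isotropic
  complement. The first summand of \<open>split_form\<close> makes the lifts orthonormal, the
  summand with index \<open>j\<close> the \<open>w j i\<close>.\<close>

lemma split_form_frame:
  assumes frame: "polysymplectic_frame n s \<omega> f \<xi>" and dim: "DIM('e) = n * (s + 1)" and s: "s \<noteq> 1"
    and rel: "split_rel UNIV s \<omega> g Q A"
  obtains f' where "polysymplectic_frame n s \<omega> f' (\<lambda>j i X. split_form s g Q A X (f' j i))"
    "inner_product_form (split_form s g Q A)"
    "orthonormal_for (split_form s g Q A) (basis_vectors n s (f' 0) f')"
proof -
  let ?L = "kernel_sum s UNIV \<omega>"
  note bo = frame_form_bilinear[OF frame] and skew = frame_form_skew[OF frame]
  note xi_lin = frame_linear[OF frame] and dual = frame_dual[OF frame]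
  have L: "?L = {X. \<forall>i\<in>{1..n}. \<xi> 0 i X = 0}" by (rule frame_kernel_sum[OF frame s])
  have subL: "subspace ?L" by (simp add: kernel_sum_def)
  have Q: "\<And>X. X - Q X \<in> ?L" "\<And>X Y. Y \<in> ?L \<Longrightarrow> g (Q X) Y = 0"
    and A: "\<And>j X Y. j \<in> {1..s} \<Longrightarrow> g (A j X) Y = \<omega> j X Y"
    using rel unfolding split_rel_def by auto
  let ?W = "(\<lambda>(j, i). f j i) ` ({1..s} \<times> {1..n})"
  have fL: "f j i \<in> ?L" if "j \<in> {1..s}" "i \<in> {1..n}" for j i
    unfolding L using that by (auto simp: dual)
  have dimL: "dim ?L = n * s"
  proof -
    have "?L \<subseteq> span ?W"
    proof
      fix X assume X: "X \<in> ?L"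
      have "X = (\<Sum>j = 0..s. \<Sum>i = 1..n. \<xi> j i X *\<^sub>R f j i)" by (rule frame_expansion[OF frame])
      moreover have "\<xi> j i X *\<^sub>R f j i \<in> span ?W" if "j \<in> {0..s}" "i \<in> {1..n}" for j i
      proof (cases "j = 0")
        case True
        then show ?thesis using X that by (simp add: L span_zero)
      next
        case False
        then have "f j i \<in> ?W" using that by force
        then show ?thesis by (intro span_scale span_base)
      qed
      then have "(\<Sum>j = 0..s. \<Sum>i = 1..n. \<xi> j i X *\<^sub>R f j i) \<in> span ?W" by (intro span_sum)
      ultimately show "X \<in> span ?W" by simp
    qed
    moreover have "?W \<subseteq> ?L" using fL by auto
    moreover have "independent ?W"
      by (rule independent_mono[OF frame_independent[OF frame]]) (auto simp: frame_image_def)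
    ultimately have "dim ?L = card ?W" by (intro dim_unique[of ?W]) auto
    also have "\<dots> = card ({1..s} \<times> {1..n})"
      by (rule card_image, rule inj_on_subset[OF frame_inj[OF frame]]) auto
    finally show ?thesis by (simp add: card_cartesian_product)
  qed
  \<comment> \<open>An orthonormal basis of \<open>?L\<close> is extended to the whole space. By the
    dimension count the added vectors are \<open>n\<close> in number; they are the
    \<open>e i\<close>.\<close>
  have "orthonormal_family {} (\<lambda>x. x)" by (simp add: orthonormal_family_def)
  then obtain BL where BL: "finite BL" "orthonormal_family BL (\<lambda>x. x)" "span BL = ?L"
    by (rule orthonormal_extension[OF subL finite.emptyI empty_subsetI])
  obtain B where B: "finite B" "BL \<subseteq> B" "orthonormal_family B (\<lambda>x. x)" "span B = UNIV"
    by (rule orthonormal_extension[OF subspace_UNIV BL(1) subset_UNIV BL(2)])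
  have "card BL = n * s"
    using dimL dim_eq_card[of BL ?L] orthonormal_family_independent[OF BL(1,2)] BL(3)
      span_eq_iff[THEN iffD2, OF subL] by simp
  moreover have "card B = n * (s + 1)" using orthonormal_family_card[OF B(1,3)] B(4) dim by simp
  ultimately have "card (B - BL) = n" using B(2) BL(1) by (simp add: card_Diff_subset)
  then obtain e where e: "bij_betw e {1..n} (B - BL)"
    using ex_bij_betw_nat_finite_1[of "B - BL"] B(1) by auto
  have eB: "e i \<in> B" "e i \<notin> BL" if "i \<in> {1..n}" for i using bij_betwE[OF e] that by auto
  have einj: "e i = e k \<longleftrightarrow> i = k" if "i \<in> {1..n}" "k \<in> {1..n}" for i k
    using e that unfolding bij_betw_def by (auto simp: inj_on_eq_iff)
  have ee: "g (e i) (e k) = (if i = k then 1 else 0)" if "i \<in> {1..n}" "k \<in> {1..n}" for i k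
    using orthonormal_familyD[OF B(3)] eB that einj by simp
  have eL: "g (e i) Y = 0" if i: "i \<in> {1..n}" and Y: "Y \<in> ?L" for i Y
  proof -
    have "Y = (\<Sum>b\<in>BL. g Y b *\<^sub>R b)" using orthonormal_family_expansion[OF BL(1,2), of Y] Y BL(3) by simp
    then have "g (e i) Y = g (e i) (\<Sum>b\<in>BL. g Y b *\<^sub>R b)" by (rule arg_cong)
    also have "\<dots> = (\<Sum>b\<in>BL. g Y b * g (e i) b)" by (simp add: g_simps)
    also have "\<dots> = 0"
    proof (rule sum.neutral, rule ballI)
      fix b assume "b \<in> BL"
      then have "b \<in> B" "e i \<noteq> b" using eB[OF i] B(2) by auto
      then show "g Y b * g (e i) b = 0" using orthonormal_familyD[OF B(3) eB(1)[OF i]] by simp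
    qed
    finally show ?thesis .
  qed
  have eL': "g Y (e i) = 0" if "i \<in> {1..n}" "Y \<in> ?L" for i Y using eL[OF that] sym by simp
  have Qe: "Q X = e i" if "i \<in> {1..n}" "X - e i \<in> ?L" for X i
    by (rule split_projection_unique[OF rel that(2) eL[OF that(1)]])
  have Q0: "Q X = 0" if "X \<in> ?L" for X
    by (rule split_projection_unique[OF rel]) (use that in \<open>simp_all add: g_simps\<close>)
  have Qge: "g (Q X) (e i) = g X (e i)" if "i \<in> {1..n}" for X i
    using eL'[OF that Q(1)[of X]] by (simp add: g_simps)
  have Qexp: "Q X = (\<Sum>i = 1..n. g X (e i) *\<^sub>R e i)" for X
  proof -
    have "Q X = (\<Sum>b\<in>B. g (Q X) b *\<^sub>R b)" using orthonormal_family_expansion[OF B(1,3), of "Q X"] B(4) by simp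
    also have "\<dots> = (\<Sum>b\<in>B - BL. g (Q X) b *\<^sub>R b)"
    proof (rule sum.mono_neutral_right[OF B(1)])
      have "BL \<subseteq> ?L" using BL(3) span_superset by auto
      then show "\<forall>b\<in>B - (B - BL). g (Q X) b *\<^sub>R b = 0" using Q(2) by auto
    qed auto
    also have "\<dots> = (\<Sum>i = 1..n. g (Q X) (e i) *\<^sub>R e i)"
      by (rule sum.reindex_bij_betw[OF e, symmetric])
    finally show ?thesis by (simp add: Qge)
  qed
  have om_f: "\<omega> j X (f l k) = (if j = l then \<xi> 0 k X else 0)" if "j \<in> {1..s}" "l \<in> {1..s}" "k \<in> {1..n}" for j l k X
  proof -
    have "\<omega> j X (f l k) = (\<Sum>i = 1..n. if i = k then (if j = l then \<xi> 0 k X else 0) else 0)"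
      unfolding frame_form[OF frame that(1)] using that by (intro sum.cong) (auto simp: dual)
    then show ?thesis using that by simp
  qed
  have om_L: "\<omega> j X Y = 0" if "j \<in> {1..s}" "X \<in> ?L" "Y \<in> ?L" for j X Y
    unfolding frame_form[OF frame that(1)] using that(2,3) by (simp add: L)
  \<comment> \<open>The coefficients express the functional \<open>g (e i)\<close> in the basis
    \<open>\<xi> 0 k\<close> of functionals that vanish on \<open>?L\<close>, and
    \<open>\<omega> j\<close> identifies \<open>\<xi> 0 k\<close> with \<open>f j k\<close>.\<close>
  define w where "w j i = (\<Sum>k = 1..n. g (f 0 k) (e i) *\<^sub>R f j k)" for j i
  have wL: "w j i \<in> ?L" if "j \<in> {1..s}" "i \<in> {1..n}" for j i
    unfolding w_def using fL[OF that(1)] by (intro subspace_sum[OF subL] subspace_scale[OF subL])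
  have om_ew: "\<omega> j (e i) (w l k) = (if j = l \<and> i = k then 1 else 0)"
    if j: "j \<in> {1..s}" and l: "l \<in> {1..s}" and i: "i \<in> {1..n}" and k: "k \<in> {1..n}" for j l i k
  proof -
    have "\<omega> j (e i) (w l k) = (if j = l then \<Sum>q = 1..n. g (f 0 q) (e k) * \<xi> 0 q (e i) else 0)"
      unfolding w_def using j l by (simp add: bilinear_sum_right[OF bo] bilinear_rmul[OF bo] om_f)
    moreover have "(\<Sum>q = 1..n. g (f 0 q) (e k) * \<xi> 0 q (e i)) = (if i = k then 1 else 0)"
    proof -
      \<comment> \<open>Modulo \<open>?L\<close> the vector \<open>e i\<close> is a combination of
        the \<open>f 0 q\<close>, and \<open>g (e k)\<close> does not see \<open>?L\<close>.\<close>
      have "e i - (\<Sum>q = 1..n. \<xi> 0 q (e i) *\<^sub>R f 0 q) \<in> ?L"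
        unfolding L
      proof (intro CollectI ballI)
        fix m assume m: "m \<in> {1..n}"
        have lin: "linear (\<xi> 0 m)" using xi_lin m by simp
        have "\<xi> 0 m (\<Sum>q = 1..n. \<xi> 0 q (e i) *\<^sub>R f 0 q) = (\<Sum>q = 1..n. if q = m then \<xi> 0 m (e i) else 0)"
          unfolding linear_sum[OF lin] by (rule sum.cong) (use m dual in \<open>auto simp: linear_scale[OF lin]\<close>)
        then show "\<xi> 0 m (e i - (\<Sum>q = 1..n. \<xi> 0 q (e i) *\<^sub>R f 0 q)) = 0"
          using m by (simp add: linear_diff[OF lin])
      qed
      from eL'[OF k this] have "g (e i) (e k) = (\<Sum>q = 1..n. \<xi> 0 q (e i) * g (f 0 q) (e k))"
        by (simp add: g_simps)
      then show ?thesis using ee[OF i k] by (simp add: mult.commute)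
    qed
    ultimately show ?thesis by (cases "j = l"; cases "i = k") simp_all
  qed
  \<comment> \<open>The corrections must cancel \<open>\<omega> l (e i) (e k)\<close>. Both
    arguments of the form are corrected and each contributes one half; the two corrections do not
    interact because the forms vanish on \<open>?L\<close>.\<close>
  define f' where "f' j i = (if j = 0 then e i + (1/2) *\<^sub>R (\<Sum>l = 1..s. \<Sum>k = 1..n. \<omega> l (e i) (e k) *\<^sub>R w l k) else w j i)" for j i
  have cL: "(1/2) *\<^sub>R (\<Sum>l = 1..s. \<Sum>k = 1..n. \<omega> l (e i) (e k) *\<^sub>R w l k) \<in> ?L" for i
    using wL by (intro subspace_scale[OF subL] subspace_sum[OF subL])
  have f0: "f' 0 i - e i \<in> ?L" for i using cL[of i] by (simp add: f'_def)
  have fl: "f' l i = w l i" if "l \<in> {1..s}" for l i using that by (simp add: f'_def)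
  have om_f0e: "\<omega> j (f' 0 i - (1/2) *\<^sub>R e i) (e k) = 0" and om_f0c: "\<omega> j (f' 0 i - e i) (e k) = - (1/2) * \<omega> j (e i) (e k)"
    if j: "j \<in> {1..s}" and i: "i \<in> {1..n}" and k: "k \<in> {1..n}" for j i k
  proof -
    note b = bo[OF j]
    have "\<omega> j (\<Sum>l = 1..s. \<Sum>q = 1..n. \<omega> l (e i) (e q) *\<^sub>R w l q) (e k) =
        (\<Sum>l = 1..s. \<Sum>q = 1..n. \<omega> l (e i) (e q) * \<omega> j (w l q) (e k))"
      by (simp add: bilinear_sum_left[OF b] bilinear_lmul[OF b])
    also have "\<dots> = (\<Sum>l = 1..s. \<Sum>q = 1..n. if l = j \<and> q = k then - \<omega> j (e i) (e k) else 0)"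
      using om_ew[OF j _ k] skew[OF j, of "w _ _" "e k"] by (intro sum.cong) auto
    also have "\<dots> = (\<Sum>l = 1..s. if l = j then \<Sum>q = 1..n. if q = k then - \<omega> j (e i) (e k) else 0 else 0)"
      by (intro sum.cong) auto
    also have "\<dots> = - \<omega> j (e i) (e k)" using j k by simp
    finally have *: "\<omega> j (\<Sum>l = 1..s. \<Sum>q = 1..n. \<omega> l (e i) (e q) *\<^sub>R w l q) (e k) = - \<omega> j (e i) (e k)" .
    show "\<omega> j (f' 0 i - e i) (e k) = - (1/2) * \<omega> j (e i) (e k)"
    proof -
      have "f' 0 i - e i = (1/2) *\<^sub>R (\<Sum>l = 1..s. \<Sum>q = 1..n. \<omega> l (e i) (e q) *\<^sub>R w l q)" by (simp add: f'_def)
      then show ?thesis by (simp only: bilinear_lmul[OF b] *) simp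
    qed
    then show "\<omega> j (f' 0 i - (1/2) *\<^sub>R e i) (e k) = 0"
      by (simp add: bilinear_lsub[OF b] bilinear_lmul[OF b])
  qed
  let ?h = "split_form s g Q A"
  interpret h: symmetric_form ?h by (rule split_form_symmetric[OF rel bo])
  have Qf: "Q (f' j i) = (if j = 0 then e i else 0)" if "j \<le> s" "i \<in> {1..n}" for j i
    using Qe[OF that(2) f0] Q0[OF wL, of j i] that fl[of j i] by auto
  \<comment> \<open>The operator in the summand with index \<open>q\<close> kills the isotropic
    lifts and all \<open>w j i\<close> with j \<noteq> q, and takes \<open>w q i\<close> to an
    orthonormal system. The sign disappears in the inner product.\<close>
  have Bf: "Q (A q (f' j i - (1/2) *\<^sub>R Q (f' j i))) = (if j = q then - e i else 0)"
    if q: "q \<in> {1..s}" and j: "j \<le> s" and i: "i \<in> {1..n}" for q j i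
  proof (cases "j = 0")
    case True
    have "Q (A q (f' j i - (1/2) *\<^sub>R Q (f' j i))) = Q (A q (f' 0 i - (1/2) *\<^sub>R e i))"
      using Qf[OF j i] True by simp
    also have "\<dots> = (\<Sum>k = 1..n. \<omega> q (f' 0 i - (1/2) *\<^sub>R e i) (e k) *\<^sub>R e k)"
      by (simp add: Qexp[of "A q _"] A[OF q])
    also have "\<dots> = 0" using om_f0e[OF q i] by (intro sum.neutral) simp
    finally show ?thesis using True q by simp
  next
    case False
    then have j': "j \<in> {1..s}" using j by simp
    have "Q (A q (f' j i - (1/2) *\<^sub>R Q (f' j i))) = Q (A q (w j i))"
      using Qf[OF j i] False fl[OF j'] by simp
    also have "\<dots> = (\<Sum>k = 1..n. \<omega> q (w j i) (e k) *\<^sub>R e k)" by (simp add: Qexp A[OF q])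
    also have "\<dots> = (\<Sum>k = 1..n. if k = i then (if j = q then - e i else 0) else 0)"
      using om_ew[OF q j' _ i] skew[OF q, of "w j i"] by (intro sum.cong) auto
    finally show ?thesis using i by simp
  qed
  have on: "?h (f' j i) (f' l k) = (if j = l \<and> i = k then 1 else 0)"
    if j: "j \<le> s" and i: "i \<in> {1..n}" and l: "l \<le> s" and k: "k \<in> {1..n}" for j i l k
  proof -
    have "(\<Sum>q = 1..s. g (Q (A q (f' j i - (1/2) *\<^sub>R Q (f' j i)))) (Q (A q (f' l k - (1/2) *\<^sub>R Q (f' l k))))) =
      (\<Sum>q = 1..s. if q = j then (if j = l \<and> i = k then 1 else 0) else 0)"
      using j i l k by (intro sum.cong) (auto simp: Bf g_simps ee)
    also have "\<dots> = (if j \<in> {1..s} \<and> j = l \<and> i = k then 1 else 0)" by simp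
    finally show ?thesis
      unfolding split_form_def using j i l k by (auto simp: Qf g_simps ee)
  qed
  have vv: "\<omega> j (f' 0 i) (f' 0 k) = 0" if j: "j \<in> {1..s}" and i: "i \<in> {1..n}" and k: "k \<in> {1..n}" for j i k
  proof -
    note b = bo[OF j]
    have "\<omega> j (f' 0 i) (f' 0 k) = \<omega> j (e i + (f' 0 i - e i)) (e k + (f' 0 k - e k))" by simp
    also have "\<dots> = \<omega> j (e i) (e k) + \<omega> j (e i) (f' 0 k - e k) + (\<omega> j (f' 0 i - e i) (e k) + \<omega> j (f' 0 i - e i) (f' 0 k - e k))"
      by (simp only: bilinear_ladd[OF b] bilinear_radd[OF b])
    also have "\<omega> j (f' 0 i - e i) (f' 0 k - e k) = 0" by (rule om_L[OF j f0 f0])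
    also have "\<omega> j (e i) (f' 0 k - e k) = - (- (1/2) * \<omega> j (e k) (e i))"
      using skew[OF j, of "e i"] om_f0c[OF j k i] by simp
    also have "\<omega> j (e k) (e i) = - \<omega> j (e i) (e k)" by (rule skew[OF j])
    also note om_f0c[OF j i k]
    finally show ?thesis by simp
  qed
  have vw: "\<omega> j (f' 0 i) (f' l k) = (if j = l \<and> i = k then 1 else 0)"
    if j: "j \<in> {1..s}" and i: "i \<in> {1..n}" and l: "l \<in> {1..s}" and k: "k \<in> {1..n}" for j i l k
  proof -
    have "\<omega> j (f' 0 i - e i) (f' l k) = 0" using om_L[OF j f0] wL[OF l k] fl[OF l] by simp
    then have "\<omega> j (f' 0 i) (f' l k) = \<omega> j (e i) (w l k)" using fl[OF l] by (simp add: bilinear_lsub[OF bo[OF j]])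
    then show ?thesis using om_ew[OF j l i k] by simp
  qed
  have ww: "\<omega> j (f' l i) (f' m k) = 0"
    if j: "j \<in> {1..s}" and i: "i \<in> {1..n}" and l: "l \<in> {1..s}" and m: "m \<in> {1..s}" and k: "k \<in> {1..n}" for j i l m k
    using om_L[OF j wL[OF l i] wL[OF m k]] fl[OF l] fl[OF m] by simp
  note fr = h.orthonormal_frame[OF dim on bo skew vv vw ww]
  show ?thesis by (rule that[OF fr])
qed

text \<open>In an orthonormal standard frame \<open>Q\<close> keeps the \<open>f 0 i\<close>
  components, and the operator in the summand with index \<open>j\<close> reads off the
  \<open>f j i\<close> components up to sign. The summands of \<open>split_form\<close> therefore
  add up to Parseval's formula for \<open>g\<close>.\<close>

lemma split_rel_of_frame:
  assumes frame: "polysymplectic_frame n s \<omega> f (\<lambda>j i X. g X (f j i))" and s: "s \<noteq> 1"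
  obtains Q A where "split_rel UNIV s \<omega> g Q A" "split_form s g Q A = g"
proof -
  let ?L = "kernel_sum s UNIV \<omega>"
  note dual = frame_dual[OF frame]
  have L: "?L = {X. \<forall>i\<in>{1..n}. g X (f 0 i) = 0}" by (rule frame_kernel_sum[OF frame s])
  define Q where "Q X = (\<Sum>i = 1..n. g X (f 0 i) *\<^sub>R f 0 i)" for X
  define A where "A j X = (\<Sum>i = 1..n. g X (f 0 i) *\<^sub>R f j i - g X (f j i) *\<^sub>R f 0 i)" for j X
  have gQ: "g (Q X) Y = (\<Sum>i = 1..n. g X (f 0 i) * g Y (f 0 i))" for X Y
    by (simp add: Q_def g_simps sym[of _ Y])
  have Qf: "g (Q X) (f 0 i) = g X (f 0 i)" if i: "i \<in> {1..n}" for X i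
  proof -
    have "g (Q X) (f 0 i) = (\<Sum>k = 1..n. if k = i then g X (f 0 i) else 0)"
      unfolding gQ using i dual by (intro sum.cong) auto
    then show ?thesis using i by simp
  qed
  have gA: "g (A j X) Y = \<omega> j X Y" if "j \<in> {1..s}" for j X Y
    unfolding frame_form[OF frame that] A_def by (simp add: g_simps sym[of _ Y] algebra_simps)
  have rel: "split_rel UNIV s \<omega> g Q A"
    unfolding split_rel_def L using Qf gA by (auto simp: g_simps gQ)
  have B: "Q (A j (X - (1/2) *\<^sub>R Q X)) = (\<Sum>i = 1..n. (- g X (f j i)) *\<^sub>R f 0 i)" if j: "j \<in> {1..s}" for j X
  proof -
    have "g (A j (X - (1/2) *\<^sub>R Q X)) (f 0 i) = - g X (f j i)" if i: "i \<in> {1..n}" for i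
    proof -
      have "g (A j Z) (f 0 i) = - g Z (f j i)" for Z
      proof -
        have "g (A j Z) (f 0 i) = (\<Sum>k = 1..n. if k = i then - g Z (f j i) else 0)"
          unfolding gA[OF j] frame_form[OF frame j] using i j dual by (intro sum.cong) auto
        then show ?thesis using i by simp
      qed
      moreover have "g (Q X) (f j i) = 0"
        unfolding gQ using dual[of 0 _ j i] i j sym by (intro sum.neutral) auto
      ultimately show ?thesis by (simp add: g_simps)
    qed
    then show ?thesis unfolding Q_def[of "A j _"] by simp
  qed
  have on: "g (f 0 i) (f 0 k) = (if i = k then 1 else 0)" if "i \<in> {1..n}" "k \<in> {1..n}" for i k
    using dual[of 0 k 0 i] that by auto
  have par: "g (\<Sum>i = 1..n. a i *\<^sub>R f 0 i) (\<Sum>i = 1..n. b i *\<^sub>R f 0 i) = (\<Sum>i = 1..n. a i * b i)" for a b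
  proof -
    have "g (\<Sum>i = 1..n. a i *\<^sub>R f 0 i) (\<Sum>i = 1..n. b i *\<^sub>R f 0 i) = (\<Sum>i = 1..n. \<Sum>k = 1..n. if k = i then a i * b i else 0)"
      unfolding bilinear_sum_left[OF bil] bilinear_sum_right[OF bil]
      by (intro sum.cong) (auto simp: g_simps on)
    then show ?thesis by simp
  qed
  have "split_form s g Q A X Y = g X Y" for X Y
  proof -
    have split: "{0..s} = insert 0 {1..s}" by auto
    have QQ: "g (Q X) (Q Y) = (\<Sum>i = 1..n. g X (f 0 i) * g Y (f 0 i))"
      unfolding Q_def par ..
    have BB: "g (Q (A j (X - (1/2) *\<^sub>R Q X))) (Q (A j (Y - (1/2) *\<^sub>R Q Y))) = (\<Sum>i = 1..n. g X (f j i) * g Y (f j i))"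
      if "j \<in> {1..s}" for j
      unfolding B[OF that] par by simp
    have "g X Y = g (\<Sum>j = 0..s. \<Sum>i = 1..n. g X (f j i) *\<^sub>R f j i) Y" using frame_expansion[OF frame] by simp
    also have "\<dots> = (\<Sum>j = 0..s. \<Sum>i = 1..n. g X (f j i) * g Y (f j i))"
      by (simp add: g_simps sym[of _ Y])
    finally show ?thesis
      unfolding split_form_def split using BB QQ by simp
  qed
  then show ?thesis by (intro that[OF rel]) auto
qed

end

section \<open>Polar decomposition for a single form\<close>

declare One_nat_def [simp del]

context inner_product_form
begin

text \<open>\<open>g (S X) Y = g X (S Y)\<close> is additive and homogeneous in \<open>X\<close> for
  every \<open>Y\<close>, and \<open>g\<close> is nondegenerate.\<close>

lemma polar_linear:
  assumes "polar_rel UNIV \<omega> g S" shows "linear S"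
proof -
  have "g (S X) Y = g X (S Y)" for X Y using assms unfolding polar_rel_def by auto
  then show ?thesis by (intro linearI eqI) (simp_all add: g_simps)
qed

text \<open>Existence, uniqueness and eigenvectors are stated together because they come from the
  same frame: the root has eigenvalue \<open>\<mu> i\<close> on both vectors of a block. The
  eigenvectors serve twice, for the compatible frame and for the eigenprojections behind smoothness
  of the root.\<close>

lemma polar_normal_form:
  assumes bo: "bilinear \<omega>" and alt: "\<And>X. \<omega> X X = 0" and nondeg: "\<forall>X. (\<forall>Y. \<omega> X Y = 0) \<longrightarrow> X = 0"
  shows "\<exists>S k \<mu> v w. polar_rel UNIV \<omega> g S \<and> skew_frame \<omega> k \<mu> v w \<and> DIM('e) = 2 * k \<and>
    (\<forall>X. X = (\<Sum>i<k. g X (v i) *\<^sub>R v i + g X (w i) *\<^sub>R w i)) \<and>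
    (\<forall>S'. polar_rel UNIV \<omega> g S' \<longrightarrow> S' = S \<and> (\<forall>i<k. S' (v i) = \<mu> i *\<^sub>R v i \<and> S' (w i) = \<mu> i *\<^sub>R w i))"
proof -
  obtain k \<mu> v w where sf: "skew_frame \<omega> k \<mu> v w"
    and span: "span ((\<lambda>(i, b). if b then w i else v i) ` ({..<k} \<times> UNIV)) = UNIV"
    using skew_normal_form[OF bo alt nondeg] by blast
  have mu: "\<And>i. i < k \<Longrightarrow> \<mu> i > 0"
    and on: "orthonormal_family ({..<k} \<times> UNIV) (\<lambda>(i, b). if b then w i else v i)"
    and o: "\<And>i Y. i < k \<Longrightarrow> \<omega> (v i) Y = \<mu> i * g (w i) Y" "\<And>i Y. i < k \<Longrightarrow> \<omega> (w i) Y = - \<mu> i * g (v i) Y"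
    using sf unfolding skew_frame_def by blast+
  have gg: "g (v i) (v j) = (if i = j then 1 else 0)" "g (w i) (w j) = (if i = j then 1 else 0)"
    "g (v i) (w j) = 0" "g (w i) (v j) = 0" if "i < k" "j < k" for i j
    using orthonormal_familyD[OF on, of "(i, False)" "(j, False)"] orthonormal_familyD[OF on, of "(i, True)" "(j, True)"]
      orthonormal_familyD[OF on, of "(i, False)" "(j, True)"] orthonormal_familyD[OF on, of "(i, True)" "(j, False)"] that
    by auto
  have exp: "X = (\<Sum>i<k. g X (v i) *\<^sub>R v i + g X (w i) *\<^sub>R w i)" for X
  proof -
    have "X = (\<Sum>a\<in>{..<k} \<times> UNIV. g X ((\<lambda>(i, b). if b then w i else v i) a) *\<^sub>R (\<lambda>(i, b). if b then w i else v i) a)"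
      by (rule orthonormal_family_expansion[OF _ on]) (use span in auto)
    also have "\<dots> = (\<Sum>i<k. \<Sum>b\<in>UNIV. g X (if b then w i else v i) *\<^sub>R (if b then w i else v i))"
      unfolding sum.cartesian_product by (rule sum.cong) auto
    finally show ?thesis by (simp add: UNIV_bool add.commute)
  qed
  have dim: "DIM('e) = 2 * k"
    using orthonormal_family_card[OF _ on span] by (simp add: card_cartesian_product)
  obtain A where A: "linear A" "\<And>X Y. g (A X) Y = \<omega> X Y"
    by (rule form_representation[OF bo]) (rule that)
  have Av: "A (v i) = \<mu> i *\<^sub>R w i" "A (w i) = - \<mu> i *\<^sub>R v i" if "i < k" for i
    by (rule eqI; simp add: A(2) o[OF that] g_simps)+
  define S where "S X = (\<Sum>i<k. \<mu> i *\<^sub>R (g X (v i) *\<^sub>R v i + g X (w i) *\<^sub>R w i))" for X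
  have linS: "linear S"
    unfolding S_def by (intro linear_compose_sum ballI) (auto intro!: linearI simp: g_simps algebra_simps)
  have gS: "g (S X) Y = (\<Sum>i<k. \<mu> i * (g X (v i) * g Y (v i) + g X (w i) * g Y (w i)))" for X Y
    unfolding S_def by (simp add: g_simps sym[of _ Y])
  have Sv: "S (v i) = \<mu> i *\<^sub>R v i" "S (w i) = \<mu> i *\<^sub>R w i" if i: "i < k" for i
  proof -
    have "S (v i) = (\<Sum>j<k. if j = i then \<mu> i *\<^sub>R v i else 0)" "S (w i) = (\<Sum>j<k. if j = i then \<mu> i *\<^sub>R w i else 0)"
      unfolding S_def using i by (intro sum.cong; auto simp: gg)+
    then show "S (v i) = \<mu> i *\<^sub>R v i" "S (w i) = \<mu> i *\<^sub>R w i" using i by simp_all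
  qed
  have eq_on_frame: "F X = F' X"
    if F: "linear F" "linear F'" and eq: "\<And>i. i < k \<Longrightarrow> F (v i) = F' (v i) \<and> F (w i) = F' (w i)"
    for F F' :: "'e \<Rightarrow> 'e" and X
  proof -
    have "F (\<Sum>i<k. g X (v i) *\<^sub>R v i + g X (w i) *\<^sub>R w i) = F' (\<Sum>i<k. g X (v i) *\<^sub>R v i + g X (w i) *\<^sub>R w i)"
      unfolding linear_sum[OF F(1)] linear_sum[OF F(2)]
      by (intro sum.cong) (simp_all add: linear_add[OF F(1)] linear_add[OF F(2)] linear_scale[OF F(1)] linear_scale[OF F(2)] eq)
    then show ?thesis using exp[of X] by simp
  qed
  have "S (S X) = - A (A X)" for X
  proof (rule eq_on_frame[of "\<lambda>X. S (S X)" "\<lambda>X. - A (A X)"])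
    show "linear (\<lambda>X. S (S X))" using linear_compose[OF linS linS] by (simp add: o_def)
    show "linear (\<lambda>X. - A (A X))" using linear_compose_neg[OF linear_compose[OF A(1) A(1)]] by (simp add: o_def)
    show "S (S (v i)) = - A (A (v i)) \<and> S (S (w i)) = - A (A (w i))" if "i < k" for i
      using that by (simp add: Sv Av linear_scale[OF linS] linear_scale[OF A(1)])
        (simp add: Av linear_neg[OF A(1)] linear_scale[OF A(1)])
  qed
  moreover have "g (S X) X \<ge> 0" for X
    unfolding gS using mu by (auto intro!: sum_nonneg mult_nonneg_nonneg[OF less_imp_le])
  moreover have "g (S X) Y = g X (S Y)" for X Y
    unfolding sym[of X "S Y"] gS by (simp add: mult.commute)
  ultimately have rel: "polar_rel UNIV \<omega> g S"
    unfolding polar_rel_def using A(2) by (intro conjI bexI[of _ A]) auto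
  have eig: "S' (v i) = \<mu> i *\<^sub>R v i \<and> S' (w i) = \<mu> i *\<^sub>R w i" if S': "polar_rel UNIV \<omega> g S'" and i: "i < k" for S' i
  proof -
    obtain A' where A': "\<And>X Y. g (A' X) Y = \<omega> X Y" "\<And>X. g (S' X) X \<ge> 0" "\<And>X. S' (S' X) = - A' (A' X)"
      using S' unfolding polar_rel_def by auto
    have "A' X = A X" for X by (rule eqI) (simp add: A' A)
    then have sq: "S' (S' X) = - A (A X)" for X using A'(3) by simp
    have lin: "linear S'" by (rule polar_linear[OF S'])
    have "S' Z = \<mu> i *\<^sub>R Z" if Z: "S (S Z) = (\<mu> i * \<mu> i) *\<^sub>R Z" for Z
    proof -
      \<comment> \<open>From \<open>(S' + \<mu>\<^sub>i) (S' - \<mu>\<^sub>i) Z = 0\<close> the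
        vector \<open>Y\<close> would be an eigenvector of the nonnegative \<open>S'\<close> with
        eigenvalue \<open>- \<mu>\<^sub>i < 0\<close>, so it is zero.\<close>
      define Y where "Y = S' Z - \<mu> i *\<^sub>R Z"
      have "S' (S' Z) = S (S Z)" using sq[of Z] \<open>\<And>X. S (S X) = - A (A X)\<close> by simp
      then have "S' Y + \<mu> i *\<^sub>R Y = 0"
        by (simp add: Y_def linear_diff[OF lin] linear_scale[OF lin] Z algebra_simps)
      then have "g (S' Y + \<mu> i *\<^sub>R Y) Y = 0" by (simp add: g_simps)
      then have "g (S' Y) Y + \<mu> i * g Y Y = 0" by (simp add: g_simps)
      then have "\<mu> i * g Y Y \<le> 0" using A'(2)[of Y] by linarith
      then have "g Y Y \<le> 0" using mu[OF i] by (simp add: mult_le_0_iff)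
      then have "Y = 0" using pos[of Y] by fastforce
      then show ?thesis by (simp add: Y_def)
    qed
    moreover have "S (S (v i)) = (\<mu> i * \<mu> i) *\<^sub>R v i" "S (S (w i)) = (\<mu> i * \<mu> i) *\<^sub>R w i"
      using i by (simp_all add: Sv linear_scale[OF linS])
    ultimately show ?thesis by blast
  qed
  have uniq: "S' = S" if S': "polar_rel UNIV \<omega> g S'" for S'
    by (rule ext, rule eq_on_frame[OF polar_linear[OF S'] linS]) (use eig[OF S'] Sv in auto)
  show ?thesis
    by (intro exI[of _ S] exI[of _ k] exI[of _ \<mu>] exI[of _ v] exI[of _ w] conjI allI impI rel sf dim exp)
      (use eig uniq in blast)+
qed

text \<open>In each block the new metric gives \<open>v i\<close> and \<open>w i\<close> the squared
  length \<open>\<mu> i\<close>, and \<open>\<omega> 1 (v i) (w i)\<close> is also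
  \<open>\<mu> i\<close>. Dividing both vectors by the square root of \<open>\<mu> i\<close>
  normalizes the metric and the form at once.\<close>

lemma polar_frame:
  assumes bo: "bilinear (\<omega> 1)" and alt: "\<And>X. \<omega> 1 X X = 0" and nondeg: "\<forall>X. (\<forall>Y. \<omega> 1 X Y = 0) \<longrightarrow> X = 0"
    and dim: "DIM('e) = n * (1 + 1)" and rel: "polar_rel UNIV (\<omega> 1) g S"
  obtains f' where "polysymplectic_frame n 1 \<omega> f' (\<lambda>j i X. g (S X) (f' j i))"
    "inner_product_form (\<lambda>X. g (S X))" "orthonormal_for (\<lambda>X. g (S X)) (basis_vectors n 1 (f' 0) f')"
proof -
  obtain S0 k \<mu> v w where sf: "skew_frame (\<omega> 1) k \<mu> v w" and dimk: "DIM('e) = 2 * k"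
    and eig: "\<forall>S'. polar_rel UNIV (\<omega> 1) g S' \<longrightarrow> S' = S0 \<and> (\<forall>i<k. S' (v i) = \<mu> i *\<^sub>R v i \<and> S' (w i) = \<mu> i *\<^sub>R w i)"
    using polar_normal_form[OF bo alt nondeg] by blast
  have mu: "\<And>i. i < k \<Longrightarrow> \<mu> i > 0"
    and on: "orthonormal_family ({..<k} \<times> UNIV) (\<lambda>(i, b). if b then w i else v i)"
    and o: "\<And>i Y. i < k \<Longrightarrow> \<omega> 1 (v i) Y = \<mu> i * g (w i) Y" "\<And>i Y. i < k \<Longrightarrow> \<omega> 1 (w i) Y = - \<mu> i * g (v i) Y"
    using sf unfolding skew_frame_def by blast+
  have k: "k = n" using dim dimk by simp
  have gg: "g (v i) (v j) = (if i = j then 1 else 0)" "g (w i) (w j) = (if i = j then 1 else 0)"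
    "g (v i) (w j) = 0" "g (w i) (v j) = 0" if "i < n" "j < n" for i j
    using orthonormal_familyD[OF on, of "(i, False)" "(j, False)"] orthonormal_familyD[OF on, of "(i, True)" "(j, True)"]
      orthonormal_familyD[OF on, of "(i, False)" "(j, True)"] orthonormal_familyD[OF on, of "(i, True)" "(j, False)"] that k
    by auto
  have lin: "linear S" by (rule polar_linear[OF rel])
  have gS: "g (S X) Y = g X (S Y)" for X Y using rel unfolding polar_rel_def by auto
  interpret h: symmetric_form "\<lambda>X. g (S X)"
  proof
    show "bilinear (\<lambda>X. g (S X))"
      unfolding bilinear_def by (auto intro!: linearI simp: g_simps linear_add[OF lin] linear_scale[OF lin])
    show "g (S X) Y = g (S Y) X" for X Y using gS[of X Y] sym by simp
  qed
  \<comment> \<open>Blocks are counted from 0, frame vectors from 1.\<close>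
  define f' where "f' j i = (if j = 0 then v (i - 1) /\<^sub>R sqrt (\<mu> (i - 1)) else w (i - 1) /\<^sub>R sqrt (\<mu> (i - 1)))" for j i :: nat
  note b = bo
  note fs = g_simps linear_scale[OF lin] bilinear_lmul[OF b] bilinear_rmul[OF b]
  have e: "S (v i) = \<mu> i *\<^sub>R v i" "S (w i) = \<mu> i *\<^sub>R w i" if "i < n" for i using eig rel that k by auto
  have m: "\<mu> i > 0" if "i < n" for i using mu that k by simp
  have o': "\<omega> 1 (v i) Y = \<mu> i * g (w i) Y" "\<omega> 1 (w i) Y = - \<mu> i * g (v i) Y" if "i < n" for i Y using o that k by auto
  have root: "inverse (sqrt (\<mu> i)) * (inverse (sqrt (\<mu> i)) * \<mu> i) = 1" if "i < n" for i
    using m[OF that] by (simp add: field_simps)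
  have on': "g (S (f' j i)) (f' l q) = (if j = l \<and> i = q then 1 else 0)"
    if "j \<le> 1" "i \<in> {1..n}" "l \<le> 1" "q \<in> {1..n}" for j i l q
  proof -
    have "i - 1 < n" "q - 1 < n" "i - 1 = q - 1 \<longleftrightarrow> i = q" using that by auto
    then show ?thesis using that(1,3) root[of "i - 1"] by (auto simp: f'_def fs e gg mult_ac)
  qed
  have vw: "\<omega> j (f' 0 i) (f' l q) = (if j = l \<and> i = q then 1 else 0)"
    if "j \<in> {1..1}" "i \<in> {1..n}" "l \<in> {1..1}" "q \<in> {1..n}" for j i l q
  proof -
    have "i - 1 < n" "q - 1 < n" "i - 1 = q - 1 \<longleftrightarrow> i = q" "j = 1" "l = 1" using that by auto
    then show ?thesis using root[of "i - 1"] o'[of "i - 1"] by (auto simp: f'_def fs gg mult_ac)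
  qed
  have vv: "\<omega> j (f' 0 i) (f' 0 q) = 0" if "j \<in> {1..1}" "i \<in> {1..n}" "q \<in> {1..n}" for j i q
  proof -
    have "i - 1 < n" "q - 1 < n" "j = 1" using that by auto
    then show ?thesis using o'[of "i - 1"] by (auto simp: f'_def fs gg)
  qed
  have ww: "\<omega> j (f' l i) (f' m q) = 0"
    if "j \<in> {1..1}" "i \<in> {1..n}" "l \<in> {1..1}" "m \<in> {1..1}" "q \<in> {1..n}" for j i l m q
  proof -
    have "i - 1 < n" "q - 1 < n" "j = 1" "l = 1" "m = 1" using that by auto
    then show ?thesis using o'[of "i - 1"] by (auto simp: f'_def fs gg)
  qed
  have skew: "\<omega> j X Y = - \<omega> j Y X" if "j \<in> {1..1}" for j X Y
  proof -
    have "\<omega> 1 X X + \<omega> 1 X Y + (\<omega> 1 Y X + \<omega> 1 Y Y) = 0"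
      using alt[of "X + Y"] by (simp only: bilinear_ladd[OF b] bilinear_radd[OF b])
    then show ?thesis using that alt[of X] alt[of Y] by auto
  qed
  have bo': "bilinear (\<omega> j)" if "j \<in> {1..1}" for j using that b by auto
  show ?thesis by (rule that[OF h.orthonormal_frame[OF dim on' bo' skew vv vw ww]])
qed

text \<open>For a compatible \<open>g\<close> the representing operator is a complex structure: it
  maps \<open>f 0 i\<close> to \<open>f 1 i\<close> and \<open>f 1 i\<close> to
  \<open>- f 0 i\<close>. Its negative square is the identity, which is its own nonnegative
  root.\<close>

lemma polar_rel_id_of_frame:
  assumes frame: "polysymplectic_frame n 1 \<omega> f (\<lambda>j i X. g X (f j i))"
  shows "polar_rel UNIV (\<omega> 1) g (\<lambda>X. X)"
proof -
  note dual = frame_dual[OF frame]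
  define A where "A X = (\<Sum>i = 1..n. g X (f 0 i) *\<^sub>R f 1 i - g X (f 1 i) *\<^sub>R f 0 i)" for X
  have gA: "g (A X) Y = \<omega> 1 X Y" for X Y
    unfolding A_def by (subst frame_form[OF frame]) (simp_all add: g_simps sym[of _ Y] algebra_simps)
  have gA0: "g (A X) (f 0 i) = - g X (f 1 i)" and gA1: "g (A X) (f 1 i) = g X (f 0 i)" if i: "i \<in> {1..n}" for X i
  proof -
    have "g (A X) (f 0 i) = (\<Sum>k = 1..n. if k = i then - g X (f 1 i) else 0)"
      "g (A X) (f 1 i) = (\<Sum>k = 1..n. if k = i then g X (f 0 i) else 0)"
      unfolding gA by (subst frame_form[OF frame]; (intro sum.cong)?; use i dual in auto)+
    then show "g (A X) (f 0 i) = - g X (f 1 i)" "g (A X) (f 1 i) = g X (f 0 i)" using i by simp_all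
  qed
  have "X = - A (A X)" for X
  proof -
    have "- A (A X) = (\<Sum>i = 1..n. g X (f 1 i) *\<^sub>R f 1 i + g X (f 0 i) *\<^sub>R f 0 i)"
      unfolding A_def[of "A X"] sum_negf[symmetric] by (intro sum.cong) (simp_all add: gA0 gA1)
    also have "\<dots> = (\<Sum>j = 0..1. \<Sum>i = 1..n. g X (f j i) *\<^sub>R f j i)"
    proof -
      have "{0..1::nat} = {0, 1}" by auto
      then show ?thesis by (simp add: sum.distrib)
    qed
    also have "\<dots> = X" using frame_expansion[OF frame, of X] by simp
    finally show ?thesis by simp
  qed
  then show ?thesis
    unfolding polar_rel_def using gA nonneg by (intro conjI bexI[of _ A]) auto
qed

end

lemma frame_nondegenerate:
  fixes f :: "nat \<Rightarrow> nat \<Rightarrow> 'e::euclidean_space"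
  assumes frame: "polysymplectic_frame n 1 \<omega> f \<xi>" and X: "\<forall>Y. \<omega> 1 X Y = 0"
  shows "X = 0"
proof -
  have "\<xi> j i X = 0" if "j \<le> 1" "i \<in> {1..n}" for j i
  proof -
    have "\<omega> 1 X (f 0 i) = (\<Sum>k = 1..n. if k = i then - \<xi> 1 i X else 0)"
      "\<omega> 1 X (f 1 i) = (\<Sum>k = 1..n. if k = i then \<xi> 0 i X else 0)"
      by (subst frame_form[OF frame]; (intro sum.cong)?; use that frame_dual[OF frame] in auto)+
    then have "\<xi> 1 i X = 0" "\<xi> 0 i X = 0" using X that(2) by simp_all
    moreover have "j = 0 \<or> j = 1" using that(1) by auto
    ultimately show ?thesis by auto
  qed
  then show ?thesis by (subst frame_expansion[OF frame]) simp
qed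

declare One_nat_def [simp]

section \<open>Existence, uniqueness and fixed points of the pointwise retraction\<close>

definition compatible_form ::
  "'v::real_vector set \<Rightarrow> nat \<Rightarrow> nat \<Rightarrow> (nat \<Rightarrow> 'v \<Rightarrow> 'v \<Rightarrow> real) \<Rightarrow> ('v \<Rightarrow> 'v \<Rightarrow> real) \<Rightarrow> bool" where
  "compatible_form V n s \<omega> h \<longleftrightarrow>
    (\<exists>v w. standard_polysymplectic_basis V n s \<omega> v w \<and> orthonormal_for h (basis_vectors n s v w))"

lemma (in inner_product_form) retract_exists:
  assumes "polysymplectic_structure UNIV n s \<omega>" and dim: "DIM('e) = n * (s + 1)"
  shows "\<exists>h. retract_rel UNIV s \<omega> g h \<and> inner_product_form h \<and> compatible_form UNIV n s \<omega> h"
proof -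
  obtain v w where "standard_polysymplectic_basis UNIV n s \<omega> v w"
    using assms(1) unfolding polysymplectic_structure_def by blast
  then obtain f \<xi> where frame: "polysymplectic_frame n s \<omega> f \<xi>"
    by (rule polysymplectic_frame_of_basis)
  note bo = frame_form_bilinear[OF frame]
  show ?thesis
  proof (cases "s = 1")
    case True
    have frame1: "polysymplectic_frame n 1 \<omega> f \<xi>" using frame True by simp
    have bo1: "bilinear (\<omega> 1)" using bo True by simp
    have alt: "\<omega> 1 X X = 0" for X using frame_form_skew[OF frame, of 1 X X] True by simp
    have nd: "\<forall>X. (\<forall>Y. \<omega> 1 X Y = 0) \<longrightarrow> X = 0" using frame_nondegenerate[OF frame1] by blast
    have dim1: "DIM('e) = n * (1 + 1)" using dim True by simp
    obtain S where S: "polar_rel UNIV (\<omega> 1) g S" using polar_normal_form[OF bo1 alt nd] by blast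
    obtain f' where f': "polysymplectic_frame n 1 \<omega> f' (\<lambda>j i X. g (S X) (f' j i))"
      and ip: "inner_product_form (\<lambda>X. g (S X))"
      and on: "orthonormal_for (\<lambda>X. g (S X)) (basis_vectors n 1 (f' 0) f')"
      by (rule polar_frame[where \<omega>=\<omega>, OF bo1 alt nd dim1 S])
    have "retract_rel UNIV s \<omega> g (\<lambda>X. g (S X))" unfolding retract_rel_def using True S by auto
    moreover have "compatible_form UNIV n s \<omega> (\<lambda>X. g (S X))"
      unfolding compatible_form_def True using standard_basis_of_frame[OF f'] on by blast
    ultimately show ?thesis using ip by blast
  next
    case False
    obtain Q A where rel: "split_rel UNIV s \<omega> g Q A" by (rule split_rel_exists[OF bo])
    let ?h = "split_form s g Q A"
    obtain f' where f': "polysymplectic_frame n s \<omega> f' (\<lambda>j i X. ?h X (f' j i))"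
      and ip: "inner_product_form ?h" and on: "orthonormal_for ?h (basis_vectors n s (f' 0) f')"
      by (rule split_form_frame[OF frame dim False rel])
    have "retract_rel UNIV s \<omega> g ?h" unfolding retract_rel_def using False rel by auto
    moreover have "compatible_form UNIV n s \<omega> ?h"
      unfolding compatible_form_def using standard_basis_of_frame[OF f'] on by blast
    ultimately show ?thesis using ip by blast
  qed
qed

lemma (in inner_product_form) retract_unique:
  assumes "polysymplectic_structure UNIV n s \<omega>"
    and "retract_rel UNIV s \<omega> g h" "retract_rel UNIV s \<omega> g h'"
  shows "h = h'"
proof (cases "s = 1")
  case True
  obtain v w where "standard_polysymplectic_basis UNIV n s \<omega> v w"
    using assms(1) unfolding polysymplectic_structure_def by blast
  then obtain f \<xi> where frame: "polysymplectic_frame n s \<omega> f \<xi>"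
    by (rule polysymplectic_frame_of_basis)
  have frame1: "polysymplectic_frame n 1 \<omega> f \<xi>" using frame True by simp
  have bo1: "bilinear (\<omega> 1)" using frame_form_bilinear[OF frame] True by simp
  have alt: "\<omega> 1 X X = 0" for X using frame_form_skew[OF frame, of 1 X X] True by simp
  have nd: "\<forall>X. (\<forall>Y. \<omega> 1 X Y = 0) \<longrightarrow> X = 0" using frame_nondegenerate[OF frame1] by blast
  obtain S S' where "polar_rel UNIV (\<omega> 1) g S" "polar_rel UNIV (\<omega> 1) g S'"
    and h: "\<forall>X Y. h X Y = g (S X) Y" "\<forall>X Y. h' X Y = g (S' X) Y"
    using assms(2,3) True unfolding retract_rel_def by auto
  then have "S = S'" using polar_normal_form[OF bo1 alt nd] by blast
  then show ?thesis using h by (intro ext) simp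
next
  case False
  obtain Q A Q' A' where "split_rel UNIV s \<omega> g Q A" "split_rel UNIV s \<omega> g Q' A'"
    and h: "\<forall>X Y. h X Y = split_form s g Q A X Y" "\<forall>X Y. h' X Y = split_form s g Q' A' X Y"
    using assms(2,3) False unfolding retract_rel_def by auto
  from split_form_unique[OF this(1,2)] show ?thesis using h by (intro ext) simp
qed

text \<open>The dual basis of an orthonormal frame consists of the functionals
  \<open>g X (f l k)\<close> in \<open>X\<close>, so the coordinates \<open>\<xi>\<close> can be
  replaced by them. This is the form in which the two cases have been computed.\<close>

lemma (in inner_product_form) retract_fixed:
  assumes "compatible_form UNIV n s \<omega> g"
  shows "retract_rel UNIV s \<omega> g g"
proof -
  obtain v w where vw: "standard_polysymplectic_basis UNIV n s \<omega> v w" "orthonormal_for g (basis_vectors n s v w)"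
    using assms unfolding compatible_form_def by blast
  obtain f \<xi> where frame: "polysymplectic_frame n s \<omega> f \<xi>" and im: "frame_image n s f = basis_vectors n s v w"
    by (rule polysymplectic_frame_of_basis[OF vw(1)])
  have on: "g (f j i) (f l k) = (if j = l \<and> i = k then 1 else 0)"
    if "j \<in> {0..s}" "i \<in> {1..n}" "l \<in> {0..s}" "k \<in> {1..n}" for j i l k
  proof -
    have "f j i \<in> frame_image n s f" "f l k \<in> frame_image n s f" using that by (force simp: frame_image_def)+
    then have "g (f j i) (f l k) = (if f j i = f l k then 1 else 0)"
      using vw(2) unfolding im orthonormal_for_def by blast
    then show ?thesis using inj_onD[OF frame_inj[OF frame], of "(j, i)" "(l, k)"] that by auto
  qed
  have xi: "\<xi> l k X = g X (f l k)" if lk: "l \<in> {0..s}" "k \<in> {1..n}" for l k X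
  proof -
    have "g X (f l k) = g (\<Sum>j = 0..s. \<Sum>i = 1..n. \<xi> j i X *\<^sub>R f j i) (f l k)"
      by (rule arg_cong[OF frame_expansion[OF frame]])
    also have "\<dots> = (\<Sum>j = 0..s. \<Sum>i = 1..n. \<xi> j i X * g (f j i) (f l k))" by (simp add: g_simps)
    also have "\<dots> = (\<Sum>j = 0..s. \<Sum>i = 1..n. if j = l \<and> i = k then \<xi> l k X else 0)"
      using on lk by (intro sum.cong) auto
    also have "\<dots> = (\<Sum>j = 0..s. if j = l then \<Sum>i = 1..n. if i = k then \<xi> l k X else 0 else 0)"
      by (intro sum.cong) auto
    also have "\<dots> = \<xi> l k X" using lk by simp
    finally show ?thesis by simp
  qed
  have frame': "polysymplectic_frame n s \<omega> f (\<lambda>j i X. g X (f j i))"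
  proof -
    have xi': "\<xi> l k = (\<lambda>X. g X (f l k))" if "l \<in> {0..s}" "k \<in> {1..n}" for l k using xi[OF that] by auto
    have e: "(\<Sum>j = 0..s. \<Sum>i = 1..n. \<xi> j i X *\<^sub>R f j i) = (\<Sum>j = 0..s. \<Sum>i = 1..n. g X (f j i) *\<^sub>R f j i)" for X
      using xi by (intro sum.cong) auto
    have o: "(\<Sum>i = 1..n. \<xi> 0 i X * \<xi> j i Y - \<xi> 0 i Y * \<xi> j i X) =
        (\<Sum>i = 1..n. g X (f 0 i) * g Y (f j i) - g Y (f 0 i) * g X (f j i))" if "j \<in> {1..s}" for j X Y
      using xi that by (intro sum.cong) auto
    show ?thesis
      using frame unfolding polysymplectic_frame_def e by (simp add: xi' o)
  qed
  show ?thesis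
  proof (cases "s = 1")
    case True
    then show ?thesis
      unfolding retract_rel_def using polar_rel_id_of_frame[of n \<omega> f] frame' by auto
  next
    case False
    obtain Q A where "split_rel UNIV s \<omega> g Q A" "split_form s g Q A = g"
      by (rule split_rel_of_frame[OF frame' False])
    then have "split_rel UNIV s \<omega> g Q A \<and> (\<forall>X\<in>UNIV. \<forall>Y\<in>UNIV. g X Y = split_form s g Q A X Y)" by simp
    then show ?thesis unfolding retract_rel_def if_not_P[OF False] by blast
  qed
qed

section \<open>Transport along linear isomorphisms of subspaces\<close>

locale linear_transport =
  fixes V :: "'a::real_vector set" and W :: "'b::real_vector set" and \<alpha> :: "'a \<Rightarrow> 'b" and \<beta> :: "'b \<Rightarrow> 'a"
  assumes lin: "linear \<alpha>" "linear \<beta>" and sub: "subspace V" "subspace W"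
    and maps: "\<And>X. X \<in> V \<Longrightarrow> \<alpha> X \<in> W" "\<And>Y. Y \<in> W \<Longrightarrow> \<beta> Y \<in> V"
    and inv: "\<And>X. X \<in> V \<Longrightarrow> \<beta> (\<alpha> X) = X" "\<And>Y. Y \<in> W \<Longrightarrow> \<alpha> (\<beta> Y) = Y"
begin

lemma swap: "linear_transport W V \<beta> \<alpha>"
  by (rule linear_transport.intro[OF lin(2,1) sub(2,1) maps(2,1) inv(2,1)])

lemma image: "\<alpha> ` V = W"
  using maps inv by force

lemma kernel_sum_image:
  "kernel_sum s W (\<lambda>j X Y. \<omega> j (\<beta> X) (\<beta> Y)) = \<alpha> ` kernel_sum s V \<omega>"
proof -
  have "{Y\<in>W. \<forall>Y'\<in>W. \<omega> j (\<beta> Y) (\<beta> Y') = 0} = \<alpha> ` {X\<in>V. \<forall>X'\<in>V. \<omega> j X X' = 0}" for j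
  proof (intro equalityI subsetI)
    fix Y assume Y: "Y \<in> {Y\<in>W. \<forall>Y'\<in>W. \<omega> j (\<beta> Y) (\<beta> Y') = 0}"
    then have "\<omega> j (\<beta> Y) X' = 0" if "X' \<in> V" for X' using maps(1)[OF that] inv(1)[OF that] by fastforce
    then show "Y \<in> \<alpha> ` {X\<in>V. \<forall>X'\<in>V. \<omega> j X X' = 0}"
      using Y maps inv by (intro image_eqI[of _ _ "\<beta> Y"]) auto
  qed (use maps inv in auto)
  then have "(\<Union>j\<in>{1..s}. {Y\<in>W. \<forall>Y'\<in>W. \<omega> j (\<beta> Y) (\<beta> Y') = 0}) = \<alpha> ` (\<Union>j\<in>{1..s}. {X\<in>V. \<forall>X'\<in>V. \<omega> j X X' = 0})"
    by (simp add: image_UN)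
  then show ?thesis unfolding kernel_sum_def by (simp add: linear_span_image[OF lin(1)])
qed

lemma kernel_sum_subset: "kernel_sum s V \<omega> \<subseteq> V"
  unfolding kernel_sum_def using sub(1) by (intro span_minimal) auto

text \<open>The relation asserts the existence of operators, and conjugating them by \<alpha> and
  \<beta> gives the operators on the other side. This naturality is what makes a pointwise
  construction independent of coordinates.\<close>

lemma retract_rel_transport:
  assumes "retract_rel V s \<omega> g h"
  shows "retract_rel W s (\<lambda>j X Y. \<omega> j (\<beta> X) (\<beta> Y)) (\<lambda>X Y. g (\<beta> X) (\<beta> Y)) (\<lambda>X Y. h (\<beta> X) (\<beta> Y))"
proof (cases "s = 1")
  case True
  then obtain S A where SA: "S \<in> V \<rightarrow> V" "A \<in> V \<rightarrow> V"
      "\<forall>X\<in>V. \<forall>Y\<in>V. g (A X) Y = \<omega> 1 X Y \<and> g (S X) Y = g X (S Y)"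
      "\<forall>X\<in>V. g (S X) X \<ge> 0 \<and> S (S X) = - A (A X)" "\<forall>X\<in>V. \<forall>Y\<in>V. h X Y = g (S X) Y"
    using assms unfolding retract_rel_def polar_rel_def by auto
  have m: "S (\<beta> Y) \<in> V" "A (\<beta> Y) \<in> V" if "Y \<in> W" for Y using SA(1,2) maps(2)[OF that] by auto
  have "polar_rel W (\<lambda>X Y. \<omega> 1 (\<beta> X) (\<beta> Y)) (\<lambda>X Y. g (\<beta> X) (\<beta> Y)) (\<lambda>Y. \<alpha> (S (\<beta> Y)))"
    unfolding polar_rel_def
  proof (intro conjI bexI[of _ "\<lambda>Y. \<alpha> (A (\<beta> Y))"] ballI)
    show "\<alpha> (S (\<beta> (\<alpha> (S (\<beta> Y))))) = - \<alpha> (A (\<beta> (\<alpha> (A (\<beta> Y)))))" if "Y \<in> W" for Y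
      using SA(4) m[OF that] maps(2)[OF that] by (simp add: inv linear_neg[OF lin(1)])
  qed (use SA m maps inv in auto)
  then show ?thesis
    unfolding retract_rel_def using True SA(5) m maps inv by (auto intro!: exI[of _ "\<lambda>Y. \<alpha> (S (\<beta> Y))"])
next
  case False
  then obtain Q A where QA: "Q \<in> V \<rightarrow> V" "\<forall>j\<in>{1..s}. A j \<in> V \<rightarrow> V \<and> (\<forall>X\<in>V. \<forall>Y\<in>V. g (A j X) Y = \<omega> j X Y)"
      "\<forall>X\<in>V. X - Q X \<in> kernel_sum s V \<omega> \<and> (\<forall>Y\<in>kernel_sum s V \<omega>. g (Q X) Y = 0)"
      "\<forall>X\<in>V. \<forall>Y\<in>V. h X Y = split_form s g Q A X Y"
    using assms unfolding retract_rel_def split_rel_def by auto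
  define Q' A' where "Q' = (\<lambda>Y. \<alpha> (Q (\<beta> Y)))" and "A' = (\<lambda>j Y. \<alpha> (A j (\<beta> Y)))"
  have m: "Q (\<beta> Y) \<in> V" if "Y \<in> W" for Y using QA(1) maps(2)[OF that] by auto
  have mA: "A j X \<in> V" if "j \<in> {1..s}" "X \<in> V" for j X using QA(2) that by auto
  have mQ: "Q X \<in> V" if "X \<in> V" for X using QA(1) that by auto
  have "split_rel W s (\<lambda>j X Y. \<omega> j (\<beta> X) (\<beta> Y)) (\<lambda>X Y. g (\<beta> X) (\<beta> Y)) Q' A'"
    unfolding split_rel_def kernel_sum_image
  proof (intro conjI ballI)
    fix Y assume Y: "Y \<in> W"
    have "Y - Q' Y = \<alpha> (\<beta> Y - Q (\<beta> Y))" by (simp add: Q'_def linear_diff[OF lin(1)] inv(2)[OF Y])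
    then show "Y - Q' Y \<in> \<alpha> ` kernel_sum s V \<omega>" using QA(3) maps(2)[OF Y] by auto
    fix Z assume "Z \<in> \<alpha> ` kernel_sum s V \<omega>"
    then show "g (\<beta> (Q' Y)) (\<beta> Z) = 0"
      using QA(3) maps(2)[OF Y] m[OF Y] kernel_sum_subset[of s \<omega>] by (auto simp: Q'_def inv(1) subset_iff)
  next
    show "A' j \<in> W \<rightarrow> W" if "j \<in> {1..s}" for j
      using maps mQ mA that by (auto simp: Q'_def A'_def)
    show "Q' \<in> W \<rightarrow> W" using maps mQ by (auto simp: Q'_def)
    show "g (\<beta> (A' j X)) (\<beta> Y) = \<omega> j (\<beta> X) (\<beta> Y)" if "j \<in> {1..s}" "X \<in> W" "Y \<in> W" for j X Y
      using QA(2) that maps mA by (simp add: A'_def inv)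
  qed
  moreover have "h (\<beta> X) (\<beta> Y) = split_form s (\<lambda>X Y. g (\<beta> X) (\<beta> Y)) Q' A' X Y" if XY: "X \<in> W" "Y \<in> W" for X Y
  proof -
    have Z: "\<beta> (Q' (A' j (Z - (1/2) *\<^sub>R Q' Z))) = Q (A j (\<beta> Z - (1/2) *\<^sub>R Q (\<beta> Z)))" if "Z \<in> W" "j \<in> {1..s}" for Z j
    proof -
      have "\<beta> (Z - (1/2) *\<^sub>R Q' Z) = \<beta> Z - (1/2) *\<^sub>R Q (\<beta> Z)"
        by (simp add: Q'_def linear_diff[OF lin(2)] linear_scale[OF lin(2)] inv(1)[OF m[OF that(1)]])
      moreover have "\<beta> Z - (1/2) *\<^sub>R Q (\<beta> Z) \<in> V"
        using sub(1) maps(2)[OF that(1)] m[OF that(1)] by (intro subspace_diff subspace_scale)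
      ultimately show ?thesis using mA[OF that(2)] mQ by (simp add: Q'_def A'_def inv(1))
    qed
    have "\<beta> (Q' Z) = Q (\<beta> Z)" if "Z \<in> W" for Z using m[OF that] by (simp add: Q'_def inv(1))
    then show ?thesis
      using QA(4) maps(2) XY Z by (simp add: split_form_def)
  qed
  ultimately show ?thesis unfolding retract_rel_def using False by auto
qed

lemma standard_basis_transport:
  assumes "standard_polysymplectic_basis V n s \<omega> v w"
  shows "standard_polysymplectic_basis W n s (\<lambda>j X Y. \<omega> j (\<beta> X) (\<beta> Y)) (\<lambda>i. \<alpha> (v i)) (\<lambda>j i. \<alpha> (w j i))"
proof -
  define B where "B = basis_vectors n s v w"
  have B: "independent B" "span B = V" "card B = n * (s + 1)"
    and om: "\<And>j X Y. j \<in> {1..s} \<Longrightarrow> X \<in> V \<Longrightarrow> Y \<in> V \<Longrightarrow>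
      \<omega> j X Y = (\<Sum>i = 1..n. wedge (\<lambda>X. representation B X (v i)) (\<lambda>X. representation B X (w j i)) X Y)"
    using assms unfolding standard_polysymplectic_basis_def B_def Let_def by auto
  have img: "basis_vectors n s (\<lambda>i. \<alpha> (v i)) (\<lambda>j i. \<alpha> (w j i)) = \<alpha> ` B"
    by (simp add: basis_vectors_def B_def image_Un image_image case_prod_unfold)
  have fin: "finite B" by (simp add: B_def basis_vectors_def)
  have BV: "B \<subseteq> V" using B(2) span_superset by blast
  have inj: "inj_on \<alpha> V" using inv(1) by (metis inj_onI)
  have ind: "independent (\<alpha> ` B)"
    by (rule linear_independent_injective_image[OF lin(1) B(1)]) (use inj B(2) in simp)
  have spn: "span (\<alpha> ` B) = W" using linear_span_image[OF lin(1), of B] B(2) image by simp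
  have rep: "representation (\<alpha> ` B) Y (\<alpha> b) = representation B (\<beta> Y) b" if Y: "Y \<in> W" and b: "b \<in> B" for Y b
  proof -
    have "Y = \<alpha> (\<Sum>b\<in>B. representation B (\<beta> Y) b *\<^sub>R b)"
      using sum_representation_eq[OF B(1) _ fin subset_refl, of "\<beta> Y"] maps(2)[OF Y] inv(2)[OF Y] B(2) by simp
    also have "\<dots> = (\<Sum>b\<in>B. representation B (\<beta> Y) b *\<^sub>R \<alpha> b)"
      by (simp add: linear_sum[OF lin(1)] linear_scale[OF lin(1)])
    finally have Yr: "Y = (\<Sum>b\<in>B. representation B (\<beta> Y) b *\<^sub>R \<alpha> b)" .
    have "representation (\<alpha> ` B) (\<Sum>b\<in>B. representation B (\<beta> Y) b *\<^sub>R \<alpha> b) =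
        (\<lambda>c. \<Sum>b\<in>B. representation B (\<beta> Y) b * representation (\<alpha> ` B) (\<alpha> b) c)"
      using ind by (simp add: representation_sum representation_scale span_scale span_base)
    then have "representation (\<alpha> ` B) Y (\<alpha> b) = (\<Sum>b'\<in>B. representation B (\<beta> Y) b' * representation (\<alpha> ` B) (\<alpha> b') (\<alpha> b))"
      using Yr by simp
    also have "\<dots> = (\<Sum>b'\<in>B. if b' = b then representation B (\<beta> Y) b else 0)"
      using b BV inj by (intro sum.cong) (auto simp: representation_basis[OF ind] inj_on_eq_iff subset_iff)
    also have "\<dots> = representation B (\<beta> Y) b" using b fin by simp
    finally show ?thesis .
  qed
  have vB: "v i \<in> B" if "i \<in> {1..n}" for i using that by (auto simp: B_def basis_vectors_def)
  have wB: "w j i \<in> B" if "j \<in> {1..s}" "i \<in> {1..n}" for j i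
    unfolding B_def basis_vectors_def using that by (intro UnI2 image_eqI[of _ _ "(j, i)"]) auto
  have "card (\<alpha> ` B) = n * (s + 1)"
    using card_image[OF inj_on_subset[OF inj BV]] B(3) by simp
  moreover have "\<omega> j (\<beta> X) (\<beta> Y) = (\<Sum>i = 1..n. wedge (\<lambda>X. representation (\<alpha> ` B) X (\<alpha> (v i)))
      (\<lambda>X. representation (\<alpha> ` B) X (\<alpha> (w j i))) X Y)" if "j \<in> {1..s}" "X \<in> W" "Y \<in> W" for j X Y
    unfolding om[OF that(1) maps(2)[OF that(2)] maps(2)[OF that(3)]] wedge_def
    using that vB wB by (intro sum.cong) (auto simp: rep)
  ultimately show ?thesis
    unfolding standard_polysymplectic_basis_def Let_def img using ind spn by blast
qed

lemma compatible_form_transport: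
  assumes "compatible_form V n s \<omega> h"
  shows "compatible_form W n s (\<lambda>j X Y. \<omega> j (\<beta> X) (\<beta> Y)) (\<lambda>X Y. h (\<beta> X) (\<beta> Y))"
proof -
  obtain v w where vw: "standard_polysymplectic_basis V n s \<omega> v w" "orthonormal_for h (basis_vectors n s v w)"
    using assms unfolding compatible_form_def by blast
  let ?B = "basis_vectors n s v w"
  have BV: "?B \<subseteq> V"
    using vw(1) span_superset[of ?B] unfolding standard_polysymplectic_basis_def Let_def by blast
  have img: "basis_vectors n s (\<lambda>i. \<alpha> (v i)) (\<lambda>j i. \<alpha> (w j i)) = \<alpha> ` ?B"
    by (simp add: basis_vectors_def image_Un image_image case_prod_unfold)
  have "orthonormal_for (\<lambda>X Y. h (\<beta> X) (\<beta> Y)) (\<alpha> ` ?B)"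
    unfolding orthonormal_for_def
  proof (intro ballI)
    fix c c' assume "c \<in> \<alpha> ` ?B" "c' \<in> \<alpha> ` ?B"
    then obtain b b' where b: "b \<in> ?B" "c = \<alpha> b" "b' \<in> ?B" "c' = \<alpha> b'" by blast
    then have "b \<in> V" "b' \<in> V" using BV by auto
    then have "\<beta> c = b" "\<beta> c' = b'" "c = c' \<longleftrightarrow> b = b'" using b inv(1) by metis+
    then show "h (\<beta> c) (\<beta> c') = (if c = c' then 1 else 0)"
      using vw(2) b unfolding orthonormal_for_def by simp
  qed
  then show ?thesis
    unfolding compatible_form_def img[symmetric] using standard_basis_transport[OF vw(1)] by (intro exI conjI)
qed

end

lemma kernel_sum_cong:
  assumes "\<And>j X Y. j \<in> {1..s} \<Longrightarrow> X \<in> V \<Longrightarrow> Y \<in> V \<Longrightarrow> \<omega> j X Y = \<omega>' j X Y"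
  shows "kernel_sum s V \<omega> = kernel_sum s V \<omega>'"
proof -
  have "(\<Union>j\<in>{1..s}. {X\<in>V. \<forall>Y\<in>V. \<omega> j X Y = 0}) = (\<Union>j\<in>{1..s}. {X\<in>V. \<forall>Y\<in>V. \<omega>' j X Y = 0})"
    by (intro SUP_cong refl Collect_cong conj_cong ball_cong) (simp add: assms)
  then show ?thesis unfolding kernel_sum_def by simp
qed

text \<open>A form transported to coordinates and back agrees with the original only on the tangent
  space, not on the ambient type, so equality of functions cannot be used.\<close>

lemma retract_rel_cong:
  assumes V: "subspace V"
    and \<omega>: "\<And>j X Y. j \<in> {1..s} \<Longrightarrow> X \<in> V \<Longrightarrow> Y \<in> V \<Longrightarrow> \<omega> j X Y = \<omega>' j X Y"
    and g: "\<And>X Y. X \<in> V \<Longrightarrow> Y \<in> V \<Longrightarrow> g X Y = g' X Y"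
    and h: "\<And>X Y. X \<in> V \<Longrightarrow> Y \<in> V \<Longrightarrow> h X Y = h' X Y"
    and rel: "retract_rel V s \<omega> g h"
  shows "retract_rel V s \<omega>' g' h'"
proof (cases "s = 1")
  case True
  then obtain S A where SA: "S \<in> V \<rightarrow> V" "A \<in> V \<rightarrow> V"
      "\<forall>X\<in>V. \<forall>Y\<in>V. g (A X) Y = \<omega> 1 X Y \<and> g (S X) Y = g X (S Y)"
      "\<forall>X\<in>V. g (S X) X \<ge> 0 \<and> S (S X) = - A (A X)" "\<forall>X\<in>V. \<forall>Y\<in>V. h X Y = g (S X) Y"
    using rel unfolding retract_rel_def polar_rel_def by auto
  have m: "S X \<in> V" "A X \<in> V" if "X \<in> V" for X using SA(1,2) that by auto
  have "polar_rel V (\<omega>' 1) g' S"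
    unfolding polar_rel_def using SA m g \<omega>[of 1] True by (intro conjI bexI[of _ A]) auto
  then show ?thesis unfolding retract_rel_def using True SA(5) m g h by auto
next
  case False
  then obtain Q A where QA: "Q \<in> V \<rightarrow> V" "\<forall>j\<in>{1..s}. A j \<in> V \<rightarrow> V \<and> (\<forall>X\<in>V. \<forall>Y\<in>V. g (A j X) Y = \<omega> j X Y)"
      "\<forall>X\<in>V. X - Q X \<in> kernel_sum s V \<omega> \<and> (\<forall>Y\<in>kernel_sum s V \<omega>. g (Q X) Y = 0)"
      "\<forall>X\<in>V. \<forall>Y\<in>V. h X Y = split_form s g Q A X Y"
    using rel unfolding retract_rel_def split_rel_def by auto
  have k: "kernel_sum s V \<omega> = kernel_sum s V \<omega>'" by (rule kernel_sum_cong[OF \<omega>])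
  have sub: "kernel_sum s V \<omega>' \<subseteq> V" unfolding kernel_sum_def using V by (intro span_minimal) auto
  have mQ: "Q X \<in> V" if "X \<in> V" for X using QA(1) that by auto
  have mA: "A j X \<in> V" if "j \<in> {1..s}" "X \<in> V" for j X using QA(2) that by auto
  have "split_rel V s \<omega>' g' Q A"
    unfolding split_rel_def k[symmetric] using QA \<omega> g mQ mA sub[folded k] by (auto simp: subset_iff)
  moreover have "split_form s g Q A X Y = split_form s g' Q A X Y" if "X \<in> V" "Y \<in> V" for X Y
  proof -
    have "Q (A j (Z - (1/2) *\<^sub>R Q Z)) \<in> V" if "j \<in> {1..s}" "Z \<in> V" for j Z
      using mQ[OF mA[OF that(1) subspace_diff[OF V that(2) subspace_scale[OF V mQ[OF that(2)]]]]] .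
    then show ?thesis unfolding split_form_def using that mQ g by (intro arg_cong2[where f="(+)"] sum.cong) auto
  qed
  ultimately show ?thesis
    unfolding retract_rel_def using False QA(4) h by auto
qed

lemma compatible_form_cong:
  assumes \<omega>: "\<And>j X Y. j \<in> {1..s} \<Longrightarrow> X \<in> V \<Longrightarrow> Y \<in> V \<Longrightarrow> \<omega> j X Y = \<omega>' j X Y"
    and h: "\<And>X Y. X \<in> V \<Longrightarrow> Y \<in> V \<Longrightarrow> h X Y = h' X Y"
    and c: "compatible_form V n s \<omega> h"
  shows "compatible_form V n s \<omega>' h'"
proof -
  obtain v w where vw: "standard_polysymplectic_basis V n s \<omega> v w" "orthonormal_for h (basis_vectors n s v w)"
    using c unfolding compatible_form_def by blast
  have BV: "basis_vectors n s v w \<subseteq> V"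
    using vw(1) span_superset unfolding standard_polysymplectic_basis_def Let_def by blast
  have "standard_polysymplectic_basis V n s \<omega>' v w"
    using vw(1) \<omega> unfolding standard_polysymplectic_basis_def Let_def by auto
  moreover have "orthonormal_for h' (basis_vectors n s v w)"
    using vw(2) h BV unfolding orthonormal_for_def by (auto simp: subset_iff)
  ultimately show ?thesis unfolding compatible_form_def by blast
qed

subsection \<open>Tangent spaces and local representatives\<close>

lemma bilinear_form_onD:
  assumes "bilinear_form_on V b" "X \<in> V" "Y \<in> V" "Z \<in> V"
  shows "b (X + Y) Z = b X Z + b Y Z" "b (r *\<^sub>R X) Z = r * b X Z"
    "b Z (X + Y) = b Z X + b Z Y" "b Z (r *\<^sub>R X) = r * b Z X"
  using assms unfolding bilinear_form_on_def by blast+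

locale manifold =
  fixes M :: "'m topology" and A :: "('m, 'e::euclidean_space) chart set"
  assumes mfd: "smooth_manifold M A"
begin

abbreviation coords :: "('m, 'e) chart \<Rightarrow> 'e set" where
  "coords c \<equiv> snd c ` fst c"

abbreviation D :: "('m, 'e) chart \<Rightarrow> ('m, 'e) chart \<Rightarrow> 'm \<Rightarrow> 'e \<Rightarrow> 'e" where
  "D c c' p \<equiv> frechet_derivative (transition c c') (at (snd c p))"

lemma chart: "c \<in> A \<Longrightarrow> is_chart M c"
  using mfd unfolding smooth_manifold_def smooth_atlas_def by blast

lemma chart_cover: "p \<in> topspace M \<Longrightarrow> \<exists>c. c \<in> charts_at A p"
proof -
  assume "p \<in> topspace M"
  then have "p \<in> (\<Union>c\<in>A. fst c)" using mfd unfolding smooth_manifold_def smooth_atlas_def by simp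
  then show ?thesis unfolding charts_at_def by blast
qed

lemma open_domain: "c \<in> A \<Longrightarrow> openin M (fst c)"
  using chart unfolding is_chart_def by blast

lemma domain_topspace: "c \<in> A \<Longrightarrow> p \<in> fst c \<Longrightarrow> p \<in> topspace M"
  using openin_subset[OF open_domain] by blast

lemma open_coords: "c \<in> A \<Longrightarrow> open (coords c)"
  using chart unfolding is_chart_def by blast

lemma chart_homeo: "c \<in> A \<Longrightarrow> homeomorphic_map (subtopology M (fst c)) (top_of_set (coords c)) (snd c)"
  using chart unfolding is_chart_def by blast

lemma chart_inj: "c \<in> A \<Longrightarrow> inj_on (snd c) (fst c)"
  using homeomorphic_imp_injective_map[OF chart_homeo] openin_subset[OF open_domain]
  by (simp add: Int_absorb1)

lemma chart_inv_left: "c \<in> A \<Longrightarrow> p \<in> fst c \<Longrightarrow> chart_inv c (snd c p) = p"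
  unfolding chart_inv_def by (simp add: chart_inj inv_into_f_f)

lemma chart_inv_in: "x \<in> coords c \<Longrightarrow> chart_inv c x \<in> fst c"
  unfolding chart_inv_def by (rule inv_into_into)

lemma open_chart_image:
  assumes "c \<in> A" "openin M N" "N \<subseteq> fst c" shows "open (snd c ` N)"
proof -
  have "openin (subtopology M (fst c)) N" using assms openin_subtopology_Int2[of M N "fst c"]
    by (simp add: openin_open_subtopology open_domain)
  then have "openin (top_of_set (coords c)) (snd c ` N)"
    using homeomorphic_imp_open_map[OF chart_homeo[OF assms(1)]] by (simp add: open_map_def)
  then show ?thesis using open_coords[OF assms(1)] openin_open_eq by blast
qed

lemma open_overlap: "c \<in> A \<Longrightarrow> c' \<in> A \<Longrightarrow> open (snd c ` (fst c \<inter> fst c'))"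
  by (rule open_chart_image) (auto intro: openin_Int open_domain)

lemma open_chart_preimage:
  assumes "c \<in> A" "open V" shows "openin M {p \<in> fst c. snd c p \<in> V}"
proof -
  have "continuous_map (subtopology M (fst c)) (top_of_set (coords c)) (snd c)"
    by (rule homeomorphic_imp_continuous_map[OF chart_homeo[OF assms(1)]])
  then have "continuous_map (subtopology M (fst c)) euclidean (snd c)"
    using continuous_map_into_fulltopology by blast
  then have "openin (subtopology M (fst c)) {p \<in> topspace (subtopology M (fst c)). snd c p \<in> V}"
    using assms(2) openin_continuous_map_preimage by fastforce
  moreover have "topspace (subtopology M (fst c)) = fst c"
    using openin_subset[OF open_domain[OF assms(1)]] by (simp add: Int_absorb1)
  ultimately have "openin (subtopology M (fst c)) {p \<in> fst c. snd c p \<in> V}" by (simp only:)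
  then show ?thesis using openin_trans_full[OF _ open_domain[OF assms(1)]] by simp
qed

lemma transition_smooth:
  assumes "c \<in> A" "c' \<in> A" shows "smooth_on (snd c ` (fst c \<inter> fst c')) (transition c c')"
  using mfd assms unfolding smooth_manifold_def smooth_atlas_def smoothly_compatible_def by blast

lemma transition_apply: "c \<in> A \<Longrightarrow> p \<in> fst c \<Longrightarrow> transition c c' (snd c p) = snd c' p"
  by (simp add: transition_def chart_inv_left)

lemma transition_has_derivative:
  assumes "c \<in> A" "c' \<in> A" "p \<in> fst c" "p \<in> fst c'"
  shows "(transition c c' has_derivative D c c' p) (at (snd c p))"
  by (rule smooth_on_has_derivative[OF transition_smooth]) (use assms in auto)

lemma D_linear: "c \<in> A \<Longrightarrow> c' \<in> A \<Longrightarrow> p \<in> fst c \<Longrightarrow> p \<in> fst c' \<Longrightarrow> linear (D c c' p)"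
  using transition_has_derivative has_derivative_linear by blast

lemma D_compose:
  assumes "c \<in> A" "c' \<in> A" "c'' \<in> A" "p \<in> fst c" "p \<in> fst c'" "p \<in> fst c''"
  shows "D c' c'' p (D c c' p u) = D c c'' p u"
proof -
  have t: "transition c c' (snd c p) = snd c' p" by (rule transition_apply) (use assms in auto)
  have "(transition c' c'' \<circ> transition c c' has_derivative D c' c'' p \<circ> D c c' p) (at (snd c p))"
    by (rule diff_chain_at) (use assms transition_has_derivative t in auto)
  then have "(transition c c'' has_derivative D c' c'' p \<circ> D c c' p) (at (snd c p))"
  proof (rule has_derivative_transform_within_open)
    show "open (snd c ` (fst c \<inter> fst c'))" by (rule open_overlap[OF assms(1,2)])
    show "snd c p \<in> snd c ` (fst c \<inter> fst c')" using assms by auto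
    show "(transition c' c'' \<circ> transition c c') x = transition c c'' x" if "x \<in> snd c ` (fst c \<inter> fst c')" for x
      using that assms by (auto simp: transition_apply)
  qed
  from has_derivative_unique[OF this transition_has_derivative[OF assms(1,3,4,6)]]
  show ?thesis by (simp add: fun_eq_iff)
qed

lemma D_same: "c \<in> A \<Longrightarrow> p \<in> fst c \<Longrightarrow> D c c p u = u"
proof -
  assume c: "c \<in> A" "p \<in> fst c"
  have "((\<lambda>x. x) has_derivative (\<lambda>x. x)) (at (snd c p))" by (rule has_derivative_ident)
  then have "(transition c c has_derivative (\<lambda>x. x)) (at (snd c p))"
    by (rule has_derivative_transform_within_open[OF _ open_coords[OF c(1)]])
      (use c in \<open>auto simp: transition_apply\<close>)
  from fun_cong[OF has_derivative_unique[OF this transition_has_derivative[OF c(1,1) c(2,2)]], of u]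
  show ?thesis by simp
qed

lemma charts_atD: "c \<in> charts_at A p \<Longrightarrow> c \<in> A \<and> p \<in> fst c"
  by (simp add: charts_at_def)

lemma tangent_spaceI:
  assumes "\<And>c1 c2. c1 \<in> charts_at A p \<Longrightarrow> c2 \<in> charts_at A p \<Longrightarrow> Z c2 = D c1 c2 p (Z c1)"
    and "\<And>c1. c1 \<notin> charts_at A p \<Longrightarrow> Z c1 = 0"
  shows "Z \<in> tangent_space A p"
  using assms unfolding tangent_space_def by blast

text \<open>That \<open>coord_vector\<close> takes values in the tangent space is the cocycle rule
  \<open>D_compose\<close>: one coordinate vector determines the others consistently. Every
  pointwise statement can now be moved to the model space.\<close>

lemma tangent_transport:
  assumes c: "c \<in> charts_at A p"
  shows "linear_transport UNIV (tangent_space A p) (coord_vector A c p) (\<lambda>X. X c)"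
proof
  note cA = charts_atD[OF c]
  have Dl: "linear (D c c' p)" if "c' \<in> charts_at A p" for c'
    using D_linear cA charts_atD[OF that] by blast
  show "coord_vector A c p (x + y) = coord_vector A c p x + coord_vector A c p y"
    "coord_vector A c p (r *\<^sub>R x) = r *\<^sub>R coord_vector A c p x" for x y r
    using Dl by (auto simp: coord_vector_def fun_eq_iff plus_fun_def scaleR_fun_def linear_add linear_scale)
  show "(X + Y) c = X c + Y c" "(r *\<^sub>R X) c = r *\<^sub>R X c" for X Y :: "('m, 'e) tvec" and r
    by (simp_all add: plus_fun_def scaleR_fun_def)
  show "subspace (UNIV :: 'e set)" by simp
  have Dl': "linear (D c1 c2 p)" if "c1 \<in> charts_at A p" "c2 \<in> charts_at A p" for c1 c2
    using D_linear charts_atD[OF that(1)] charts_atD[OF that(2)] by blast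
  show "subspace (tangent_space A p)"
    unfolding subspace_def
  proof (intro conjI ballI allI)
    have tD: "Z c2 = D c1 c2 p (Z c1)" if "Z \<in> tangent_space A p" "c1 \<in> charts_at A p" "c2 \<in> charts_at A p" for Z c1 c2
      using that unfolding tangent_space_def by blast
    have t0: "Z c1 = 0" if "Z \<in> tangent_space A p" "c1 \<notin> charts_at A p" for Z c1
      using that unfolding tangent_space_def by blast
    show "0 \<in> tangent_space A p"
      unfolding tangent_space_def by (simp add: linear_0[OF Dl'])
    fix X Y :: "('m, 'e) tvec" and r :: real
    assume X: "X \<in> tangent_space A p"
    show "r *\<^sub>R X \<in> tangent_space A p"
    proof (rule tangent_spaceI)
      show "(r *\<^sub>R X) c2 = D c1 c2 p ((r *\<^sub>R X) c1)" if "c1 \<in> charts_at A p" "c2 \<in> charts_at A p" for c1 c2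
        unfolding scaleR_fun_def linear_scale[OF Dl'[OF that]] tD[OF X that, symmetric] ..
      show "(r *\<^sub>R X) c1 = 0" if "c1 \<notin> charts_at A p" for c1
        using t0[OF X that] by (simp add: scaleR_fun_def)
    qed
    assume Y: "Y \<in> tangent_space A p"
    show "X + Y \<in> tangent_space A p"
    proof (rule tangent_spaceI)
      show "(X + Y) c2 = D c1 c2 p ((X + Y) c1)" if "c1 \<in> charts_at A p" "c2 \<in> charts_at A p" for c1 c2
        unfolding plus_fun_def linear_add[OF Dl'[OF that]] tD[OF X that, symmetric] tD[OF Y that, symmetric] ..
      show "(X + Y) c1 = 0" if "c1 \<notin> charts_at A p" for c1
        using t0[OF X that] t0[OF Y that] by (simp add: plus_fun_def)
    qed
  qed
  show "coord_vector A c p u \<in> tangent_space A p" for u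
  proof (rule tangent_spaceI)
    show "coord_vector A c p u c2 = D c1 c2 p (coord_vector A c p u c1)"
      if "c1 \<in> charts_at A p" "c2 \<in> charts_at A p" for c1 c2
      using D_compose[of c c1 c2 p u] cA charts_atD[OF that(1)] charts_atD[OF that(2)] that
      by (simp add: coord_vector_def)
    show "coord_vector A c p u c1 = 0" if "c1 \<notin> charts_at A p" for c1
      using that by (simp add: coord_vector_def)
  qed
  show "coord_vector A c p u c = u" for u
    using c cA by (simp add: coord_vector_def D_same)
  show "coord_vector A c p (X c) = X" if "X \<in> tangent_space A p" for X
  proof
    fix c'
    have "X c' = D c c' p (X c)" if "c' \<in> charts_at A p"
      using \<open>X \<in> tangent_space A p\<close> c that unfolding tangent_space_def by blast
    moreover have "X c' = 0" if "c' \<notin> charts_at A p"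
      using \<open>X \<in> tangent_space A p\<close> that unfolding tangent_space_def by blast
    ultimately show "coord_vector A c p (X c) c' = X c'" unfolding coord_vector_def by simp
  qed
qed auto

lemma coord_vector_change:
  assumes "c \<in> charts_at A p" "c' \<in> charts_at A p"
  shows "coord_vector A c p u = coord_vector A c' p (D c c' p u)"
proof
  fix c''
  show "coord_vector A c p u c'' = coord_vector A c' p (D c c' p u) c''"
  proof (cases "c'' \<in> charts_at A p")
    case True
    then show ?thesis
      using D_compose[of c c' c'' p u] charts_atD[OF assms(1)] charts_atD[OF assms(2)] charts_atD[OF True]
      by (simp add: coord_vector_def)
  qed (simp add: coord_vector_def)
qed

lemma coord_vector_coords:
  assumes "c \<in> charts_at A p" "c' \<in> charts_at A p"
  shows "coord_vector A c p u c' = D c c' p u"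
  using assms(2) by (simp add: coord_vector_def)

lemma subspace_tangent_space: "p \<in> topspace M \<Longrightarrow> subspace (tangent_space A p)"
  using chart_cover linear_transport.sub(2)[OF tangent_transport] by blast

lemma local_rep_at: "c \<in> A \<Longrightarrow> p \<in> fst c \<Longrightarrow>
    local_rep A T c (snd c p) u w = T p (coord_vector A c p u) (coord_vector A c p w)"
  by (simp add: local_rep_def Let_def chart_inv_left)

lemma local_rep_change:
  assumes "c \<in> A" "c' \<in> A" "p \<in> fst c" "p \<in> fst c'"
  shows "local_rep A T c' (snd c' p) u w = local_rep A T c (snd c p) (D c' c p u) (D c' c p w)"
  unfolding local_rep_at[OF assms(1,3)] local_rep_at[OF assms(2,4)]
  using coord_vector_change[of c' p c] assms by (simp add: charts_at_def)

lemma bilinear_local_rep: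
  assumes "bilinear_form_on (tangent_space A p) (T p)" "c \<in> A" "p \<in> fst c"
  shows "bilinear (local_rep A T c (snd c p))"
proof -
  interpret linear_transport UNIV "tangent_space A p" "coord_vector A c p" "\<lambda>X. X c"
    by (rule tangent_transport) (use assms in \<open>simp add: charts_at_def\<close>)
  note b = bilinear_form_onD[OF assms(1) maps(1)[OF UNIV_I] maps(1)[OF UNIV_I] maps(1)[OF UNIV_I]]
  show ?thesis
    unfolding bilinear_def
    by (intro conjI allI linearI) (simp_all add: local_rep_at[OF assms(2,3)] linear_add[OF lin(1)] linear_scale[OF lin(1)] b)
qed

text \<open>One good chart around each point is enough, which permits working in charts adapted to
  the distribution. On overlaps the components change by derivatives of the transition maps, which
  are smooth and independent of the parameter.\<close>

lemma param_smooth_charts: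
  fixes \<T> :: "'t \<Rightarrow> ('m, 'e) tensor2"
  assumes bil: "\<And>t p. t \<in> topspace T \<Longrightarrow> p \<in> topspace M \<Longrightarrow> bilinear_form_on (tangent_space A p) (\<T> t p)"
    and loc: "\<And>p. p \<in> topspace M \<Longrightarrow> \<exists>c\<in>charts_at A p. \<forall>k u w. param_C_k k T (coords c) (\<lambda>t x. local_rep A (\<T> t) c x u w)"
    and c': "c' \<in> A"
  shows "param_C_k k T (coords c') (\<lambda>t x. local_rep A (\<T> t) c' x u w)"
proof (rule param_C_k_local)
  fix x0 assume "x0 \<in> coords c'"
  then obtain p where p: "p \<in> fst c'" "x0 = snd c' p" by auto
  then obtain c where c: "c \<in> A" "p \<in> fst c"
    and C: "\<And>k u w. param_C_k k T (coords c) (\<lambda>t x. local_rep A (\<T> t) c x u w)"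
    using loc[OF domain_topspace[OF c' p(1)]] charts_atD by meson
  define V where "V = snd c' ` (fst c' \<inter> fst c)"
  have V: "open V" unfolding V_def by (rule open_overlap[OF c' c(1)])
  have VU: "V \<subseteq> coords c'" by (auto simp: V_def)
  have sm: "smooth_on V (transition c' c)" unfolding V_def by (rule transition_smooth[OF c' c(1)])
  have comp: "param_C_k k T V (\<lambda>t x. local_rep A (\<T> t) c (transition c' c x) b b')" for b b'
  proof (rule param_C_k_compose_smooth[OF V open_coords[OF c(1)] C])
    show "C_k_on k V (transition c' c)" using sm by (simp add: smooth_on_def)
    show "transition c' c x \<in> coords c" if "x \<in> V" for x
      using that c' by (auto simp: V_def transition_apply)
  qed
  \<comment> \<open>The transformed directions depend on the point, while \<open>C\<close> covers
    fixed directions only; bilinearity reduces the former to the latter.\<close>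
  have "param_C_k k T V (\<lambda>t x. \<Sum>b\<in>Basis. \<Sum>b'\<in>Basis.
      ((frechet_derivative (transition c' c) (at x) u \<bullet> b) * (frechet_derivative (transition c' c) (at x) w \<bullet> b')) *
      local_rep A (\<T> t) c (transition c' c x) b b')"
    by (intro param_C_k_sum param_C_k_mult param_C_k_inner param_C_k_const V comp
        smooth_on_imp_param[OF smooth_on_frechet_derivative[OF sm]])
  then have "param_C_k k T V (\<lambda>t x. local_rep A (\<T> t) c' x u w)"
  proof (rule param_C_k_cong[OF V, rotated])
    fix t x assume t: "t \<in> topspace T" and "x \<in> V"
    then obtain q where q: "q \<in> fst c'" "q \<in> fst c" "x = snd c' q" by (auto simp: V_def)
    have b: "bilinear (local_rep A (\<T> t) c (snd c q))"
      by (rule bilinear_local_rep[where T="\<T> t", OF bil[OF t domain_topspace[OF c' q(1)]] c(1) q(2)])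
    let ?u = "D c' c q u" and ?w = "D c' c q w"
    have "local_rep A (\<T> t) c' x u w = local_rep A (\<T> t) c (snd c q) (\<Sum>b\<in>Basis. (?u \<bullet> b) *\<^sub>R b) (\<Sum>b\<in>Basis. (?w \<bullet> b) *\<^sub>R b)"
      unfolding q(3) euclidean_representation by (rule local_rep_change[OF c(1) c' q(2,1)])
    also have "\<dots> = (\<Sum>b\<in>Basis. \<Sum>b'\<in>Basis. (?u \<bullet> b) * ((?w \<bullet> b') * local_rep A (\<T> t) c (snd c q) b b'))"
      by (simp only: bilinear_sum_left[OF b] bilinear_sum_right[OF b] bilinear_lmul[OF b] bilinear_rmul[OF b]
          real_scaleR_def sum_distrib_left) (subst sum.swap, simp only: mult.left_commute)
    finally show "(\<Sum>b\<in>Basis. \<Sum>b'\<in>Basis.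
      ((frechet_derivative (transition c' c) (at x) u \<bullet> b) * (frechet_derivative (transition c' c) (at x) w \<bullet> b')) *
      local_rep A (\<T> t) c (transition c' c x) b b') = local_rep A (\<T> t) c' x u w"
      unfolding q(3) by (simp add: transition_apply[OF c' q(1)] mult.assoc)
  qed
  then show "\<exists>V. open V \<and> x0 \<in> V \<and> V \<subseteq> coords c' \<and> param_C_k k T V (\<lambda>t x. local_rep A (\<T> t) c' x u w)"
    using V VU p c(2) by (intro exI[of _ V]) (auto simp: V_def simp del: param_C_k.simps)
qed

end

subsection \<open>The topology on symmetric tensors\<close>

lemma param_C_k_iter_deriv:
  "param_C_k (length vs + k) T U F \<Longrightarrow> param_C_k k T U (\<lambda>t. iter_deriv vs (F t))"
proof (induction vs arbitrary: k)
  case (Cons v vs)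
  have "param_C_k (length vs + Suc k) T U F" using Cons.prems by (simp del: param_C_k.simps)
  from param_C_k_SucD'[OF Cons.IH[OF this], of v] show ?case by (simp del: param_C_k.simps)
qed simp

text \<open>The recursion of \<open>iter_deriv\<close> takes off the last derivative taken, whereas
  induction on the order of a family takes off the first.\<close>

lemma iter_deriv_snoc: "iter_deriv (vs @ [v]) f = iter_deriv vs (\<lambda>x. frechet_derivative f (at x) v)"
  by (induction vs) simp_all

lemma param_C_k_of_iter_deriv:
  assumes "\<And>t. t \<in> topspace T \<Longrightarrow> smooth_on U (F t)" "\<And>vs. param_C_k 0 T U (\<lambda>t. iter_deriv vs (F t))"
  shows "param_C_k k T U F"
  using assms
proof (induction k arbitrary: F)
  case 0
  then show ?case using 0(2)[of "[]"] by simp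
next
  case (Suc k)
  have "param_C_k k T U (\<lambda>t x. frechet_derivative (F t) (at x) v)" for v
  proof (rule Suc.IH)
    show "smooth_on U (\<lambda>x. frechet_derivative (F t) (at x) v)" if "t \<in> topspace T" for t
      by (rule smooth_on_frechet_derivative[OF Suc.prems(1)[OF that]])
    show "param_C_k 0 T U (\<lambda>t. iter_deriv vs (\<lambda>x. frechet_derivative (F t) (at x) v))" for vs
      using Suc.prems(2)[of "vs @ [v]"] unfolding iter_deriv_snoc .
  qed
  moreover have "F t differentiable (at x)" if "t \<in> topspace T" "x \<in> U" for t x
    using smooth_on_has_derivative[OF Suc.prems(1)[OF that(1)] that(2)] by (rule differentiableI)
  moreover have "param_C_k 0 T U F" using Suc.prems(2)[of "[]"] by simp
  ultimately show ?case by simp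
qed

context manifold
begin

lemma topspace_Cinf: "topspace (Cinf_topology M A) = sym_tensors M A"
proof -
  \<comment> \<open>The subbasis is indexed by charts, so some chart is needed even if
    \<open>M\<close> is empty. A maximal atlas contains the empty chart; the neighbourhood for
    \<open>K = {}\<close> is then the set of all symmetric tensors.\<close>
  have "\<exists>c. c \<in> A"
  proof -
    let ?c = "({}, \<lambda>_. 0) :: ('m, 'e) chart"
    have "is_chart M ?c"
      by (simp add: is_chart_def homeomorphic_map_def quotient_map_def)
    moreover have "smooth_on {} f" for f :: "'e \<Rightarrow> 'e"
    proof -
      have "C_k_on k {} f" for k and f :: "'e \<Rightarrow> 'e" by (induction k arbitrary: f) auto
      then show ?thesis by (simp add: smooth_on_def)
    qed
    ultimately show ?thesis
      using mfd unfolding smooth_manifold_def smoothly_compatible_def by (intro exI[of _ ?c]) simp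
  qed
  then obtain c where c: "c \<in> A" by blast
  let ?S = "{Cinf_nbhd M A T c K vs u w \<epsilon> | T c K vs u w \<epsilon>.
       T \<in> sym_tensors M A \<and> c \<in> A \<and> compact K \<and> K \<subseteq> coords c \<and> \<epsilon> > 0}"
  have 1: "g \<in> \<Union>?S" if g: "g \<in> sym_tensors M A" for g
  proof (rule UnionI)
    show "Cinf_nbhd M A g c {} [] 0 0 1 \<in> ?S"
      by (intro CollectI exI conjI, rule refl) (use g c in auto)
    show "g \<in> Cinf_nbhd M A g c {} [] 0 0 1"
      using g by (simp add: Cinf_nbhd_def)
  qed
  have 2: "Cinf_nbhd M A T c K vs u w e \<subseteq> sym_tensors M A" for T c K vs u w e
    by (auto simp: Cinf_nbhd_def)
  have "\<Union>?S = sym_tensors M A"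
  proof (rule equalityI)
    show "\<Union>?S \<subseteq> sym_tensors M A"
      by (rule Union_least, elim CollectE exE conjE) (simp only: 2)
    show "sym_tensors M A \<subseteq> \<Union>?S" by (rule subsetI) (rule 1)
  qed
  then show ?thesis unfolding Cinf_topology_def topology_generated_by_topspace .
qed

lemma sym_tensor_smooth:
  "g \<in> sym_tensors M A \<Longrightarrow> c \<in> A \<Longrightarrow> smooth_on (coords c) (\<lambda>x. local_rep A g c x u w)"
  unfolding sym_tensors_def smooth_tensor2_def by blast

text \<open>Joint continuity of the derivatives becomes uniformity over a compact \<open>K\<close>
  by the tube lemma.\<close>

lemma continuous_map_Cinf:
  assumes F: "\<And>t. t \<in> topspace T \<Longrightarrow> \<F> t \<in> sym_tensors M A"
    and C: "\<And>c u w k. c \<in> A \<Longrightarrow> param_C_k k T (coords c) (\<lambda>t x. local_rep A (\<F> t) c x u w)"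
  shows "continuous_map T (Cinf_topology M A) \<F>"
proof -
  have op: "openin T {t \<in> topspace T. \<F> t \<in> Cinf_nbhd M A g c K vs u w e}"
    if g: "g \<in> sym_tensors M A" and c: "c \<in> A" and K: "compact K" "K \<subseteq> coords c" for g c K vs u w e
  proof -
    define H where "H z = \<bar>iter_deriv vs (\<lambda>y. local_rep A (\<F> (fst z)) c y u w) (snd z) -
      iter_deriv vs (\<lambda>y. local_rep A g c y u w) (snd z)\<bar>" for z
    have 1: "param_C_k 0 T (coords c) (\<lambda>t. iter_deriv vs (\<lambda>x. local_rep A (\<F> t) c x u w))"
      by (rule param_C_k_iter_deriv[OF C[OF c]])
    have 2: "param_C_k 0 T (coords c) (\<lambda>_. iter_deriv vs (\<lambda>x. local_rep A g c x u w))"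
      by (rule param_C_k_iter_deriv[OF smooth_on_imp_param[OF sym_tensor_smooth[OF g c]]])
    have "continuous_map (prod_topology T (top_of_set (coords c))) euclideanreal H"
      unfolding H_def using param_C_k_diff[OF open_coords[OF c] 1 2] by (intro continuous_map_real_abs) simp
    then have "continuous_map (prod_topology T (top_of_set K)) euclideanreal H"
      using param_C_k_subset[OF K(2), of 0 T "\<lambda>t x. H (t, x)"] by simp
    then have W: "openin (prod_topology T (top_of_set K)) {z \<in> topspace (prod_topology T (top_of_set K)). H z \<in> {..<e}}"
      by (rule openin_continuous_map_preimage) simp
    show ?thesis
    proof (subst openin_subopen, intro ballI)
      fix t assume t: "t \<in> {t \<in> topspace T. \<F> t \<in> Cinf_nbhd M A g c K vs u w e}"
      have "compact_space (top_of_set K)" using K(1) by (simp add: compact_space_subtopology)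
      moreover have "{t} \<times> topspace (top_of_set K) \<subseteq> {z \<in> topspace (prod_topology T (top_of_set K)). H z \<in> {..<e}}"
        using t by (auto simp: Cinf_nbhd_def H_def)
      moreover have "t \<in> topspace T" using t by simp
      ultimately obtain V V' where V: "openin T V" "t \<in> V" "K \<subseteq> V'"
        "V \<times> V' \<subseteq> {z \<in> topspace (prod_topology T (top_of_set K)). H z \<in> {..<e}}"
        using tube_lemma_right[OF W, of K t] by (auto simp: compact_space_def)
      have "V \<subseteq> {t \<in> topspace T. \<F> t \<in> Cinf_nbhd M A g c K vs u w e}"
      proof
        fix s assume s: "s \<in> V"
        then have sT: "s \<in> topspace T" using openin_subset[OF V(1)] by auto
        have "H (s, x) < e" if "x \<in> K" for x using V(3,4) s that by auto
        then show "s \<in> {t \<in> topspace T. \<F> t \<in> Cinf_nbhd M A g c K vs u w e}"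
          using sT F[OF sT] by (simp add: Cinf_nbhd_def H_def)
      qed
      then show "\<exists>V. openin T V \<and> t \<in> V \<and> V \<subseteq> {t \<in> topspace T. \<F> t \<in> Cinf_nbhd M A g c K vs u w e}"
        using V by blast
    qed
  qed
  show ?thesis
    unfolding Cinf_topology_def
  proof (rule continuous_on_generated_topo)
    fix N assume "N \<in> {Cinf_nbhd M A g c K vs u w e |g c K vs u w e.
       g \<in> sym_tensors M A \<and> c \<in> A \<and> compact K \<and> K \<subseteq> coords c \<and> e > 0}"
    then show "openin T (\<F> -` N \<inter> topspace T)"
      using op by (auto simp: vimage_def Int_def conj_commute)
  next
    show "\<F> ` topspace T \<subseteq> \<Union> {Cinf_nbhd M A g c K vs u w e |g c K vs u w e.
       g \<in> sym_tensors M A \<and> c \<in> A \<and> compact K \<and> K \<subseteq> coords c \<and> e > 0}"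
      using F topspace_Cinf unfolding Cinf_topology_def topology_generated_by_topspace by auto
  qed
qed

text \<open>The universal family: tensors are parametrized by themselves. Joint continuity of
  evaluation uses local compactness of the model space, since a neighbourhood in the topology of
  tensors controls a derivative on a whole ball around \<open>x\<close>.\<close>

lemma param_C_k_Cinf:
  assumes c: "c \<in> A"
  shows "param_C_k k (Cinf_topology M A) (coords c) (\<lambda>g x. local_rep A g c x u w)"
proof (rule param_C_k_of_iter_deriv)
  show "smooth_on (coords c) (\<lambda>x. local_rep A g c x u w)" if "g \<in> topspace (Cinf_topology M A)" for g
    using that c by (simp add: topspace_Cinf sym_tensor_smooth)
  fix vs
  define d where "d g = iter_deriv vs (\<lambda>x. local_rep A g c x u w)" for g
  have "param_C_k 0 (Cinf_topology M A) (coords c) d"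
  proof (rule param_C_k_0I, rule tendstoI)
    fix g x and e :: real
    assume g: "g \<in> topspace (Cinf_topology M A)" and x: "x \<in> coords c" and e: "e > 0"
    have g': "g \<in> sym_tensors M A" using g by (simp add: topspace_Cinf)
    have "continuous_on (coords c) (d g)"
    proof -
      have "param_C_k 0 (discrete_topology {()}) (coords c) (\<lambda>_. d g)"
        unfolding d_def by (rule param_C_k_iter_deriv[OF smooth_on_imp_param[OF sym_tensor_smooth[OF g' c]]])
      from C_k_of_param_C_k[OF this, of "()"] show ?thesis by simp
    qed
    then obtain \<delta> where \<delta>: "\<delta> > 0" "\<And>y. y \<in> coords c \<Longrightarrow> dist y x < \<delta> \<Longrightarrow> dist (d g y) (d g x) < e / 2"
      using x half_gt_zero[OF e] unfolding continuous_on_iff by blast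
    obtain r where r: "r > 0" "cball x r \<subseteq> coords c"
      using open_coords[OF c] x open_contains_cball by blast
    \<comment> \<open>The closed ball has to stay in the chart and in the open ball of radius
      \<delta>, hence half of \<delta>. On it the two errors, from changing the tensor and from
      moving the point, are below \<open>e / 2\<close> each.\<close>
    define K where "K = cball x (min r (\<delta> / 2))"
    have K: "compact K" "K \<subseteq> coords c" using r by (auto simp: K_def)
    let ?N = "Cinf_nbhd M A g c K vs u w (e / 2)"
    let ?Z = "prod_topology (Cinf_topology M A) (top_of_set (coords c))"
    have "openin (Cinf_topology M A) ?N"
      unfolding Cinf_topology_def 
      by (rule topology_generated_by_Basis, intro CollectI exI conjI, rule refl) (use g' c K e in auto)
    moreover have "openin (top_of_set (coords c)) (ball x (min r (\<delta> / 2)))"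
      using r by (intro open_subset) (auto simp: subset_iff)
    ultimately have "openin ?Z (?N \<times> ball x (min r (\<delta> / 2)))" by (simp add: openin_prod_Times_iff)
    moreover have "(g, x) \<in> ?N \<times> ball x (min r (\<delta> / 2))"
      using g' e r \<delta> by (simp add: Cinf_nbhd_def)
    moreover have "dist (d (fst z) (snd z)) (d g x) < e" if z: "z \<in> ?N \<times> ball x (min r (\<delta> / 2))" for z
    proof -
      have "snd z \<in> K" "dist (snd z) x < \<delta>" using z \<delta> by (auto simp: K_def dist_commute)
      then have "dist (d (fst z) (snd z)) (d g (snd z)) < e / 2" "dist (d g (snd z)) (d g x) < e / 2"
        using z K(2) \<delta>(2) by (auto simp: Cinf_nbhd_def d_def dist_real_def)
      then show ?thesis using dist_triangle[of "d (fst z) (snd z)" "d g x" "d g (snd z)"] by linarith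
    qed
    ultimately show "\<forall>\<^sub>F z in atin ?Z (g, x). dist (d (fst z) (snd z)) (d g x) < e"
      unfolding eventually_atin by blast
  qed
  then show "param_C_k 0 (Cinf_topology M A) (coords c) (\<lambda>g. iter_deriv vs (\<lambda>x. local_rep A g c x u w))"
    unfolding d_def .
qed

end

subsection \<open>Riemannian metrics exist\<close>

text \<open>The classical flat function is \<open>flat 0\<close>. The powers of \<open>1 / t\<close>
  make the family closed under differentiation up to linear combinations, so smoothness of all
  members follows by one induction.\<close>

definition flat :: "nat \<Rightarrow> real \<Rightarrow> real" where
  "flat m t = (if t > 0 then (1 / t) ^ m * exp (- (1 / t)) else 0)"

lemma flat_pos_iff: "flat 0 t > 0 \<longleftrightarrow> t > 0" and flat_nonneg: "flat m t \<ge> 0"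
  by (simp_all add: flat_def)

lemma flat_has_derivative:
  "(flat m has_real_derivative (flat (m + 2) t - m * flat (m + 1) t)) (at t)"
proof -
  consider "t > 0" | "t < 0" | "t = 0" by linarith
  then show ?thesis
  proof cases
    case 1
    have i: "((\<lambda>t. 1 / t) has_real_derivative - ((1 / t)\<^sup>2)) (at t)"
      using 1 by (auto intro!: derivative_eq_intros simp: power2_eq_square)
    have e: "((\<lambda>t. exp (- (1 / t))) has_real_derivative exp (- (1 / t)) * (1 / t)\<^sup>2) (at t)"
      using DERIV_chain2[OF DERIV_exp DERIV_minus[OF i]] by simp
    have p: "((\<lambda>t. (1 / t) ^ m) has_real_derivative - (m * (1 / t) ^ (m + 1))) (at t)"
    proof (cases m)
      case (Suc q)
      have "real m * (- ((1 / t)\<^sup>2) * (1 / t) ^ (m - Suc 0)) = - (m * (1 / t) ^ (m + 1))"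
        unfolding Suc by (simp only: diff_Suc_Suc diff_zero power_add power2_eq_square power_Suc power_one_right) simp
      then show ?thesis using DERIV_power[OF i, of m] by (simp only:)
    qed simp
    have "- (m * (1 / t) ^ (m + 1)) * exp (- (1 / t)) + exp (- (1 / t)) * (1 / t)\<^sup>2 * (1 / t) ^ m =
        flat (m + 2) t - m * flat (m + 1) t"
      using 1 by (simp only: flat_def if_True power_add[of _ m 2]) (simp add: algebra_simps)
    then have "((\<lambda>t. (1 / t) ^ m * exp (- (1 / t))) has_real_derivative (flat (m + 2) t - m * flat (m + 1) t)) (at t)"
      using DERIV_mult[OF p e] by (simp only:)
    then show ?thesis
      by (rule has_field_derivative_transform_within_open[of _ _ _ "{0<..}"]) (use 1 in \<open>auto simp: flat_def\<close>)
  next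
    case 2
    have "((\<lambda>t::real. 0::real) has_real_derivative (flat (m + 2) t - m * flat (m + 1) t)) (at t)"
      using 2 by (simp add: flat_def)
    then show ?thesis
      by (rule has_field_derivative_transform_within_open[of _ _ _ "{..<0}"]) (use 2 in \<open>auto simp: flat_def\<close>)
  next
    case 3
    \<comment> \<open>With \<open>x = inverse h\<close> this is the right-hand difference quotient
      of \<open>flat m\<close> at 0; the additional power is the division by
      \<open>h\<close>.\<close>
    have "((\<lambda>x::real. x ^ (m + 1) / exp x) \<longlongrightarrow> 0) at_top" by (rule tendsto_power_div_exp_0)
    from filterlim_compose[OF this filterlim_inverse_at_top_right]
    have "((\<lambda>h. inverse h ^ (m + 1) / exp (inverse h)) \<longlongrightarrow> 0) (at_right (0::real))" .
    then have "((\<lambda>h. flat m h / h) \<longlongrightarrow> 0) (at_right 0)"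
      by (rule Lim_transform_eventually)
        (auto simp: eventually_at_filter flat_def field_simps exp_minus intro!: always_eventually)
    moreover have "((\<lambda>h. flat m h / h) \<longlongrightarrow> 0) (at_left 0)"
      by (rule Lim_transform_eventually[OF tendsto_const])
        (auto simp: eventually_at_filter flat_def intro!: always_eventually)
    ultimately have "((\<lambda>h. flat m h / h) \<longlongrightarrow> 0) (at 0)" by (simp add: filterlim_split_at)
    then show ?thesis
      using 3 by (simp add: has_field_derivative_iff flat_def)
  qed
qed

lemma smooth_flat: "smooth_on UNIV (flat m)"
proof (rule smooth_onI_param)
  show "param_C_k k (discrete_topology {()}) UNIV (\<lambda>_. flat m)" for k
  proof (induction k arbitrary: m)
    case 0
    have "continuous_on UNIV (flat m)"
      using flat_has_derivative by (intro DERIV_continuous_on) auto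
    then show ?case by (intro param_C_k_of_C_k) simp
  next
    case (Suc k)
    show ?case
    proof (rule param_C_k_SucI[OF open_UNIV param_C_k_imp_0[OF Suc.IH]])
      show "(flat m has_derivative (\<lambda>v. (flat (m + 2) x - m * flat (m + 1) x) * v)) (at x)" for x
        using flat_has_derivative[of m x] by (simp add: has_field_derivative_def)
      show "param_C_k k (discrete_topology {()}) UNIV (\<lambda>_ x. (flat (m + 2) x - m * flat (m + 1) x) * v)" for v
        by (intro param_C_k_mult param_C_k_diff param_C_k_const open_UNIV Suc.IH)
    qed
  qed
qed

section \<open>Bump functions and their locally finite superposition\<close>

context manifold
begin

definition smooth_fun :: "('m \<Rightarrow> real) \<Rightarrow> bool" where
  "smooth_fun \<phi> \<longleftrightarrow> (\<forall>c\<in>A. smooth_on (coords c) (\<lambda>x. \<phi> (chart_inv c x)))"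

lemma smooth_fun_mult:
  assumes "smooth_fun \<phi>" "smooth_fun \<psi>" shows "smooth_fun (\<lambda>p. \<phi> p * \<psi> p)"
  unfolding smooth_fun_def
proof (intro ballI smooth_onI_param)
  fix c k assume c: "c \<in> A"
  have "smooth_on (coords c) (\<lambda>x. \<phi> (chart_inv c x))" "smooth_on (coords c) (\<lambda>x. \<psi> (chart_inv c x))"
    using assms c unfolding smooth_fun_def by blast+
  then show "param_C_k k (discrete_topology {()}) (coords c) (\<lambda>_ x. \<phi> (chart_inv c x) * \<psi> (chart_inv c x))"
    by (intro param_C_k_mult smooth_on_imp_param open_coords[OF c])
qed

lemma smooth_fun_const: "smooth_fun (\<lambda>p. a)"
  unfolding smooth_fun_def by (intro ballI smooth_onI_param param_C_k_const open_coords)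

lemma smooth_fun_prod:
  "(\<And>i. i \<in> I \<Longrightarrow> smooth_fun (\<phi> i)) \<Longrightarrow> smooth_fun (\<lambda>p. \<Prod>i\<in>I. \<phi> i p)"
  by (induction I rule: infinite_finite_induct) (auto intro!: smooth_fun_const smooth_fun_mult)

lemma smooth_fun_flat_diff:
  assumes "smooth_fun \<phi>" shows "smooth_fun (\<lambda>p. flat 0 (a - \<phi> p))"
  unfolding smooth_fun_def
proof
  fix c assume c: "c \<in> A"
  have s: "smooth_on (coords c) (\<lambda>x. \<phi> (chart_inv c x))" using assms c unfolding smooth_fun_def by blast
  have "smooth_on (coords c) (\<lambda>x. a - \<phi> (chart_inv c x))"
    by (rule smooth_onI_param, intro param_C_k_diff param_C_k_const smooth_on_imp_param[OF s] open_coords[OF c])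
  then show "smooth_on (coords c) (\<lambda>x. flat 0 (a - \<phi> (chart_inv c x)))"
    by (rule smooth_on_compose[OF open_coords[OF c] open_UNIV smooth_flat]) simp
qed

lemma openin_smooth_fun_greater:
  assumes "smooth_fun \<phi>" shows "openin M {p \<in> topspace M. \<phi> p > a}"
proof (subst openin_subopen, intro ballI)
  fix p assume p: "p \<in> {p \<in> topspace M. \<phi> p > a}"
  then obtain c where c: "c \<in> A" "p \<in> fst c" using chart_cover charts_atD by blast
  have "smooth_on (coords c) (\<lambda>x. \<phi> (chart_inv c x))" using assms c unfolding smooth_fun_def by blast
  then have "C_k_on 0 (coords c) (\<lambda>x. \<phi> (chart_inv c x))" by (simp only: smooth_on_def)
  then have "continuous_on (coords c) (\<lambda>x. \<phi> (chart_inv c x))" by simp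
  then have "open {x \<in> coords c. \<phi> (chart_inv c x) \<in> {a<..}}"
    using open_coords[OF c(1)] by (intro continuous_open_preimage[folded vimage_def, unfolded Int_def, simplified]) (auto simp: conj_commute)
  from open_chart_preimage[OF c(1) this]
  have "openin M {q \<in> fst c. snd c q \<in> {x \<in> coords c. \<phi> (chart_inv c x) \<in> {a<..}}}" .
  also have "{q \<in> fst c. snd c q \<in> {x \<in> coords c. \<phi> (chart_inv c x) \<in> {a<..}}} = {q \<in> fst c. \<phi> q > a}"
    using c(1) by (auto simp: chart_inv_left dest: inj_onD[OF chart_inj[OF c(1)]])
  finally have "openin M {q \<in> fst c. \<phi> q > a}" .
  moreover have "{q \<in> fst c. \<phi> q > a} \<subseteq> {p \<in> topspace M. \<phi> p > a}" using domain_topspace[OF c(1)] by auto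
  ultimately show "\<exists>T. openin M T \<and> p \<in> T \<and> T \<subseteq> {p \<in> topspace M. \<phi> p > a}" using c p by blast
qed

text \<open>\<open>K\<close> is closed in the whole manifold, not merely in the chart domain: its
  complement is then open, and objects defined in the chart and multiplied by the bump extend
  smoothly by zero.\<close>

definition bump :: "('m, 'e) chart \<Rightarrow> ('m \<Rightarrow> real) \<Rightarrow> 'm set \<Rightarrow> bool" where
  "bump c \<phi> K \<longleftrightarrow> c \<in> A \<and> smooth_fun \<phi> \<and> (\<forall>q. \<phi> q \<ge> 0) \<and> closedin M K \<and> K \<subseteq> fst c \<and> (\<forall>q. q \<notin> K \<longrightarrow> \<phi> q = 0)"

lemma bump_exists:
  assumes "p \<in> topspace M"
  shows "\<exists>c \<phi> K. bump c \<phi> K \<and> \<phi> p > 0"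
proof -
  obtain c where c: "c \<in> A" "p \<in> fst c" using chart_cover[OF assms] charts_atD by blast
  define x0 where "x0 = snd c p"
  have "x0 \<in> coords c" using c by (simp add: x0_def)
  then obtain r where r: "r > 0" "cball x0 r \<subseteq> coords c"
    using open_coords[OF c(1)] open_contains_cball by blast
  \<comment> \<open>The squared distance is used because, unlike the distance, it is smooth at the
    centre.\<close>
  define \<beta> where "\<beta> x = flat 0 (r\<^sup>2 - (x - x0) \<bullet> (x - x0))" for x
  define \<phi> where "\<phi> q = (if q \<in> fst c then \<beta> (snd c q) else 0)" for q
  define K where "K = chart_inv c ` cball x0 r"
  have KD: "K \<subseteq> fst c" unfolding K_def using r(2) chart_inv_in by blast
  \<comment> \<open>Compactness is only a means: in a Hausdorff space it makes \<open>K\<close>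
    closed.\<close>
  have "compactin M K"
  proof -
    have "continuous_map (top_of_set (coords c)) (subtopology M (fst c)) (chart_inv c)"
    proof -
      obtain g where g: "homeomorphic_maps (subtopology M (fst c)) (top_of_set (coords c)) (snd c) g"
        using homeomorphic_map_maps chart_homeo[OF c(1)] by blast
      have top: "topspace (subtopology M (fst c)) = fst c"
        using openin_subset[OF open_domain[OF c(1)]] by (simp add: Int_absorb1)
      have e: "g x = chart_inv c x" if "x \<in> coords c" for x
        using that g top chart_inv_left[OF c(1)] unfolding homeomorphic_maps_def by fastforce
      have "continuous_map (top_of_set (coords c)) (subtopology M (fst c)) g"
        using g unfolding homeomorphic_maps_def by blast
      then show ?thesis by (rule continuous_map_eq) (simp add: e)
    qed
    then have "compactin (subtopology M (fst c)) K"
      unfolding K_def using r(2) by (intro image_compactin) (auto simp: compactin_subtopology)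
    then show ?thesis by (simp add: compactin_subtopology)
  qed
  then have Kcl: "closedin M K"
    using mfd unfolding smooth_manifold_def by (intro compactin_imp_closedin) auto
  have sb: "smooth_on UNIV \<beta>"
    unfolding \<beta>_def
  proof (rule smooth_on_compose[OF open_UNIV open_UNIV smooth_flat])
    have sid: "smooth_on UNIV (\<lambda>x::'e. x)"
    proof (rule smooth_onI_param)
      show "param_C_k k (discrete_topology {()}) UNIV (\<lambda>_ x::'e. x)" for k
      proof (cases k)
        case 0
        show ?thesis unfolding 0 by (rule param_C_k_of_C_k) simp
      next
        case (Suc m)
        show ?thesis unfolding Suc
          by (rule param_C_k_SucI[where F'="\<lambda>_ _ v. v"])
            (auto intro: param_C_k_const param_C_k_of_C_k simp del: param_C_k.simps)
      qed
    qed
    show "smooth_on UNIV (\<lambda>x. r\<^sup>2 - (x - x0) \<bullet> (x - x0))"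
      by (rule smooth_onI_param,
          intro param_C_k_diff param_C_k_inner param_C_k_const smooth_on_imp_param[OF sid] open_UNIV)
  qed simp
  have out: "\<phi> q = 0" if "q \<notin> K" for q
  proof (cases "q \<in> fst c")
    case True
    then have "snd c q \<notin> cball x0 r" using that chart_inv_left[OF c(1) True] unfolding K_def by (metis image_eqI)
    then have "r \<le> norm (snd c q - x0)" by (simp add: dist_norm norm_minus_commute)
    then have "r\<^sup>2 \<le> (snd c q - x0) \<bullet> (snd c q - x0)" using r(1) by (simp add: dot_square_norm power_mono)
    then show ?thesis by (simp add: \<phi>_def \<beta>_def flat_def)
  qed (simp add: \<phi>_def)
  have "smooth_fun \<phi>"
    unfolding smooth_fun_def
  proof (intro ballI smooth_on_local)
    fix c' x assume c': "c' \<in> A" and x: "x \<in> coords c'"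
    then obtain q where q: "q \<in> fst c'" "x = snd c' q" by auto
    show "\<exists>V. open V \<and> x \<in> V \<and> V \<subseteq> coords c' \<and> smooth_on V (\<lambda>x. \<phi> (chart_inv c' x))"
    proof (cases "q \<in> fst c")
      case True
      let ?V = "snd c' ` (fst c' \<inter> fst c)"
      have V: "open ?V" by (rule open_overlap[OF c' c(1)])
      have "smooth_on ?V (\<lambda>x. \<beta> (transition c' c x))"
        by (rule smooth_on_compose[OF V open_UNIV sb transition_smooth[OF c' c(1)]]) simp
      then have "smooth_on ?V (\<lambda>x. \<phi> (chart_inv c' x))"
        by (rule smooth_on_cong[OF V]) (auto simp: \<phi>_def chart_inv_left[OF c'] transition_apply[OF c'])
      then show ?thesis using V q True by (intro exI[of _ ?V]) auto
    next
      case False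
      let ?V = "snd c' ` (fst c' - K)"
      have V: "open ?V"
        by (rule open_chart_image[OF c']) (use Kcl open_domain[OF c'] in \<open>auto intro: openin_diff\<close>)
      have "smooth_on ?V (\<lambda>x. 0 :: real)" by (intro smooth_onI_param param_C_k_const V)
      then have "smooth_on ?V (\<lambda>x. \<phi> (chart_inv c' x))"
        by (rule smooth_on_cong[OF V]) (auto simp: out chart_inv_left[OF c'])
      then show ?thesis using V q False KD by (intro exI[of _ ?V]) auto
    qed
  qed
  moreover have "\<phi> q \<ge> 0" for q by (simp add: \<phi>_def \<beta>_def flat_nonneg)
  moreover have "\<phi> p > 0" using c r(1) by (simp add: \<phi>_def \<beta>_def x0_def flat_pos_iff)
  ultimately have "bump c \<phi> K \<and> \<phi> p > 0" unfolding bump_def using c(1) Kcl KD out by blast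
  then show ?thesis by blast
qed

text \<open>By the Lindelof property countably many of the sets where a bump is positive cover
  \<open>M\<close>. Repetitions in the enumeration do no harm.\<close>

lemma bump_sequence:
  assumes "topspace M \<noteq> {}"
  obtains c \<phi> K where "\<And>k::nat. bump (c k) (\<phi> k) (K k)" "\<And>p. p \<in> topspace M \<Longrightarrow> \<exists>k. \<phi> k p > 0"
proof -
  obtain c \<phi> K where B: "\<And>p. p \<in> topspace M \<Longrightarrow> bump (c p) (\<phi> p) (K p)" "\<And>p. p \<in> topspace M \<Longrightarrow> \<phi> p p > 0"
    using bump_exists by metis
  define U where "U p = {q \<in> topspace M. \<phi> p q > 0}" for p
  have "Lindelof_space M"
    using mfd unfolding smooth_manifold_def by (intro second_countable_imp_Lindelof_space) auto
  moreover have "\<And>V. V \<in> U ` topspace M \<Longrightarrow> openin M V"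
    using B(1) openin_smooth_fun_greater unfolding U_def bump_def by auto
  moreover have "\<Union> (U ` topspace M) = topspace M" using B(2) by (auto simp: U_def)
  ultimately obtain \<V> where V: "countable \<V>" "\<V> \<subseteq> U ` topspace M" "\<Union>\<V> = topspace M"
    unfolding Lindelof_space_def by meson
  obtain P where P: "P \<subseteq> topspace M" "countable P" "\<V> = U ` P"
    using countable_subset_image V(1,2) by metis
  have "P \<noteq> {}" using V(3) P(3) assms by (metis Union_empty image_empty)
  let ?e = "from_nat_into P"
  have e: "?e k \<in> topspace M" for k using from_nat_into[OF \<open>P \<noteq> {}\<close>] P(1) by auto
  have "\<exists>k. \<phi> (?e k) p > 0" if "p \<in> topspace M" for p
  proof -
    obtain q where "q \<in> P" "p \<in> U q" using V(3) P(3) \<open>p \<in> topspace M\<close> by auto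
    then show ?thesis using from_nat_into_surj[OF P(2)] by (metis (mono_tags, lifting) U_def mem_Collect_eq)
  qed
  then show ?thesis using B(1) e by (intro that[of "\<lambda>k. c (?e k)" "\<lambda>k. \<phi> (?e k)" "\<lambda>k. K (?e k)"]) auto
qed

text \<open>Multiplying \<open>\<phi> k\<close> by cut-offs that vanish where some earlier \<open>\<phi> j\<close> exceeds \<open>1 / (k + 1)\<close> makes the
  family locally finite without losing positivity: at \<open>p\<close> the first \<open>\<phi> k\<close> with \<open>\<phi> k p > 0\<close> survives.\<close>

lemma locally_finite_bump_sequence:
  assumes "topspace M \<noteq> {}"
  obtains c \<psi> K where "\<And>k::nat. bump (c k) (\<psi> k) (K k)" "\<And>p. p \<in> topspace M \<Longrightarrow> \<exists>k. \<psi> k p > 0"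
    "\<And>p. p \<in> topspace M \<Longrightarrow> \<exists>N n. openin M N \<and> p \<in> N \<and> (\<forall>q\<in>N. \<forall>k\<ge>n. \<psi> k q = 0)"
proof -
  obtain c \<phi> K where B: "\<And>k::nat. bump (c k) (\<phi> k) (K k)" and P: "\<And>p. p \<in> topspace M \<Longrightarrow> \<exists>k. \<phi> k p > 0"
    by (rule bump_sequence[OF assms]) (rule that)
  define \<psi> where "\<psi> k p = \<phi> k p * (\<Prod>j<k. flat 0 (1 / (real k + 1) - \<phi> j p))" for k p
  have "bump (c k) (\<psi> k) (K k)" for k
  proof -
    have "smooth_fun (\<psi> k)"
      unfolding \<psi>_def using B by (intro smooth_fun_mult smooth_fun_prod smooth_fun_flat_diff) (auto simp: bump_def)
    moreover have "\<psi> k q \<ge> 0" for q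
      unfolding \<psi>_def using B[of k] by (intro mult_nonneg_nonneg prod_nonneg) (auto simp: bump_def flat_nonneg)
    ultimately show ?thesis using B[of k] unfolding bump_def by (simp add: \<psi>_def)
  qed
  moreover have "\<exists>k. \<psi> k p > 0" if "p \<in> topspace M" for p
  proof -
    \<comment> \<open>All earlier functions vanish at \<open>p\<close>, so every cut-off factor of
      \<open>\<psi> k\<close> there is \<open>flat 0 (1 / (k + 1)) > 0\<close>.\<close>
    define k where "k = (LEAST k. \<phi> k p > 0)"
    have k: "\<phi> k p > 0" unfolding k_def using P[OF that] by (rule LeastI_ex)
    have "\<phi> j p = 0" if "j < k" for j
      using not_less_Least[of j "\<lambda>k. \<phi> k p > 0"] that B[of j] unfolding k_def bump_def by (meson antisym not_less)
    then have "\<psi> k p > 0" unfolding \<psi>_def using k by (intro mult_pos_pos prod_pos) (auto simp: flat_pos_iff)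
    then show ?thesis ..
  qed
  moreover have "\<exists>N n. openin M N \<and> p \<in> N \<and> (\<forall>q\<in>N. \<forall>k\<ge>n. \<psi> k q = 0)" if p: "p \<in> topspace M" for p
  proof -
    obtain j where j: "\<phi> j p > 0" using P[OF p] by blast
    \<comment> \<open>Near \<open>p\<close> the function \<open>\<phi> j\<close> stays above half
      its value there. For k \<ge> m this exceeds the threshold of \<open>\<psi> k\<close>, and for
      k > j the function \<open>\<phi> j\<close> occurs among its cut-offs, so
      \<open>\<psi> k\<close> vanishes.\<close>
    obtain m :: nat where m: "1 / (real m + 1) < \<phi> j p / 2"
      using reals_Archimedean[of "\<phi> j p / 2"] j by (auto simp: inverse_eq_divide add.commute)
    let ?N = "{q \<in> topspace M. \<phi> j q > \<phi> j p / 2}"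
    have "\<psi> k q = 0" if "q \<in> ?N" "k \<ge> max m (Suc j)" for k q
    proof -
      have "1 / (real k + 1) \<le> 1 / (real m + 1)" using that(2) by (intro divide_left_mono) auto
      then have "flat 0 (1 / (real k + 1) - \<phi> j q) = 0" using that(1) m by (simp add: flat_def add.commute)
      then have "(\<Prod>j<k. flat 0 (1 / (real k + 1) - \<phi> j q)) = 0" using that(2) by (intro prod_zero) auto
      then show ?thesis unfolding \<psi>_def by (simp only: mult_zero_right)
    qed
    moreover have "openin M ?N" using B[of j] unfolding bump_def by (intro openin_smooth_fun_greater) auto
    ultimately show ?thesis using p j by (intro exI[of _ ?N] exI[of _ "max m (Suc j)"]) auto
  qed
  ultimately show ?thesis by (rule that)
qed

text \<open>Euclidean products of the coordinate vectors, weighted by the bumps. The weights are not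
  normalized to total one, as a positive total suffices for a metric. Restricting the sum to nonzero
  weights makes it finite at each point.\<close>

definition bump_metric :: "(nat \<Rightarrow> ('m, 'e) chart) \<Rightarrow> (nat \<Rightarrow> 'm \<Rightarrow> real) \<Rightarrow> ('m, 'e) tensor2" where
  "bump_metric c \<psi> p X Y = (if p \<in> topspace M \<and> X \<in> tangent_space A p \<and> Y \<in> tangent_space A p
     then \<Sum>k | \<psi> k p \<noteq> 0. \<psi> k p * (X (c k) \<bullet> Y (c k)) else 0)"

lemma smooth_bump_term:
  assumes B: "bump c \<psi> K" and c': "c' \<in> A"
  shows "smooth_on (coords c') (\<lambda>x. \<psi> (chart_inv c' x) *
    (coord_vector A c' (chart_inv c' x) u c \<bullet> coord_vector A c' (chart_inv c' x) w c))"
    (is "smooth_on _ ?F")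
proof (rule smooth_on_local)
  fix x assume x: "x \<in> coords c'"
  then obtain q where q: "q \<in> fst c'" "x = snd c' q" by auto
  have c: "c \<in> A" and sf: "smooth_on (coords c') (\<lambda>x. \<psi> (chart_inv c' x))"
    and K: "closedin M K" "K \<subseteq> fst c" "\<And>q. q \<notin> K \<Longrightarrow> \<psi> q = 0"
    using B c' unfolding bump_def smooth_fun_def by blast+
  show "\<exists>V. open V \<and> x \<in> V \<and> V \<subseteq> coords c' \<and> smooth_on V ?F"
  proof (cases "q \<in> fst c")
    case True
    let ?V = "snd c' ` (fst c' \<inter> fst c)"
    have V: "open ?V" by (rule open_overlap[OF c' c])
    have sV: "smooth_on ?V (\<lambda>x. \<psi> (chart_inv c' x))" by (rule smooth_on_subset[OF sf]) auto
    note sD = smooth_on_frechet_derivative[OF transition_smooth[OF c' c]]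
    have "smooth_on ?V (\<lambda>x. \<psi> (chart_inv c' x) *
        (frechet_derivative (transition c' c) (at x) u \<bullet> frechet_derivative (transition c' c) (at x) w))"
      by (rule smooth_onI_param, intro param_C_k_mult param_C_k_inner V smooth_on_imp_param[OF sV] smooth_on_imp_param[OF sD])
    then have "smooth_on ?V ?F"
      by (rule smooth_on_cong[OF V])
        (auto simp: chart_inv_left[OF c'] coord_vector_coords charts_at_def c c')
    then show ?thesis using V q True by (intro exI[of _ ?V]) auto
  next
    case False
    let ?V = "snd c' ` (fst c' - K)"
    have V: "open ?V"
      by (rule open_chart_image[OF c']) (use K open_domain[OF c'] in \<open>auto intro: openin_diff\<close>)
    have "smooth_on ?V (\<lambda>x. 0 :: real)" by (intro smooth_onI_param param_C_k_const V)
    then have "smooth_on ?V ?F"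
      by (rule smooth_on_cong[OF V]) (auto simp: K(3) chart_inv_left[OF c'])
    then show ?thesis using V q False K(2) by (intro exI[of _ ?V]) auto
  qed
qed

lemma coord_vector_in_tangent_space:
  "c \<in> charts_at A p \<Longrightarrow> coord_vector A c p u \<in> tangent_space A p"
  using linear_transport.maps(1)[OF tangent_transport] by blast

lemma riemannian_metric_exists: "\<exists>g. riemannian_metric M A g"
proof (cases "topspace M = {}")
  case True
  have "fst c = {}" if "c \<in> A" for c using openin_subset[OF open_domain[OF that]] True by simp
  moreover have "smooth_on {} f" for f :: "'e \<Rightarrow> real"
    using smooth_on_local[of "{}" f] by simp
  ultimately have "riemannian_metric M A (\<lambda>_ _ _. 0)"
    using True by (auto simp: riemannian_metric_def sym_tensors_def smooth_tensor2_def)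
  then show ?thesis by blast
next
  case False
  obtain c \<psi> K where B: "\<And>k::nat. bump (c k) (\<psi> k) (K k)" and P: "\<And>p. p \<in> topspace M \<Longrightarrow> \<exists>k. \<psi> k p > 0"
    and N: "\<And>p. p \<in> topspace M \<Longrightarrow> \<exists>N n. openin M N \<and> p \<in> N \<and> (\<forall>q\<in>N. \<forall>k\<ge>n. \<psi> k q = 0)"
    using locally_finite_bump_sequence[OF False, of thesis] by blast
  let ?g = "bump_metric c \<psi>"
  have fin: "finite {k. \<psi> k p \<noteq> 0}" if "p \<in> topspace M" for p
  proof -
    obtain n where "\<forall>k\<ge>n. \<psi> k p = 0" using N[OF \<open>p \<in> topspace M\<close>] by blast
    then have "{k. \<psi> k p \<noteq> 0} \<subseteq> {..<n}" by (auto simp: not_le[symmetric])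
    then show ?thesis using finite_subset by blast
  qed
  have g: "?g p X Y = (\<Sum>k | \<psi> k p \<noteq> 0. \<psi> k p * (X (c k) \<bullet> Y (c k)))"
    if "p \<in> topspace M" "X \<in> tangent_space A p" "Y \<in> tangent_space A p" for p X Y
    using that by (simp add: bump_metric_def)
  have "smooth_tensor2 M A ?g"
    unfolding smooth_tensor2_def
  proof (intro conjI ballI allI impI)
    show "bilinear_form_on (tangent_space A p) (?g p)" if p: "p \<in> topspace M" for p
      unfolding bilinear_form_on_def
    proof (intro ballI allI)
      fix X Y Z :: "('m, 'e) tvec" and r
      assume XYZ: "X \<in> tangent_space A p" "Y \<in> tangent_space A p" "Z \<in> tangent_space A p"
      have "X + Y \<in> tangent_space A p" "r *\<^sub>R X \<in> tangent_space A p"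
        using subspace_add[OF subspace_tangent_space[OF p]] subspace_scale[OF subspace_tangent_space[OF p]] XYZ by auto
      then show "?g p (X + Y) Z = ?g p X Z + ?g p Y Z \<and> ?g p (r *\<^sub>R X) Z = r * ?g p X Z \<and>
          ?g p Z (X + Y) = ?g p Z X + ?g p Z Y \<and> ?g p Z (r *\<^sub>R X) = r * ?g p Z X"
        using p XYZ by (simp add: g plus_fun_def scaleR_fun_def inner_add_left inner_add_right
            distrib_left sum.distrib sum_distrib_left mult.left_commute)
    qed
    show "?g p X Y = 0" if "\<not> (p \<in> topspace M \<and> X \<in> tangent_space A p \<and> Y \<in> tangent_space A p)" for p X Y
      unfolding bump_metric_def using that by (rule if_not_P)
    fix c' u w assume c': "c' \<in> A"
    show "smooth_on (coords c') (\<lambda>x. local_rep A ?g c' x u w)"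
    proof (rule smooth_on_local)
      fix x assume "x \<in> coords c'"
      then obtain p where p: "p \<in> fst c'" "x = snd c' p" by auto
      obtain W n where W: "openin M W" "p \<in> W" "\<And>q k. q \<in> W \<Longrightarrow> k \<ge> n \<Longrightarrow> \<psi> k q = 0"
        using N[OF domain_topspace[OF c' p(1)]] by blast
      let ?V = "snd c' ` (fst c' \<inter> W)"
      have V: "open ?V" by (rule open_chart_image[OF c']) (auto intro: openin_Int open_domain c' W(1))
      let ?F = "\<lambda>k x. \<psi> k (chart_inv c' x) * (coord_vector A c' (chart_inv c' x) u (c k) \<bullet> coord_vector A c' (chart_inv c' x) w (c k))"
      have sF: "smooth_on ?V (?F k)" for k
        by (rule smooth_on_subset[OF smooth_bump_term[OF B c']]) auto
      have "smooth_on ?V (\<lambda>x. \<Sum>k<n. ?F k x)"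
        by (rule smooth_onI_param, rule param_C_k_sum[OF V], rule smooth_on_imp_param[OF sF])
      then have "smooth_on ?V (\<lambda>x. local_rep A ?g c' x u w)"
      proof (rule smooth_on_cong[OF V])
        fix y assume "y \<in> ?V"
        then obtain q where q: "q \<in> fst c'" "q \<in> W" "y = snd c' q" by auto
        have ca: "c' \<in> charts_at A q" using q c' by (simp add: charts_at_def)
        have "local_rep A ?g c' y u w = (\<Sum>k | \<psi> k q \<noteq> 0. ?F k y)"
          unfolding q(3) local_rep_at[OF c' q(1)]
            g[OF domain_topspace[OF c' q(1)] coord_vector_in_tangent_space[OF ca] coord_vector_in_tangent_space[OF ca]]
          by (simp add: chart_inv_left[OF c' q(1)])
        \<comment> \<open>The set of contributing indices varies with the point; near
          \<open>p\<close> it is replaced by a fixed finite range.\<close>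
        also have "\<dots> = (\<Sum>k<n. ?F k y)"
          by (rule sum.mono_neutral_left)
            (use W(3)[OF q(2)] in \<open>auto simp: q(3) chart_inv_left[OF c' q(1)] not_le[symmetric]\<close>)
        finally show "(\<Sum>k<n. ?F k y) = local_rep A ?g c' y u w" ..
      qed
      then show "\<exists>V. open V \<and> x \<in> V \<and> V \<subseteq> coords c' \<and> smooth_on V (\<lambda>x. local_rep A ?g c' x u w)"
        using V p W(2) by (intro exI[of _ ?V]) auto
    qed
  qed
  moreover have "?g p X Y = ?g p Y X" if "p \<in> topspace M" "X \<in> tangent_space A p" "Y \<in> tangent_space A p" for p X Y
    using that by (simp add: g inner_commute)
  moreover have "?g p X X > 0" if p: "p \<in> topspace M" and X: "X \<in> tangent_space A p" "X \<noteq> 0" for p X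
  proof -
    obtain k where k: "\<psi> k p > 0" using P[OF p] by blast
    then have "p \<in> fst (c k)" "c k \<in> A" using B[of k] unfolding bump_def by force+
    then interpret linear_transport UNIV "tangent_space A p" "coord_vector A (c k) p" "\<lambda>X. X (c k)"
      by (intro tangent_transport) (simp add: charts_at_def)
    have "X (c k) \<noteq> 0" using inv(2)[OF X(1)] X(2) linear_0[OF lin(1)] by auto
    then show ?thesis
      unfolding g[OF p X(1) X(1)] using B k
      by (intro sum_pos2[OF fin[OF p], of k]) (auto simp: bump_def)
  qed
  ultimately have "riemannian_metric M A ?g"
    unfolding riemannian_metric_def sym_tensors_def by blast
  then show ?thesis by blast
qed

end

subsection \<open>Smoothness of the retraction\<close>

text \<open>The operator of the Gram matrix, written as a combination of constant operators so that
  smoothness of the components \<open>b e' e\<close> carries over at once.\<close>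

definition form_op :: "('e::euclidean_space \<Rightarrow> 'e \<Rightarrow> real) \<Rightarrow> 'e \<Rightarrow>\<^sub>L 'e" where
  "form_op b = (\<Sum>e\<in>Basis. \<Sum>e'\<in>Basis. b e' e *\<^sub>R Blinfun (\<lambda>u. (u \<bullet> e') *\<^sub>R e))"

lemma form_op_inner:
  assumes b: "bilinear b" shows "form_op b u \<bullet> w = b u w"
proof -
  have B: "blinfun_apply (Blinfun (\<lambda>u. (u \<bullet> e') *\<^sub>R e)) u = (u \<bullet> e') *\<^sub>R e" for u e e' :: 'a
    by (subst bounded_linear_Blinfun_apply) (auto intro!: bounded_linear_intros)
  have "form_op b u \<bullet> w = (\<Sum>e\<in>Basis. \<Sum>e'\<in>Basis. (u \<bullet> e') * ((w \<bullet> e) * b e' e))"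
    unfolding form_op_def by (simp add: blinfun.sum_left blinfun.scaleR_left B inner_sum_right inner_commute[of _ w] mult_ac)
  also have "\<dots> = b (\<Sum>e'\<in>Basis. (u \<bullet> e') *\<^sub>R e') (\<Sum>e\<in>Basis. (w \<bullet> e) *\<^sub>R e)"
    by (simp only: bilinear_sum_left[OF b] bilinear_sum_right[OF b] bilinear_lmul[OF b] bilinear_rmul[OF b]
        real_scaleR_def sum_distrib_left) (simp only: mult.left_commute)
  finally show ?thesis by (simp only: euclidean_representation)
qed

lemma param_C_k_form_op:
  assumes "open U" "\<And>u w. param_C_k k T U (\<lambda>t x. b t x u w)"
  shows "param_C_k k T U (\<lambda>t x. form_op (b t x))"
  unfolding form_op_def by (intro param_C_k_sum param_C_k_scaleR param_C_k_const assms)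

lemma orthogonal_projection_blinfun:
  fixes F :: "'e::euclidean_space set"
  assumes "subspace F"
  obtains P :: "'e \<Rightarrow>\<^sub>L 'e" where "\<And>u. P u \<in> F" "\<And>u. u \<in> F \<Longrightarrow> P u = u" "\<And>u w. P u \<bullet> w = u \<bullet> P w"
proof -
  interpret i: inner_product_form "(\<bullet>) :: 'e \<Rightarrow> 'e \<Rightarrow> real" by (rule inner_product_form_inner)
  have "i.orthonormal_family {} (\<lambda>x. x)" by (simp add: i.orthonormal_family_def)
  then obtain B where B: "finite B" "i.orthonormal_family B (\<lambda>x. x)" "span B = F"
    by (rule i.orthonormal_extension[OF assms finite.emptyI empty_subsetI])
  have ap: "blinfun_apply (Blinfun (\<lambda>u. \<Sum>b\<in>B. (u \<bullet> b) *\<^sub>R b)) u = (\<Sum>b\<in>B. (u \<bullet> b) *\<^sub>R b)" for u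
    by (subst bounded_linear_Blinfun_apply) (auto intro!: bounded_linear_sum bounded_linear_intros)
  show ?thesis
  proof (rule that[of "Blinfun (\<lambda>u. \<Sum>b\<in>B. (u \<bullet> b) *\<^sub>R b)"])
    show "Blinfun (\<lambda>u. \<Sum>b\<in>B. (u \<bullet> b) *\<^sub>R b) u \<in> F" for u
      unfolding ap B(3)[symmetric] by (intro span_sum span_scale span_base)
    show "Blinfun (\<lambda>u. \<Sum>b\<in>B. (u \<bullet> b) *\<^sub>R b) u = u" if "u \<in> F" for u
      unfolding ap using i.orthonormal_family_expansion[OF B(1,2), of u] that B(3) by simp
    show "Blinfun (\<lambda>u. \<Sum>b\<in>B. (u \<bullet> b) *\<^sub>R b) u \<bullet> w = u \<bullet> Blinfun (\<lambda>u. \<Sum>b\<in>B. (u \<bullet> b) *\<^sub>R b) w" for u w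
      unfolding ap by (simp add: inner_sum_left inner_sum_right inner_commute mult_ac)
  qed
qed

text \<open>The pointwise data behind \<open>h\<close> are rewritten as operators obtained from the
  Gram operators of \<open>g\<close> and \<omega> by composition, inversion and a square root. The
  constancy of \<open>F\<close> enters through its Euclidean projection, which depends neither on
  the parameter nor on the point.\<close>

lemma retract_param_C_k:
  fixes g h :: "'t \<Rightarrow> 'e::euclidean_space \<Rightarrow> 'e \<Rightarrow> 'e \<Rightarrow> real" and \<omega> :: "nat \<Rightarrow> 'e \<Rightarrow> 'e \<Rightarrow> 'e \<Rightarrow> real"
  assumes U: "open U" and F: "subspace F"
    and g: "\<And>t x. t \<in> topspace T \<Longrightarrow> x \<in> U \<Longrightarrow> inner_product_form (g t x)"
    and poly: "\<And>x. x \<in> U \<Longrightarrow> polysymplectic_structure UNIV n s (\<lambda>j. \<omega> j x)"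
    and ker: "\<And>x. x \<in> U \<Longrightarrow> kernel_sum s UNIV (\<lambda>j. \<omega> j x) = F"
    and rel: "\<And>t x. t \<in> topspace T \<Longrightarrow> x \<in> U \<Longrightarrow> retract_rel UNIV s (\<lambda>j. \<omega> j x) (g t x) (h t x)"
    and sg: "\<And>k u w. param_C_k k T U (\<lambda>t x. g t x u w)"
    and so: "\<And>k j u w. j \<in> {1..s} \<Longrightarrow> param_C_k k T U (\<lambda>t x. \<omega> j x u w)"
  shows "param_C_k k T U (\<lambda>t x. h t x u w)"
proof -
  note bl = blinfun.bilinear_simps
  have frame: "\<exists>f \<xi>. polysymplectic_frame n s (\<lambda>j. \<omega> j x) f \<xi>" if x: "x \<in> U" for x
  proof -
    obtain v w where "standard_polysymplectic_basis UNIV n s (\<lambda>j. \<omega> j x) v w"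
      using poly[OF x] unfolding polysymplectic_structure_def by blast
    then show ?thesis using polysymplectic_frame_of_basis by blast
  qed
  have bo: "bilinear (\<omega> j x)" if "j \<in> {1..s}" "x \<in> U" for j x
    using frame[OF that(2)] frame_form_bilinear[OF _ that(1)] by blast
  define G where "G t x = form_op (g t x)" for t x
  define W where "W j x = form_op (\<omega> j x)" for j x
  have Gin: "G t x u \<bullet> w = g t x u w" if "t \<in> topspace T" "x \<in> U" for t x u w
    unfolding G_def by (rule form_op_inner[OF symmetric_form.bil[OF inner_product_form.axioms(1)[OF g[OF that]]]])
  have Win: "W j x u \<bullet> w = \<omega> j x u w" if "j \<in> {1..s}" "x \<in> U" for j x u w
    unfolding W_def by (rule form_op_inner[OF bo[OF that]])
  have Gpos: "G t x u \<bullet> u > 0" if "t \<in> topspace T" "x \<in> U" "u \<noteq> 0" for t x u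
    using inner_product_form.pos[OF g[OF that(1,2)] that(3)] by (simp add: Gin[OF that(1,2)])
  have sG: "param_C_k k T U G" for k unfolding G_def by (rule param_C_k_form_op[OF U sg])
  have sW: "param_C_k k T U (\<lambda>_. W j)" if "j \<in> {1..s}" for j k
    unfolding W_def by (rule param_C_k_form_op[OF U so[OF that]])
  \<comment> \<open>A pointwise choice is harmless, since an inverse is unique and the rule for
    inverses asks for nothing else.\<close>
  define Gi where "Gi t x = (SOME J. G t x o\<^sub>L J = id_blinfun \<and> J o\<^sub>L G t x = id_blinfun)" for t x
  have Gi: "G t x o\<^sub>L Gi t x = id_blinfun" "Gi t x o\<^sub>L G t x = id_blinfun" if "t \<in> topspace T" "x \<in> U" for t x
    using someI_ex[OF positive_definite_invertible[OF Gpos[OF that]]] unfolding Gi_def by auto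
  have sGi: "param_C_k k T U Gi" for k by (rule param_C_k_inverse[OF U sG Gi])
  define A where "A j t x = Gi t x o\<^sub>L W j x" for j t x
  have sA: "param_C_k k T U (A j)" if "j \<in> {1..s}" for j k
    unfolding A_def by (intro param_C_k_compose U sGi sW[OF that])
  have gA: "g t x (A j t x u) w = \<omega> j x u w" if "t \<in> topspace T" "x \<in> U" "j \<in> {1..s}" for t x j u w
    using arg_cong[OF Gi(1)[OF that(1,2)], of "\<lambda>f. blinfun_apply f (W j x u)"]
    by (simp add: Gin[OF that(1,2), symmetric] A_def Win[OF that(3,2)])
  show ?thesis
  proof (cases "s = 1")
    case True
    have one: "1 \<in> {1..s}" using True by simp
    define ok where "ok t x S \<longleftrightarrow> polar_rel UNIV (\<omega> 1 x) (g t x) (blinfun_apply S) \<and>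
      (\<forall>u w. h t x u w = g t x (S u) w)" for t x S
    have ex: "\<exists>S. ok t x S" if tx: "t \<in> topspace T" "x \<in> U" for t x
    proof -
      obtain S where S: "polar_rel UNIV (\<omega> 1 x) (g t x) S" "\<forall>X Y. h t x X Y = g t x (S X) Y"
        using rel[OF tx] True unfolding retract_rel_def by auto
      have "bounded_linear S"
        using inner_product_form.polar_linear[OF g[OF tx] S(1)] by (simp add: linear_conv_bounded_linear)
      then have "blinfun_apply (Blinfun S) = S" by (rule bounded_linear_Blinfun_apply)
      then show ?thesis using S unfolding ok_def by (intro exI[of _ "Blinfun S"]) simp
    qed
    define S where "S t x = (SOME S. ok t x S)" for t x
    have S: "polar_rel UNIV (\<omega> 1 x) (g t x) (blinfun_apply (S t x))" "\<And>u w. h t x u w = g t x (S t x u) w"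
      if "t \<in> topspace T" "x \<in> U" for t x
    proof -
      have "ok t x (S t x)" unfolding S_def by (rule someI_ex[OF ex[OF that]])
      then show "polar_rel UNIV (\<omega> 1 x) (g t x) (blinfun_apply (S t x))" "\<And>u w. h t x u w = g t x (S t x u) w"
        unfolding ok_def by blast+
    qed
    \<comment> \<open>The root is symmetric and nonnegative for \<open>g t x\<close>, not for the
      Euclidean product; this is why the rule for roots carries the auxiliary family
      \<open>G\<close>.\<close>
    have "param_C_k k T U S"
    proof (rule param_C_k_sqrt[OF U _ sG Gpos, where P="\<lambda>t x. - (A 1 t x o\<^sub>L A 1 t x)"])
      show "param_C_k k T U (\<lambda>t x. - (A 1 t x o\<^sub>L A 1 t x))"
        by (intro param_C_k_minus param_C_k_compose U sA[OF one])
    next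
      fix t x assume tx: "t \<in> topspace T" "x \<in> U"
      interpret ip: inner_product_form "g t x" by (rule g[OF tx])
      obtain A' where "\<forall>X\<in>UNIV. \<forall>Y\<in>UNIV. g t x (A' X) Y = \<omega> 1 x X Y \<and> g t x (S t x X) Y = g t x X (S t x Y)"
        "\<forall>X\<in>UNIV. g t x (S t x X) X \<ge> 0 \<and> S t x (S t x X) = - A' (A' X)"
        using S(1)[OF tx] unfolding polar_rel_def by blast
      then have A': "\<And>X Y. g t x (A' X) Y = \<omega> 1 x X Y" "\<And>X. g t x (S t x X) X \<ge> 0"
        "\<And>X. S t x (S t x X) = - A' (A' X)" "\<And>X Y. g t x (S t x X) Y = g t x X (S t x Y)"
        by blast+
      show "0 \<le> G t x (S t x u) \<bullet> u" for u using A'(2) by (simp add: Gin[OF tx])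
      have "A' X = A 1 t x X" for X by (rule ip.eqI) (simp only: A' gA[OF tx one])
      then show "S t x o\<^sub>L S t x = - (A 1 t x o\<^sub>L A 1 t x)"
        by (intro blinfun_eqI) (simp add: A'(3) bl)
      obtain f \<xi> where fr: "polysymplectic_frame n s (\<lambda>j. \<omega> j x) f \<xi>" using frame[OF tx(2)] by blast
      have alt: "\<omega> 1 x X X = 0" for X using frame_form_skew[OF fr one, of X X] by simp
      have nd: "\<forall>X. (\<forall>Y. \<omega> 1 x X Y = 0) \<longrightarrow> X = 0"
        using frame_nondegenerate[of n "\<lambda>j. \<omega> j x" f \<xi>] fr True by blast
      obtain k \<mu> v w where sf: "ip.skew_frame (\<omega> 1 x) k \<mu> v w"
        and exp: "\<forall>X. X = (\<Sum>i<k. g t x X (v i) *\<^sub>R v i + g t x X (w i) *\<^sub>R w i)"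
        and eig: "\<forall>S'. polar_rel UNIV (\<omega> 1 x) (g t x) S' \<longrightarrow> (\<forall>i<k. S' (v i) = \<mu> i *\<^sub>R v i \<and> S' (w i) = \<mu> i *\<^sub>R w i)"
        using ip.polar_normal_form[OF bo[OF one tx(2)] alt nd] by blast
      have e: "S t x (v i) = \<mu> i *\<^sub>R v i" "S t x (w i) = \<mu> i *\<^sub>R w i" if "i < k" for i
        using eig S(1)[OF tx] that by blast+
      \<comment> \<open>The \<open>g t x\<close>-orthogonal projection onto a block, on which the
        root is a multiple of the identity. Different blocks may share an eigenvalue.\<close>
      define \<pi> where "\<pi> i = Blinfun (\<lambda>u. g t x u (v i) *\<^sub>R v i + g t x u (w i) *\<^sub>R w i)" for i
      have pi: "\<pi> i u = g t x u (v i) *\<^sub>R v i + g t x u (w i) *\<^sub>R w i" for i u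
      proof -
        have "linear (\<lambda>u. g t x u (v i) *\<^sub>R v i + g t x u (w i) *\<^sub>R w i)"
          by (rule linearI) (simp_all add: ip.g_simps algebra_simps)
        then show ?thesis unfolding \<pi>_def by (simp add: bounded_linear_Blinfun_apply linear_conv_bounded_linear)
      qed
      have "(\<Sum>i<k. \<pi> i) = id_blinfun"
        by (rule blinfun_eqI) (simp add: blinfun.sum_left pi exp[rule_format, symmetric])
      moreover have "S t x o\<^sub>L \<pi> i = \<mu> i *\<^sub>R \<pi> i" if "i < k" for i
        by (rule blinfun_eqI) (simp add: pi bl e[OF that] scaleR_add_right mult.commute)
      moreover have "\<pi> i o\<^sub>L S t x = \<mu> i *\<^sub>R \<pi> i" if "i < k" for i
        by (rule blinfun_eqI) (simp add: pi bl A'(4) e[OF that] scaleR_add_right ip.g_simps)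
      moreover have "\<mu> i > 0" if "i < k" for i using sf that unfolding ip.skew_frame_def by blast
      ultimately show "\<exists>I \<mu> \<pi>. finite (I :: nat set) \<and> (\<forall>i\<in>I. \<mu> i > 0 \<and> S t x o\<^sub>L \<pi> i = \<mu> i *\<^sub>R \<pi> i \<and>
          \<pi> i o\<^sub>L S t x = \<mu> i *\<^sub>R \<pi> i) \<and> (\<Sum>i\<in>I. \<pi> i) = id_blinfun"
        by (intro exI[of _ "{..<k}"] exI[of _ \<mu>] exI[of _ \<pi>]) auto
    qed
    then have "param_C_k k T U (\<lambda>t x. G t x (S t x u) \<bullet> w)"
      by (intro param_C_k_inner param_C_k_apply param_C_k_const U sG)
    then show ?thesis
      by (rule param_C_k_cong[OF U, rotated]) (simp add: Gin S(2))
  next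
    case False
    obtain P :: "'e \<Rightarrow>\<^sub>L 'e" where P: "\<And>u. P u \<in> F" "\<And>u. u \<in> F \<Longrightarrow> P u = u" "\<And>u w. P u \<bullet> w = u \<bullet> P w"
      by (rule orthogonal_projection_blinfun[OF F]) (rule that)
    have PP: "P (P u) = P u" for u by (rule P(2)[OF P(1)])
    \<comment> \<open>The compression of \<open>G t x\<close> to \<open>F\<close>, completed by the
      identity on the Euclidean complement. It is positive definite on the whole space, so that the
      rule for inverses applies.\<close>
    define N where "N t x = (P o\<^sub>L (G t x o\<^sub>L P)) + (id_blinfun - P)" for t x
    have Napp: "N t x u = P (G t x (P u)) + (u - P u)" for t x u by (simp add: N_def bl)
    have Npos: "N t x u \<bullet> u > 0" if "t \<in> topspace T" "x \<in> U" "u \<noteq> 0" for t x u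
    proof -
      have "(u - P u) \<bullet> u = (u - P u) \<bullet> (u - P u)"
        using P(3)[of "u - P u" u] PP[of u] by (simp add: inner_diff_right bl inner_commute)
      then have *: "N t x u \<bullet> u = G t x (P u) \<bullet> P u + (u - P u) \<bullet> (u - P u)"
        by (simp add: Napp inner_add_left P(3))
      show ?thesis
      proof (cases "P u = 0")
        case True
        then show ?thesis unfolding * using that(3) by (simp add: bl)
      next
        case False
        then show ?thesis unfolding * using Gpos[OF that(1,2) False] by (intro add_pos_nonneg) auto
      qed
    qed
    define Ni where "Ni t x = (SOME J. N t x o\<^sub>L J = id_blinfun \<and> J o\<^sub>L N t x = id_blinfun)" for t x
    have Ni: "N t x o\<^sub>L Ni t x = id_blinfun" "Ni t x o\<^sub>L N t x = id_blinfun" if "t \<in> topspace T" "x \<in> U" for t x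
      using someI_ex[OF positive_definite_invertible[OF Npos[OF that]]] unfolding Ni_def by auto
    have sN: "param_C_k k T U N" for k
      unfolding N_def by (intro param_C_k_add param_C_k_compose param_C_k_const U sG)
    have sNi: "param_C_k k T U Ni" for k by (rule param_C_k_inverse[OF U sN Ni])
    \<comment> \<open>The subtracted operator is the \<open>g t x\<close>-orthogonal projection onto
      \<open>F\<close>: its value \<open>E u\<close> is the element of \<open>F\<close> with the
      same products as \<open>u\<close> against \<open>F\<close>, which is the equation
      \<open>P (G (E u)) = P (G u)\<close>.\<close>
    define Q where "Q t x = id_blinfun - (Ni t x o\<^sub>L (P o\<^sub>L G t x))" for t x
    have sQ: "param_C_k k T U Q" for k
      unfolding Q_def by (intro param_C_k_diff param_C_k_compose param_C_k_const U sNi sG)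
    have hQ: "h t x = split_form s (g t x) (Q t x) (\<lambda>j. A j t x)" if tx: "t \<in> topspace T" "x \<in> U" for t x
    proof -
      interpret ip: inner_product_form "g t x" by (rule g[OF tx])
      have Ni1: "N t x (Ni t x u) = u" and Ni2: "Ni t x (N t x u) = u" for u
        using arg_cong[OF Ni(1)[OF tx], of "\<lambda>f. blinfun_apply f u"] arg_cong[OF Ni(2)[OF tx], of "\<lambda>f. blinfun_apply f u"]
        by simp_all
      have NP: "N t x (P u) = P (N t x u)" for u by (simp add: Napp PP bl)
      have PNi: "P (Ni t x u) = Ni t x (P u)" for u
        using Ni2[of "P (Ni t x u)"] by (simp add: NP Ni1)
      define E where "E u = Ni t x (P (G t x u))" for u
      have Qu: "Q t x u = u - E u" for u by (simp add: Q_def E_def bl)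
      have PE: "P (E u) = E u" for u by (simp add: E_def PNi PP)
      have EF: "E u \<in> F" for u using P(1)[of "E u"] by (simp add: PE)
      have PGE: "P (G t x (E u)) = P (G t x u)" for u
      proof -
        have "P (G t x (E u)) = N t x (E u)" by (simp add: Napp PE)
        then show ?thesis by (simp add: E_def Ni1)
      qed
      have orth: "g t x (Q t x u) y = 0" if "y \<in> F" for u y
      proof -
        have "g t x (Q t x u) y = G t x (Q t x u) \<bullet> P y" using that by (simp add: Gin[OF tx] P(2))
        also have "\<dots> = P (G t x (Q t x u)) \<bullet> y" by (simp add: P(3))
        also have "\<dots> = 0" by (simp add: Qu bl PGE)
        finally show ?thesis .
      qed
      have "split_rel UNIV s (\<lambda>j. \<omega> j x) (g t x) (Q t x) (\<lambda>j. A j t x)"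
        unfolding split_rel_def ker[OF tx(2)] using gA[OF tx] orth EF by (simp add: Qu)
      \<comment> \<open>\<open>h\<close> is only known through the relation; uniqueness identifies
        it with the explicit formula.\<close>
      then have "retract_rel UNIV s (\<lambda>j. \<omega> j x) (g t x) (split_form s (g t x) (Q t x) (\<lambda>j. A j t x))"
        unfolding retract_rel_def using False by auto
      from ip.retract_unique[OF poly[OF tx(2)] rel[OF tx] this] show ?thesis .
    qed
    have "param_C_k k T U (\<lambda>t x. G t x (Q t x u) \<bullet> Q t x w +
       (\<Sum>j\<in>{1..s}. G t x (Q t x (A j t x (u - (1/2) *\<^sub>R Q t x u))) \<bullet> Q t x (A j t x (w - (1/2) *\<^sub>R Q t x w))))"
      by (intro param_C_k_add param_C_k_sum param_C_k_inner param_C_k_apply param_C_k_diff param_C_k_scaleR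
          param_C_k_const U sG sQ sA)
    then show ?thesis
      by (rule param_C_k_cong[OF U, rotated]) (simp add: hQ split_form_def Gin)
  qed
qed

subsection \<open>Polysymplectic manifolds\<close>

lemma smooth_tensor2D:
  assumes "smooth_tensor2 M A T"
  shows "p \<in> topspace M \<Longrightarrow> bilinear_form_on (tangent_space A p) (T p)"
    and "\<not> (p \<in> topspace M \<and> X \<in> tangent_space A p \<and> Y \<in> tangent_space A p) \<Longrightarrow> T p X Y = 0"
    and "c \<in> A \<Longrightarrow> smooth_on (snd c ` fst c) (\<lambda>x. local_rep A T c x u w)"
  using assms unfolding smooth_tensor2_def by blast+

lemma riemannian_metricD:
  assumes "riemannian_metric M A g"
  shows "g \<in> sym_tensors M A" "smooth_tensor2 M A g"
    and "p \<in> topspace M \<Longrightarrow> X \<in> tangent_space A p \<Longrightarrow> Y \<in> tangent_space A p \<Longrightarrow> g p X Y = g p Y X"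
    and "p \<in> topspace M \<Longrightarrow> X \<in> tangent_space A p \<Longrightarrow> X \<noteq> 0 \<Longrightarrow> g p X X > 0"
proof -
  show g: "g \<in> sym_tensors M A" using assms unfolding riemannian_metric_def by blast
  then show "smooth_tensor2 M A g" unfolding sym_tensors_def by blast
  show "p \<in> topspace M \<Longrightarrow> X \<in> tangent_space A p \<Longrightarrow> Y \<in> tangent_space A p \<Longrightarrow> g p X Y = g p Y X"
    using g unfolding sym_tensors_def by blast
  show "p \<in> topspace M \<Longrightarrow> X \<in> tangent_space A p \<Longrightarrow> X \<noteq> 0 \<Longrightarrow> g p X X > 0"
    using assms unfolding riemannian_metric_def by blast
qed

locale polysymplectic = manifold M A
  for M :: "'m topology" and A :: "('m, 'e::euclidean_space) chart set" +
  fixes n s :: nat and \<omega> :: "nat \<Rightarrow> ('m, 'e) tensor2"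
  assumes poly: "polysymplectic_manifold M A n s \<omega>"
begin

lemma dim: "DIM('e) = n * (s + 1)"
  using poly unfolding polysymplectic_manifold_def by blast

lemma omega_tensor: "j \<in> {1..s} \<Longrightarrow> smooth_tensor2 M A (\<omega> j)"
  using poly unfolding polysymplectic_manifold_def smooth_2form_def by blast

text \<open>The relation determines the chosen form on the tangent space only. The value zero
  elsewhere restores the normalization of tensor fields, so that fixed points are equal as
  functions.\<close>

definition retraction :: "('m, 'e) tensor2 \<Rightarrow> ('m, 'e) tensor2" where
  "retraction g p X Y = (if p \<in> topspace M \<and> X \<in> tangent_space A p \<and> Y \<in> tangent_space A p
     then (SOME h. retract_rel (tangent_space A p) s (\<lambda>j. \<omega> j p) (g p) h) X Y else 0)"

lemma local_rep_fun: "c \<in> A \<Longrightarrow> p \<in> fst c \<Longrightarrow>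
    local_rep A T c (snd c p) = (\<lambda>u w. T p (coord_vector A c p u) (coord_vector A c p w))"
  by (intro ext) (rule local_rep_at)

lemma local_polysymplectic:
  assumes "c \<in> A" "p \<in> fst c"
  shows "polysymplectic_structure UNIV n s (\<lambda>j. local_rep A (\<omega> j) c (snd c p))"
proof -
  have "c \<in> charts_at A p" using assms by (simp add: charts_at_def)
  then interpret t: linear_transport "tangent_space A p" UNIV "\<lambda>X. X c" "coord_vector A c p"
    by (rule linear_transport.swap[OF tangent_transport])
  have "polysymplectic_structure (tangent_space A p) n s (\<lambda>j. \<omega> j p)"
    using poly domain_topspace[OF assms] unfolding polysymplectic_manifold_def by blast
  then obtain v w where "standard_polysymplectic_basis (tangent_space A p) n s (\<lambda>j. \<omega> j p) v w"
    unfolding polysymplectic_structure_def by blast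
  from t.standard_basis_transport[OF this] show ?thesis
    unfolding polysymplectic_structure_def local_rep_fun[OF assms] by blast
qed

lemma local_inner_product:
  assumes "riemannian_metric M A g" "c \<in> A" "p \<in> fst c"
  shows "inner_product_form (local_rep A g c (snd c p))"
proof -
  have p: "p \<in> topspace M" by (rule domain_topspace[OF assms(2,3)])
  have "c \<in> charts_at A p" using assms by (simp add: charts_at_def)
  then interpret t: linear_transport UNIV "tangent_space A p" "coord_vector A c p" "\<lambda>X. X c"
    by (rule tangent_transport)
  note bil = smooth_tensor2D(1)[OF riemannian_metricD(2)[OF assms(1)] p]
    and sym = riemannian_metricD(3)[OF assms(1) p] and pos = riemannian_metricD(4)[OF assms(1) p]
  show ?thesis
  proof
    show "bilinear (local_rep A g c (snd c p))" by (rule bilinear_local_rep[where T=g, OF bil assms(2,3)])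
    show "local_rep A g c (snd c p) X Y = local_rep A g c (snd c p) Y X" for X Y
      unfolding local_rep_fun[OF assms(2,3)] by (rule sym[OF t.maps(1)[OF UNIV_I] t.maps(1)[OF UNIV_I]])
    show "0 < local_rep A g c (snd c p) X X" if "X \<noteq> 0" for X
    proof -
      have "coord_vector A c p X \<noteq> 0"
        using t.inv(1)[OF UNIV_I, of X] that linear_0[OF t.lin(2)] by metis
      then show ?thesis unfolding local_rep_fun[OF assms(2,3)] by (rule pos[OF t.maps(1)[OF UNIV_I]])
    qed
  qed
qed

text \<open>Existence is carried from coordinates to the tangent space, which justifies the choice
  made there. The chosen form is carried back, where uniqueness identifies it with the form
  constructed in coordinates, including its definiteness and compatibility.\<close>

lemma retraction_local:
  assumes g: "riemannian_metric M A g" and c: "c \<in> A" "p \<in> fst c"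
  shows "retract_rel UNIV s (\<lambda>j. local_rep A (\<omega> j) c (snd c p)) (local_rep A g c (snd c p)) (local_rep A (retraction g) c (snd c p))"
    and "inner_product_form (local_rep A (retraction g) c (snd c p))"
    and "compatible_form UNIV n s (\<lambda>j. local_rep A (\<omega> j) c (snd c p)) (local_rep A (retraction g) c (snd c p))"
proof -
  have p: "p \<in> topspace M" by (rule domain_topspace[OF c])
  have "c \<in> charts_at A p" using c by (simp add: charts_at_def)
  then interpret t: linear_transport UNIV "tangent_space A p" "coord_vector A c p" "\<lambda>X. X c"
    by (rule tangent_transport)
  interpret t': linear_transport "tangent_space A p" UNIV "\<lambda>X. X c" "coord_vector A c p"
    by (rule t.swap)
  let ?V = "tangent_space A p" and ?\<omega> = "\<lambda>j. local_rep A (\<omega> j) c (snd c p)" and ?g = "local_rep A g c (snd c p)"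
  interpret ip: inner_product_form ?g by (rule local_inner_product[OF g c])
  note poly' = local_polysymplectic[OF c]
  obtain h where h: "retract_rel UNIV s ?\<omega> ?g h" "inner_product_form h" "compatible_form UNIV n s ?\<omega> h"
    using ip.retract_exists[OF poly' dim] by blast
  have inv: "\<And>X. X \<in> ?V \<Longrightarrow> coord_vector A c p (X c) = X" by (rule t.inv)
  have "retract_rel ?V s (\<lambda>j. \<omega> j p) (g p) (\<lambda>X Y. h (X c) (Y c))"
    by (rule retract_rel_cong[OF t.sub(2) _ _ refl t.retract_rel_transport[OF h(1)]])
      (simp_all add: local_rep_fun[OF c] inv)
  then have some: "retract_rel ?V s (\<lambda>j. \<omega> j p) (g p) (SOME h. retract_rel ?V s (\<lambda>j. \<omega> j p) (g p) h)"
    by (rule someI[of "\<lambda>h. retract_rel ?V s (\<lambda>j. \<omega> j p) (g p) h"])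
  have "retract_rel ?V s (\<lambda>j. \<omega> j p) (g p) (retraction g p)"
    by (rule retract_rel_cong[OF t.sub(2) refl refl _ some]) (simp add: retraction_def p)
  from t'.retract_rel_transport[OF this]
  show 1: "retract_rel UNIV s ?\<omega> ?g (local_rep A (retraction g) c (snd c p))"
    unfolding local_rep_fun[OF c] .
  have "local_rep A (retraction g) c (snd c p) = h" by (rule ip.retract_unique[OF poly' 1 h(1)])
  then show "inner_product_form (local_rep A (retraction g) c (snd c p))"
    "compatible_form UNIV n s ?\<omega> (local_rep A (retraction g) c (snd c p))"
    using h by simp_all
qed

lemma retraction_coords:
  assumes "c \<in> charts_at A p" "X \<in> tangent_space A p" "Y \<in> tangent_space A p"
  shows "T p X Y = local_rep A T c (snd c p) (X c) (Y c)"
  using linear_transport.inv(2)[OF tangent_transport[OF assms(1)]] assms charts_atD[OF assms(1)]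
  by (simp add: local_rep_at)

text \<open>In a chart adapted to the integrable distribution the kernel sum is the same subspace of
  the model space at all points.\<close>

lemma kernel_sum_local:
  assumes c: "c \<in> A" and F: "subspace F"
    and D: "\<And>q. q \<in> fst c \<Longrightarrow> span (\<Union>j\<in>{1..s}. perp A (\<omega> j) q) = {X \<in> tangent_space A q. X c \<in> F}"
    and q: "q \<in> fst c"
  shows "kernel_sum s UNIV (\<lambda>j. local_rep A (\<omega> j) c (snd c q)) = F"
proof -
  have cq: "c \<in> charts_at A q" using c q by (simp add: charts_at_def)
  interpret t: linear_transport UNIV "tangent_space A q" "coord_vector A c q" "\<lambda>X. X c"
    by (rule tangent_transport[OF cq])
  interpret t': linear_transport "tangent_space A q" UNIV "\<lambda>X. X c" "coord_vector A c q"
    by (rule t.swap)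
  have "kernel_sum s UNIV (\<lambda>j. local_rep A (\<omega> j) c (snd c q)) = (\<lambda>X. X c) ` kernel_sum s (tangent_space A q) (\<lambda>j. \<omega> j q)"
    unfolding local_rep_fun[OF c q] by (rule t'.kernel_sum_image)
  also have "kernel_sum s (tangent_space A q) (\<lambda>j. \<omega> j q) = {X \<in> tangent_space A q. X c \<in> F}"
    unfolding D[OF q, symmetric] kernel_sum_def perp_def ..
  also have "(\<lambda>X. X c) ` {X \<in> tangent_space A q. X c \<in> F} = F"
  proof (intro equalityI subsetI)
    fix u assume "u \<in> F"
    then show "u \<in> (\<lambda>X. X c) ` {X \<in> tangent_space A q. X c \<in> F}"
      using t.inv(1)[OF UNIV_I, of u] t.maps(1)[OF UNIV_I, of u] by (intro image_eqI[of _ _ "coord_vector A c q u"]) auto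
  qed auto
  finally show ?thesis .
qed

lemma retraction_bilinear:
  assumes g: "riemannian_metric M A g" and p: "p \<in> topspace M"
  shows "bilinear_form_on (tangent_space A p) (retraction g p)"
proof -
  obtain c where c: "c \<in> charts_at A p" using chart_cover[OF p] by blast
  note cA = charts_atD[OF c]
  interpret t: linear_transport UNIV "tangent_space A p" "coord_vector A c p" "\<lambda>X. X c"
    by (rule tangent_transport[OF c])
  interpret ip: inner_product_form "local_rep A (retraction g) c (snd c p)"
    using retraction_local(2)[OF g] cA by blast
  note coords = retraction_coords[OF c]
  show ?thesis
    unfolding bilinear_form_on_def
    using subspace_add[OF t.sub(2)] subspace_scale[OF t.sub(2)]
    by (auto simp: coords ip.g_simps linear_add[OF t.lin(2)] linear_scale[OF t.lin(2)])
qed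

text \<open>The common source of smoothness of a single image and of continuity of the homotopy. The
  argument runs in adapted charts, and the result spreads to all charts.\<close>

lemma retraction_param:
  assumes G: "\<And>t. t \<in> topspace T \<Longrightarrow> riemannian_metric M A (\<G> t)"
    and sm: "\<And>c u w k. c \<in> A \<Longrightarrow> param_C_k k T (coords c) (\<lambda>t x. local_rep A (\<G> t) c x u w)"
    and c': "c' \<in> A"
  shows "param_C_k k T (coords c') (\<lambda>t x. local_rep A (retraction (\<G> t)) c' x u w)"
proof (rule param_smooth_charts[where \<T>="\<lambda>t. retraction (\<G> t)", OF _ _ c'])
  show "bilinear_form_on (tangent_space A p) (retraction (\<G> t) p)" if "t \<in> topspace T" "p \<in> topspace M" for t p
    by (rule retraction_bilinear[OF G[OF that(1)] that(2)])
  fix p assume "p \<in> topspace M"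
  then obtain c F where c: "c \<in> charts_at A p" and F: "subspace F"
    and D: "\<And>q. q \<in> fst c \<Longrightarrow> span (\<Union>j\<in>{1..s}. perp A (\<omega> j) q) = {X \<in> tangent_space A q. X c \<in> F}"
    using poly unfolding polysymplectic_manifold_def integrable_distribution_def by meson
  have cA: "c \<in> A" using charts_atD[OF c] by simp
  show "\<exists>c\<in>charts_at A p. \<forall>k u w. param_C_k k T (coords c) (\<lambda>t x. local_rep A (retraction (\<G> t)) c x u w)"
  proof (intro bexI[OF _ c] allI)
    fix k u w
    show "param_C_k k T (coords c) (\<lambda>t x. local_rep A (retraction (\<G> t)) c x u w)"
    proof (rule retract_param_C_k[where g="\<lambda>t x. local_rep A (\<G> t) c x" and h="\<lambda>t x. local_rep A (retraction (\<G> t)) c x"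
          and \<omega>="\<lambda>j x. local_rep A (\<omega> j) c x" and n=n and s=s, OF open_coords[OF cA] F])
      show "param_C_k k T (coords c) (\<lambda>t x. local_rep A (\<G> t) c x u w)" for k u w by (rule sm[OF cA])
      show "param_C_k k T (coords c) (\<lambda>t x. local_rep A (\<omega> j) c x u w)" if "j \<in> {1..s}" for k j u w
        by (rule smooth_on_imp_param) (rule smooth_tensor2D(3)[OF omega_tensor[OF that] cA])
      fix x assume "x \<in> coords c"
      then obtain q where q: "q \<in> fst c" "x = snd c q" by auto
      show "polysymplectic_structure UNIV n s (\<lambda>j. local_rep A (\<omega> j) c x)"
        unfolding q(2) by (rule local_polysymplectic[OF cA q(1)])
      show "kernel_sum s UNIV (\<lambda>j. local_rep A (\<omega> j) c x) = F"
        unfolding q(2) by (rule kernel_sum_local[OF cA F D q(1)])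
      fix t assume t: "t \<in> topspace T"
      show "inner_product_form (local_rep A (\<G> t) c x)"
        unfolding q(2) by (rule local_inner_product[OF G[OF t] cA q(1)])
      show "retract_rel UNIV s (\<lambda>j. local_rep A (\<omega> j) c x) (local_rep A (\<G> t) c x) (local_rep A (retraction (\<G> t)) c x)"
        unfolding q(2) by (rule retraction_local(1)[OF G[OF t] cA q(1)])
    qed
  qed
qed

lemma compatible_metrics_iff:
  "g \<in> compatible_metrics M A n s \<omega> \<longleftrightarrow> riemannian_metric M A g \<and>
    (\<forall>p\<in>topspace M. compatible_form (tangent_space A p) n s (\<lambda>j. \<omega> j p) (g p))"
  unfolding compatible_metrics_def compatible_form_def by blast

lemma retraction_compatible:
  assumes g: "riemannian_metric M A g"
  shows "retraction g \<in> compatible_metrics M A n s \<omega>"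
proof -
  have pt: "retraction g p X Y = retraction g p Y X" "X \<noteq> 0 \<Longrightarrow> retraction g p X X > 0"
    if p: "p \<in> topspace M" and XY: "X \<in> tangent_space A p" "Y \<in> tangent_space A p" for p X Y
  proof -
    obtain c where c: "c \<in> charts_at A p" using chart_cover[OF p] by blast
    interpret t: linear_transport UNIV "tangent_space A p" "coord_vector A c p" "\<lambda>X. X c"
      by (rule tangent_transport[OF c])
    interpret ip: inner_product_form "local_rep A (retraction g) c (snd c p)"
      using retraction_local(2)[OF g] charts_atD[OF c] by blast
    show "retraction g p X Y = retraction g p Y X"
      unfolding retraction_coords[OF c XY] retraction_coords[OF c XY(2,1)] by (rule ip.sym)
    assume "X \<noteq> 0"
    then have "X c \<noteq> 0" using t.inv(2)[OF XY(1)] linear_0[OF t.lin(1)] by metis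
    then show "retraction g p X X > 0" unfolding retraction_coords[OF c XY(1,1)] by (rule ip.pos)
  qed
  have sm: "smooth_on (coords c) (\<lambda>x. local_rep A (retraction g) c x u w)" if c: "c \<in> A" for c u w
  proof (rule smooth_onI_param)
    have "g \<in> sym_tensors M A" using g unfolding riemannian_metric_def by blast
    \<comment> \<open>A single metric is a family over one point.\<close>
    then show "param_C_k k (discrete_topology {()}) (coords c) (\<lambda>_ x. local_rep A (retraction g) c x u w)" for k
      by (intro retraction_param[where \<G>="\<lambda>_. g", OF g _ c] smooth_on_imp_param sym_tensor_smooth)
  qed
  have "smooth_tensor2 M A (retraction g)"
    unfolding smooth_tensor2_def
  proof (intro conjI ballI allI impI)
    show "retraction g p X Y = 0" if "\<not> (p \<in> topspace M \<and> X \<in> tangent_space A p \<and> Y \<in> tangent_space A p)" for p X Y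
      unfolding retraction_def using that by (rule if_not_P)
  qed (fact retraction_bilinear[OF g] sm)+
  then have "riemannian_metric M A (retraction g)"
    unfolding riemannian_metric_def sym_tensors_def using pt by blast
  moreover have "compatible_form (tangent_space A p) n s (\<lambda>j. \<omega> j p) (retraction g p)" if p: "p \<in> topspace M" for p
  proof -
    obtain c where c: "c \<in> charts_at A p" using chart_cover[OF p] by blast
    have cA: "c \<in> A" "p \<in> fst c" using charts_atD[OF c] by auto
    interpret t: linear_transport UNIV "tangent_space A p" "coord_vector A c p" "\<lambda>X. X c"
      by (rule tangent_transport[OF c])
    show ?thesis
      by (rule compatible_form_cong[OF _ _ t.compatible_form_transport[OF retraction_local(3)[OF g cA]]])
        (simp_all add: retraction_coords[OF c])
  qed
  ultimately show ?thesis unfolding compatible_metrics_iff by blast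
qed

lemma retraction_fixed:
  assumes "g \<in> compatible_metrics M A n s \<omega>" shows "retraction g = g"
proof (intro ext)
  fix p X Y
  have g: "riemannian_metric M A g" using assms unfolding compatible_metrics_iff by blast
  show "retraction g p X Y = g p X Y"
  proof (cases "p \<in> topspace M \<and> X \<in> tangent_space A p \<and> Y \<in> tangent_space A p")
    case True
    then obtain c where c: "c \<in> charts_at A p" using chart_cover by blast
    have cA: "c \<in> A" "p \<in> fst c" using charts_atD[OF c] by auto
    interpret t': linear_transport "tangent_space A p" UNIV "\<lambda>X. X c" "coord_vector A c p"
      by (rule linear_transport.swap[OF tangent_transport[OF c]])
    interpret ip: inner_product_form "local_rep A g c (snd c p)" by (rule local_inner_product[OF g cA])
    have "compatible_form (tangent_space A p) n s (\<lambda>j. \<omega> j p) (g p)"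
      using assms True unfolding compatible_metrics_iff by blast
    from t'.compatible_form_transport[OF this]
    have "compatible_form UNIV n s (\<lambda>j. local_rep A (\<omega> j) c (snd c p)) (local_rep A g c (snd c p))"
      unfolding local_rep_fun[OF cA] .
    from ip.retract_unique[OF local_polysymplectic[OF cA] retraction_local(1)[OF g cA] ip.retract_fixed[OF this]]
    show ?thesis using True retraction_coords[OF c] by metis
  next
    case False
    have "g p X Y = 0" by (rule smooth_tensor2D(2)[OF riemannian_metricD(2)[OF g] False])
    moreover have "retraction g p X Y = 0" unfolding retraction_def by (rule if_not_P[OF False])
    ultimately show ?thesis by simp
  qed
qed

section \<open>Contraction along segments of metrics\<close>

definition segment :: "('m, 'e) tensor2 \<Rightarrow> ('m, 'e) tensor2 \<Rightarrow> real \<Rightarrow> ('m, 'e) tensor2" where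
  "segment g0 g r p X Y = (1 - r) * g0 p X Y + r * g p X Y"

lemma local_rep_segment:
  "local_rep A (segment g0 g r) c x u w = (1 - r) * local_rep A g0 c x u w + r * local_rep A g c x u w"
  by (simp add: local_rep_def segment_def Let_def)

lemma segment_metric:
  assumes g: "riemannian_metric M A g0" "riemannian_metric M A g" and r: "0 \<le> r" "r \<le> 1"
  shows "riemannian_metric M A (segment g0 g r)"
proof -
  note b = smooth_tensor2D(1)[OF riemannian_metricD(2)[OF g(1)]] smooth_tensor2D(1)[OF riemannian_metricD(2)[OF g(2)]]
  note z = smooth_tensor2D(2)[OF riemannian_metricD(2)[OF g(1)]] smooth_tensor2D(2)[OF riemannian_metricD(2)[OF g(2)]]
  note st = riemannian_metricD(1)[OF g(1)] riemannian_metricD(1)[OF g(2)]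
  note sy = riemannian_metricD(3)[OF g(1)] riemannian_metricD(3)[OF g(2)]
  note po = riemannian_metricD(4)[OF g(1)] riemannian_metricD(4)[OF g(2)]
  have "bilinear_form_on (tangent_space A p) (segment g0 g r p)" if p: "p \<in> topspace M" for p
    unfolding bilinear_form_on_def
  proof (intro ballI allI)
    fix X Y Z :: "('m, 'e) tvec" and a
    assume XYZ: "X \<in> tangent_space A p" "Y \<in> tangent_space A p" "Z \<in> tangent_space A p"
    show "segment g0 g r p (X + Y) Z = segment g0 g r p X Z + segment g0 g r p Y Z \<and>
        segment g0 g r p (a *\<^sub>R X) Z = a * segment g0 g r p X Z \<and>
        segment g0 g r p Z (X + Y) = segment g0 g r p Z X + segment g0 g r p Z Y \<and>
        segment g0 g r p Z (a *\<^sub>R X) = a * segment g0 g r p Z X"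
      unfolding segment_def bilinear_form_onD[OF b(1)[OF p] XYZ] bilinear_form_onD[OF b(2)[OF p] XYZ]
      by (simp add: algebra_simps)
  qed
  moreover have "smooth_on (coords c) (\<lambda>x. local_rep A (segment g0 g r) c x u w)" if c: "c \<in> A" for c u w
    unfolding local_rep_segment
    by (rule smooth_onI_param, intro param_C_k_add param_C_k_mult param_C_k_const open_coords[OF c]
        smooth_on_imp_param[OF sym_tensor_smooth[OF st(1) c]] smooth_on_imp_param[OF sym_tensor_smooth[OF st(2) c]])
  ultimately have "smooth_tensor2 M A (segment g0 g r)"
    unfolding smooth_tensor2_def by (intro conjI ballI allI impI) (simp_all add: segment_def z)
  moreover have "segment g0 g r p X X > 0" if "p \<in> topspace M" "X \<in> tangent_space A p" "X \<noteq> 0" for p X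
  \<comment> \<open>Strict positivity has to come from a summand with positive weight: from
    \<open>g\<close> if r > 0, and from \<open>g0\<close> if r = 0.\<close>
  proof (cases "r = 0")
    case False
    then show ?thesis
      unfolding segment_def using po[OF that] r by (intro add_nonneg_pos mult_nonneg_nonneg mult_pos_pos) auto
  qed (use po[OF that] in \<open>simp add: segment_def\<close>)
  ultimately show ?thesis
    unfolding riemannian_metric_def sym_tensors_def by (simp add: segment_def sy)
qed

lemma compatible_metrics_subset: "compatible_metrics M A n s \<omega> \<subseteq> sym_tensors M A"
  unfolding compatible_metrics_def riemannian_metric_def by blast

text \<open>The homotopy retracts the segment from \<open>g0\<close> to the variable metric. It ends
  correctly because the retraction fixes both endpoints, and its parameter space is the product of
  the unit interval with the space of compatible metrics.\<close>

lemma compatible_metrics_contractible: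
  assumes g0: "g0 \<in> compatible_metrics M A n s \<omega>"
  shows "contractible_space (subtopology (Cinf_topology M A) (compatible_metrics M A n s \<omega>))"
proof -
  let ?C = "compatible_metrics M A n s \<omega>"
  let ?X = "subtopology (Cinf_topology M A) ?C"
  let ?T = "prod_topology (top_of_set {0..1::real}) ?X"
  define H where "H = (\<lambda>z. retraction (segment g0 (snd z) (fst z)))"
  have topX: "topspace ?X = ?C" using compatible_metrics_subset by (simp add: topspace_Cinf Int_absorb1)
  have rm: "riemannian_metric M A g" if "g \<in> ?C" for g using that unfolding compatible_metrics_iff by blast
  have sT: "riemannian_metric M A (segment g0 (snd z) (fst z))" if "z \<in> topspace ?T" for z
  proof (rule segment_metric[OF rm[OF g0] rm])
    have "fst z \<in> {0..1}" "snd z \<in> topspace ?X" using that by (simp_all add: topspace_prod_topology mem_Times_iff del: topspace_subtopology)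
    then show "snd z \<in> ?C" "0 \<le> fst z" "fst z \<le> 1" using topX by simp_all
  qed
  have HC: "H z \<in> ?C" if "z \<in> topspace ?T" for z
    unfolding H_def by (rule retraction_compatible[OF sT[OF that]])
  have "continuous_map ?T (Cinf_topology M A) H"
  proof (rule continuous_map_Cinf)
    show "H z \<in> sym_tensors M A" if "z \<in> topspace ?T" for z using HC[OF that] compatible_metrics_subset by blast
    fix c u w k assume c: "c \<in> A"
    show "param_C_k k ?T (coords c) (\<lambda>z x. local_rep A (H z) c x u w)"
      unfolding H_def
    proof (rule retraction_param[OF sT _ c])
      fix c u w k assume c: "c \<in> A"
      note U = open_coords[OF c]
      have g0s: "g0 \<in> sym_tensors M A" using g0 compatible_metrics_subset by blast
      have "continuous_map ?T (Cinf_topology M A) snd"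
        using continuous_map_into_fulltopology[OF continuous_map_snd] .
      \<comment> \<open>The second coordinate of the parameter is itself a tensor, so its local
        components form a pullback of the universal family.\<close>
      from param_C_k_reparam[OF this param_C_k_Cinf[OF c]]
      have 1: "param_C_k k ?T (coords c) (\<lambda>z x. local_rep A (snd z) c x u w)" .
      have f: "continuous_map ?T euclidean fst"
        using continuous_map_into_fulltopology[OF continuous_map_fst] .
      have 2: "param_C_k k ?T (coords c) (\<lambda>z x. fst z)" by (rule param_C_k_param[OF U f])
      show "param_C_k k ?T (coords c) (\<lambda>z x. local_rep A (segment g0 (snd z) (fst z)) c x u w)"
        unfolding local_rep_segment
        by (intro param_C_k_add param_C_k_mult param_C_k_diff param_C_k_const U 1 2
            smooth_on_imp_param[OF sym_tensor_smooth[OF g0s c]])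
    qed
  qed
  then have cont: "continuous_map ?T ?X H"
    using HC by (auto simp: continuous_map_in_subtopology)
  have fix0: "H (0, g) = g0" if "g \<in> ?C" for g
  proof -
    have "segment g0 g 0 = g0" by (intro ext) (simp add: segment_def)
    then show ?thesis using retraction_fixed[OF g0] by (simp add: H_def)
  qed
  have fix1: "H (1, g) = g" if "g \<in> ?C" for g
  proof -
    have "segment g0 g 1 = g" by (intro ext) (simp add: segment_def)
    then show ?thesis using retraction_fixed[OF that] by (simp add: H_def)
  qed
  have "homotopic_with (\<lambda>_. True) ?X ?X (\<lambda>_. g0) (\<lambda>x. x)"
  proof (subst homotopic_with)
    show "\<exists>h. continuous_map ?T ?X h \<and> (\<forall>x\<in>topspace ?X. h (0, x) = g0) \<and> (\<forall>x\<in>topspace ?X. h (1, x) = x) \<and>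
        (\<forall>t\<in>{0..1}. True)"
      unfolding topX by (intro exI[of _ H] conjI ballI TrueI cont fix0 fix1)
  qed simp
  then have "homotopic_with (\<lambda>_. True) ?X ?X id (\<lambda>_. g0)"
    unfolding id_def by (rule homotopic_with_symD)
  then show ?thesis unfolding contractible_space_def by blast
qed

end

theorem theorem6p3:
  fixes M :: "'m topology"
    and A :: "('m, 'e::euclidean_space) chart set"
    and n s :: nat
    and \<omega> :: "nat \<Rightarrow> ('m, 'e) tensor2"
  assumes "polysymplectic_manifold M A n s \<omega>"
  shows "compatible_metrics M A n s \<omega> \<noteq> {} \<and>
    contractible_space (subtopology (Cinf_topology M A) (compatible_metrics M A n s \<omega>))"
proof -
  interpret polysymplectic M A n s \<omega>
    by unfold_locales (use assms in \<open>simp_all add: polysymplectic_manifold_def\<close>)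
  obtain g where "riemannian_metric M A g" using riemannian_metric_exists by blast
  from retraction_compatible[OF this] show ?thesis
    using compatible_metrics_contractible by blast
qed

end
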